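(* Consider a translationally invariant Gaussian fermion sequential circuit of staircase type, i.e. one whose corresponding 1D channel circuit is a brick-wall Gaussian fermion channel circuit, translation invariant by one unit cell (two sites) in space and by two steps in time, with one-period momentum-space data $(A_k,B_k)$. Then, in the thermodynamic limit (momentum $k$ ranging over $\mathbb{R}/2\pi\mathbb{Z}$), the bulk entanglement spectrum of the prepared 2D state is continuous in $k$ up to removable singularities. In particular, the bulk entanglement spectrum is non-chiral.
   Context: **Setting.** Each site of a ring hosts $n$ Majorana modes; a unit cell consists of two sites ($2n$ modes). A Gaussian fermion channel acts on real antisymmetric correlation matrices ($\Gamma\Gamma^T\le I$) by $\Gamma\mapsto \mathsf A+\mathsf B\Gamma \mathsf B^T$, with $\mathsf A$ real antisymmetric, $\mathsf B$ real, and the CPTP condition $\Lambda^T\Lambda\le I$ for $\Lambda=\begin{pmatrix}\mathsf A&\mathsf B\\ -\mathsf B^T&0\end{pmatrix}$. In odd time steps a two-site channel $(\mathsf A_o,\mathsf B_o)$ ($2n\times 2n$ matrices) acts on the two sites of every unit cell; in even time steps a two-site channel $(\mathsf A_e,\mathsf B_e)$ acts on every pair formed by the second site of a cell and the first site of the next one. The sequential circuit is a purification (Stinespring dilation) of this channel circuit: each local channel is implemented by a local Gaussian unitary coupling the chain to fresh environment modes, and the environment modes of all steps form the 2D state, whose rows correspond to time steps. **Momentum space.** With $U_k=\begin{pmatrix}0&I_n\\ e^{-ik}I_n&0\end{pmatrix}$, one period (two steps) acts on the momentum-space correlation matrix $\Gamma_k$ ($2n\times2n$, $\Gamma_k^\dagger=-\Gamma_k$,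 $\Gamma_k\Gamma_k^\dagger\le I$) by $\Gamma_k\mapsto A_k+B_k\Gamma_kB_k^\dagger$, where $B_k=U_k\mathsf B_eU_k^\dagger\,\mathsf B_o$ and $A_k=U_k\mathsf A_eU_k^\dagger+U_k\mathsf B_eU_k^\dagger\,\mathsf A_o\,U_k\mathsf B_e^TU_k^\dagger$. These are trigonometric polynomials in $k$ and satisfy $A_k^\dagger A_k+B_kB_k^\dagger\le I$ and $B_k^\dagger B_k\le I$ for real $k$. **Preserved and dissipative modes.** $V_{k,u}\subset\mathbb{C}^{2n}$ is the span of the eigenvectors of $B_k$ with eigenvalues of modulus $1$, $V_{k,d}=V_{k,u}^\perp$, and $P_{k,d}$ is the orthogonal projector onto $V_{k,d}$, which commutes with $A_k$ and $B_k$. The restriction of $B_k$ to $V_{k,d}$ has spectral radius less than $1$. The dissipative steady-state correlation matrix $\Gamma^{(\mathrm s)}_{k,d}$ is the unique operator on $V_{k,d}$ solving $\Gamma^{(\mathrm s)}_{k,d}=P_{k,d}A_k+P_{k,d}B_k\,\Gamma^{(\mathrm s)}_{k,d}\,B_k^\dagger P_{k,d}$. **Bulk entanglement spectrum.** At momentum $k$ it is the multiset of eigenvalues, in $[-\infty,+\infty]$, of $h_{\mathrm{bulk},k}=\log\frac{I-i\Gamma^{(\mathrm s)}_{k,d}}{I+i\Gamma^{(\mathrm s)}_{k,d}}$ on $V_{k,d}$; here $i\Gamma^{(\mathrm s)}_{k,d}$ is Hermitian with spectrum in $[-1,1]$, and the eigenvalues $\mp1$ of $i\Gamma^{(\mathrm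 s)}_{k,d}$ correspond to $\pm\infty$. **Terminology.** "Continuous up to removable singularities" means: there is a finite set $F\subset\mathbb{R}/2\pi\mathbb{Z}$ such that off $F$ the number of eigenvalues is constant and the multiset of eigenvalues depends continuously on $k$ (in the topology of $[-\infty,+\infty]$), and at each $k_0\in F$ the left and right limits of the multiset exist in $[-\infty,+\infty]$ and coincide (so a branch diverging to the same one of $+\infty$ or $-\infty$ on both sides of a momentum is allowed, while a jump of a branch, e.g. from $+\infty$ to $-\infty$, is not). "Chiral" means that the net signed number of times the continuous eigenvalue branches cross a given finite level as $k$ traverses the Brillouin zone once is nonzero, which is only compatible with periodicity if some branch jumps discontinuously (e.g. from $+\infty$ to $-\infty$); "non-chiral" means not chiral. *)

theory Defs
  imports "HOL-Analysis.Analysis"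
begin

section \<open>Gaussian fermion channels\<close>

definition block_matrix ::
  "'a^'c^'r \<Rightarrow> 'a^'d^'r \<Rightarrow> 'a^'c^'s \<Rightarrow> 'a^'d^'s \<Rightarrow> 'a^('c + 'd)^('r + 's)" where
  "block_matrix A B C D = (\<chi> i j. case i of
      Inl r \<Rightarrow> (case j of Inl c \<Rightarrow> A $ r $ c | Inr d \<Rightarrow> B $ r $ d)
    | Inr s \<Rightarrow> (case j of Inl c \<Rightarrow> C $ s $ c | Inr d \<Rightarrow> D $ s $ d))"

definition loewner_le :: "real^'m^'m \<Rightarrow> real^'m^'m \<Rightarrow> bool" where
  "loewner_le M N \<longleftrightarrow> transpose (N - M) = N - M \<and> (\<forall>v. 0 \<le> v \<bullet> ((N - M) *v v))"

definition gaussian_channel :: "real^'m^'m \<Rightarrow> real^'m^'m \<Rightarrow> bool" where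
  "gaussian_channel A B \<longleftrightarrow> transpose A = - A \<and>
     (let L = block_matrix A B (- transpose B) 0 in loewner_le (transpose L ** L) (mat 1))"


section \<open>Momentum space\<close>

text \<open>A site carries the modes indexed by \<open>'n\<close>; in the unit cell \<open>'n + 'n\<close>, \<open>Inl\<close> is the first
  site and \<open>Inr\<close> the second. For the even channel, \<open>Inl\<close> is the second site of a cell and
  \<open>Inr\<close> the first site of the next one.\<close>

definition ctranspose :: "complex^'c^'r \<Rightarrow> complex^'r^'c" where
  "ctranspose M = map_matrix cnj (transpose M)"

definition cmatrix :: "real^'c^'r \<Rightarrow> complex^'c^'r" where
  "cmatrix M = map_matrix complex_of_real M"

definition U_mat :: "real \<Rightarrow> complex^('n::finite + 'n)^('n + 'n)" where
  "U_mat k = block_matrix 0 (mat 1) (mat (exp (- (\<i> * of_real k)))) 0"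

definition B_mat :: "real^('n::finite + 'n)^('n + 'n) \<Rightarrow> real^('n + 'n)^('n + 'n) \<Rightarrow> real
    \<Rightarrow> complex^('n + 'n)^('n + 'n)" where
  "B_mat Bo Be k = U_mat k ** cmatrix Be ** ctranspose (U_mat k) ** cmatrix Bo"

definition A_mat :: "real^('n::finite + 'n)^('n + 'n) \<Rightarrow> real^('n + 'n)^('n + 'n)
    \<Rightarrow> real^('n + 'n)^('n + 'n) \<Rightarrow> real \<Rightarrow> complex^('n + 'n)^('n + 'n)" where
  "A_mat Ao Ae Be k =
     U_mat k ** cmatrix Ae ** ctranspose (U_mat k)
   + U_mat k ** cmatrix Be ** ctranspose (U_mat k) ** cmatrix Ao
       ** U_mat k ** cmatrix (transpose Be) ** ctranspose (U_mat k)"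


section \<open>Preserved and dissipative modes, steady state\<close>

text \<open>The inner product \<open>\<bullet>\<close> on \<open>complex^'m\<close> is the real one, hence the explicit Hermitian form.
  \<open>vec.span\<close> and \<open>vec.dim\<close> are over the complex field.\<close>

definition hinner :: "complex^'m \<Rightarrow> complex^'m \<Rightarrow> complex" where
  "hinner v w = (\<Sum>i\<in>UNIV. cnj (v $ i) * w $ i)"

definition preserved_space :: "complex^'m^'m \<Rightarrow> (complex^'m) set" where
  "preserved_space B = vec.span {v. v \<noteq> 0 \<and> (\<exists>z. cmod z = 1 \<and> B *v v = z *s v)}"

definition dissipative_space :: "complex^'m^'m \<Rightarrow> (complex^'m) set" where
  "dissipative_space B = {w. \<forall>v\<in>preserved_space B. hinner v w = 0}"

definition orth_projector :: "(complex^'m) set \<Rightarrow> complex^'m^'m" where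
  "orth_projector V = (THE P. P ** P = P \<and> ctranspose P = P \<and> range ((*v) P) = V)"

text \<open>Operators on the dissipative space are represented by matrices \<open>G = P ** G ** P\<close>, i.e.
  extended by zero to the preserved space.\<close>

definition steady_state :: "complex^'m^'m \<Rightarrow> complex^'m^'m \<Rightarrow> complex^'m^'m" where
  "steady_state A B = (let V = dissipative_space B; P = orth_projector V in
     THE G. G = P ** G ** P \<and>
       (\<forall>v\<in>V. G *v v = (P ** A + P ** B ** G ** ctranspose B ** P) *v v))"


section \<open>Bulk entanglement spectrum\<close>

text \<open>Eigenvalues of \<open>M\<close> on an invariant subspace \<open>V\<close>, with geometric multiplicities; used for
  Hermitian \<open>M\<close> only.\<close>

definition eigenvalues_on :: "(complex^'m) set \<Rightarrow> complex^'m^'m \<Rightarrow> complex multiset" where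
  "eigenvalues_on V M = (\<Sum>z | \<exists>v\<in>V. v \<noteq> 0 \<and> M *v v = z *s v.
     replicate_mset (vec.dim {v\<in>V. M *v v = z *s v}) z)"

text \<open>\<open>log ((1 - x) / (1 + x))\<close> with the values at \<open>x = -1\<close> and \<open>x = 1\<close> in the extended reals.\<close>

definition entanglement_energy :: "real \<Rightarrow> ereal" where
  "entanglement_energy x =
     (if x = -1 then \<infinity> else if x = 1 then -\<infinity> else ereal (ln ((1 - x) / (1 + x))))"

definition bulk_entanglement_spectrum ::
  "real^('n::finite + 'n)^('n + 'n) \<Rightarrow> real^('n + 'n)^('n + 'n) \<Rightarrow> real^('n + 'n)^('n + 'n)
    \<Rightarrow> real^('n + 'n)^('n + 'n) \<Rightarrow> real \<Rightarrow> ereal multiset" where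
  "bulk_entanglement_spectrum Ao Bo Ae Be k =
     (let A = A_mat Ao Ae Be k; B = B_mat Bo Be k in
      image_mset (\<lambda>z. entanglement_energy (Re z))
        (eigenvalues_on (dissipative_space B) (map_matrix ((*) \<i>) (steady_state A B))))"


section \<open>Continuity up to removable singularities\<close>

text \<open>Convergence in the quotient topology on unordered tuples: eventually the points of \<open>S k\<close>
  can be matched one-to-one with those of \<open>M\<close> such that matched points are close.\<close>

definition mset_tendsto ::
  "('k \<Rightarrow> 'a::topological_space multiset) \<Rightarrow> 'a multiset \<Rightarrow> 'k filter \<Rightarrow> bool" where
  "mset_tendsto S M G \<longleftrightarrow>
     (\<forall>N. (\<forall>x\<in>#M. open (N x) \<and> x \<in> N x) \<longrightarrow>
        (\<forall>\<^sub>F k in G. rel_mset (\<lambda>x y. y \<in> N x) M (S k)))"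

text \<open>Subsets of the Brillouin zone \<open>\<real> / 2\<pi>\<int>\<close> are represented by \<open>2\<pi>\<close>-periodic sets of
  reals.\<close>

definition continuous_up_to_removable :: "(real \<Rightarrow> 'a::topological_space multiset) \<Rightarrow> bool" where
  "continuous_up_to_removable S \<longleftrightarrow>
     (\<exists>F. (\<forall>k. k + 2 * pi \<in> F \<longleftrightarrow> k \<in> F) \<and> finite (F \<inter> {0..<2 * pi}) \<and>
        (\<exists>m. \<forall>k. k \<notin> F \<longrightarrow> size (S k) = m) \<and>
        (\<forall>k. k \<notin> F \<longrightarrow> mset_tendsto S (S k) (at k)) \<and>
        (\<forall>k\<in>F. \<exists>M. mset_tendsto S M (at_left k) \<and> mset_tendsto S M (at_right k)))"


section \<open>Chirality\<close>

text \<open>One traversal of the Brillouin zone is cut at \<open>p 0 < \<dots> < p N = p 0 + 2\<pi>\<close>; on the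
  segment \<open>j\<close> the \<open>m\<close> eigenvalues are the values of the continuous branches
  \<open>\<beta> j 0, \<dots>, \<beta> j (m - 1)\<close>. Jumps and isolated exceptional momenta are allowed at the cuts only,
  where the end values of the branches are the one-sided limits.\<close>

definition eigenvalue_branches :: "(real \<Rightarrow> ereal multiset) \<Rightarrow> nat \<Rightarrow> (nat \<Rightarrow> real) \<Rightarrow> nat
    \<Rightarrow> (nat \<Rightarrow> nat \<Rightarrow> real \<Rightarrow> ereal) \<Rightarrow> bool" where
  "eigenvalue_branches S N p m \<beta> \<longleftrightarrow>
     (\<forall>j<N. p j < p (Suc j)) \<and> p N = p 0 + 2 * pi \<and>
     (\<forall>j<N. \<forall>i<m. continuous_on {p j..p (Suc j)} (\<beta> j i)) \<and>
     (\<forall>j<N. \<forall>k\<in>{p j<..<p (Suc j)}. S k = image_mset (\<lambda>i. \<beta> j i k) (mset_set {..<m}))"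

text \<open>A crossing of the level \<open>c\<close> is a passage between \<open>{f < c}\<close> and \<open>{f \<ge> c}\<close>. This half-open
  convention gives every passage through \<open>c\<close> a definite momentum also if \<open>f\<close> stays at \<open>c\<close> for a
  while or reaches \<open>c\<close> at a cut. A branch touching \<open>c\<close> from below crosses both up and down. Since
  only continuous branches are considered, jumps between segments do not count as crossings.\<close>

definition up_crossings :: "(real \<Rightarrow> ereal) \<Rightarrow> real \<Rightarrow> real \<Rightarrow> real \<Rightarrow> real set" where
  "up_crossings f c a b =
     {t. a < t \<and> t \<le> b \<and> f t \<ge> ereal c \<and> (\<forall>\<^sub>F s in at_left t. f s < ereal c)}"

definition down_crossings :: "(real \<Rightarrow> ereal) \<Rightarrow> real \<Rightarrow> real \<Rightarrow> real \<Rightarrow> real set" where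
  "down_crossings f c a b =
     {t. a \<le> t \<and> t < b \<and> f t \<ge> ereal c \<and> (\<forall>\<^sub>F s in at_right t. f s < ereal c)}"

definition net_crossings ::
  "nat \<Rightarrow> (nat \<Rightarrow> real) \<Rightarrow> nat \<Rightarrow> (nat \<Rightarrow> nat \<Rightarrow> real \<Rightarrow> ereal) \<Rightarrow> real \<Rightarrow> int" where
  "net_crossings N p m \<beta> c = (\<Sum>j<N. \<Sum>i<m.
     int (card (up_crossings (\<beta> j i) c (p j) (p (Suc j))))
     - int (card (down_crossings (\<beta> j i) c (p j) (p (Suc j)))))"

text \<open>The finiteness condition says that the crossings can be counted (\<open>card\<close> of an infinite set
  is \<open>0\<close>).\<close>

definition chiral :: "(real \<Rightarrow> ereal multiset) \<Rightarrow> bool" where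
  "chiral S \<longleftrightarrow> (\<exists>N p m \<beta> c. eigenvalue_branches S N p m \<beta> \<and>
     (\<forall>j<N. \<forall>i<m. finite (up_crossings (\<beta> j i) c (p j) (p (Suc j))) \<and>
                    finite (down_crossings (\<beta> j i) c (p j) (p (Suc j)))) \<and>
     net_crossings N p m \<beta> c \<noteq> 0)"

end

theory Submission
  imports Defs "HOL-Computational_Algebra.Polynomial"
begin

text \<open>Fix \<open>k\<close>, let \<open>P\<close> be the projector onto the dissipative space and \<open>G\<close> the steady state, extended by
  zero. Complete positivity gives \<open>I - B B\<^sup>\<dagger> \<plusminus> \<i> A \<ge> 0\<close>, and a Lyapunov argument turns this into
  \<open>P \<plusminus> \<i> G \<ge> 0\<close>. Hence \<open>H = \<i> G + 2 (I - P)\<close> is Hermitian with spectrum in \<open>[-1, 1] \<union> {2}\<close>, and its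
  entries are bounded uniformly in \<open>k\<close>. As the limit of the resolvent \<open>(\<epsilon> + 1 - B \<sqdot> B\<^sup>\<dagger>)\<^sup>-\<^sup>1\<close> on a
  trigonometric polynomial for \<open>\<epsilon> \<rightarrow> 0\<close>, \<open>H\<close> is a rational function of \<open>e\<^sup>i\<^sup>k\<close>. Being bounded, it has
  only removable singularities, so off finitely many momenta it agrees with a continuous periodic
  family of Hermitian matrices, whose eigenvalues depend continuously on \<open>k\<close>.

  A continuous branch crosses a level a net number of times given by its end points. Since the limit
  multisets match at every cut, the net crossings telescope to zero around the Brillouin zone.\<close>

section \<open>Hermitian matrices and contractions\<close>

text \<open>The obstacle is that \<open>P\<close> and the dimension of the dissipative space can
  jump, and that \<open>X \<mapsto> X - B X B\<^sup>\<dagger>\<close> is singular whenever there are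
  preserved modes, possibly at every momentum. So neither \<open>P\<close> nor \<open>G\<close> is
  visibly rational in \<open>cis k\<close>. The way out is that \<open>P\<close> itself solves a
  Stein equation, with source \<open>E = I - B B\<^sup>\<dagger>\<close>. Hence
  \<open>H - 2 I = \<i> G - 2 P\<close> has the source \<open>\<i> A - 2 E\<close>, which contains
  no projector, and the shift by \<open>\<epsilon> > 0\<close> makes the Stein map invertible at all
  momenta. The lowest nonzero coefficient of its determinant in \<open>\<epsilon>\<close> gives one
  denominator for all entries. The constant 2 stands for a value outside \<open>[-1, 1]\<close>: the
  gap keeps preserved and dissipative eigenvalues apart in limits, so a matrix of fixed size records
  a spectrum whose size varies. As \<open>entanglement_energy\<close> is continuous from
  \<open>[-1, 1]\<close> to the extended reals, a two-sided limit of \<open>H\<close> also excludes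
  a jump between the two infinities.\<close>

lemma hinner_add_right: "hinner x (y + z) = hinner x y + hinner x z"
  by (simp add: hinner_def algebra_simps sum.distrib)

lemma hinner_diff_right: "hinner x (y - z) = hinner x y - hinner x z"
  by (simp add: hinner_def algebra_simps sum_subtractf)

lemma hinner_scale_right [simp]: "hinner x (c *s y) = c * hinner x y"
  by (simp add: hinner_def sum_distrib_left mult_ac)

lemma hinner_scale_left [simp]: "hinner (c *s x) y = cnj c * hinner x y"
  by (simp add: hinner_def sum_distrib_left mult_ac)

lemma hinner_zero [simp]: "hinner 0 y = 0" "hinner y 0 = 0"
  by (simp_all add: hinner_def)

lemma cnj_hinner: "cnj (hinner x y) = hinner y x"
  by (simp add: hinner_def mult.commute)

lemma hinner_sum_right: "hinner x (\<Sum>i\<in>I. f i) = (\<Sum>i\<in>I. hinner x (f i))"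
  by (induction I rule: infinite_finite_induct) (simp_all add: hinner_add_right)

lemma inner_eq_Re_hinner: "x \<bullet> y = Re (hinner x y)"
  by (simp add: hinner_def inner_vec_def inner_complex_def)

lemma hinner_self: "hinner x x = complex_of_real ((norm x)\<^sup>2)"
proof -
  have "Im (hinner x x) = 0"
    by (simp add: hinner_def mult.commute)
  then show ?thesis
    by (simp add: complex_eq_iff power2_norm_eq_inner inner_eq_Re_hinner)
qed

lemma hinner_self_eq_0 [simp]: "hinner x x = 0 \<longleftrightarrow> x = 0"
  by (simp add: hinner_self)

lemma norm_smult_cvec: "norm (c *s x) = cmod c * norm x" for x :: "complex^'m"
proof -
  have "complex_of_real ((norm (c *s x))\<^sup>2) = hinner (c *s x) (c *s x)"
    by (simp only: hinner_self)
  also have "\<dots> = cnj c * c * hinner x x"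
    by simp
  also have "\<dots> = complex_of_real ((cmod c * norm x)\<^sup>2)"
    by (simp add: hinner_self power_mult_distrib complex_norm_square[of c] mult.commute del: of_real_power)
  finally have "(norm (c *s x))\<^sup>2 = (cmod c * norm x)\<^sup>2"
    using of_real_eq_iff by blast
  then show ?thesis
    by (simp add: power2_eq_iff_nonneg)
qed

lemma scaleR_cvec: "r *\<^sub>R x = complex_of_real r *s x" for x :: "complex^'m"
  by (simp add: vec_eq_iff complex_eq_iff)

lemma matrix_vector_mult_smult: "M *v (c *s x) = c *s (M *v x)" for x :: "complex^'m"
  by (simp add: matrix_vector_mult_def vec_eq_iff sum_distrib_left mult_ac)

lemma matrix_vector_mult_uminus [simp]: "M *v (- x) = - (M *v x)" for x :: "complex^'m"
  by (simp add: matrix_vector_mult_def vec_eq_iff sum_negf)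

lemma matrix_vector_mult_scaleR: "M *v (c *\<^sub>R x) = c *\<^sub>R (M *v x)" for x :: "complex^'m"
  by (simp add: scaleR_cvec matrix_vector_mult_smult)

lemma ctranspose_nth [simp]: "ctranspose M $ i $ j = cnj (M $ j $ i)"
  by (simp add: ctranspose_def map_matrix_def transpose_def)

lemma ctranspose_ctranspose [simp]: "ctranspose (ctranspose M) = M"
  by (simp add: vec_eq_iff)

lemma ctranspose_mult: "ctranspose (M ** N) = ctranspose N ** ctranspose M"
  by (simp add: vec_eq_iff matrix_matrix_mult_def mult.commute)

lemma ctranspose_add: "ctranspose (M + N) = ctranspose M + ctranspose N"
  by (simp add: vec_eq_iff)

lemma ctranspose_diff: "ctranspose (M - N) = ctranspose M - ctranspose N"
  by (simp add: vec_eq_iff)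

lemma ctranspose_uminus: "ctranspose (- M) = - ctranspose M"
  by (simp add: vec_eq_iff)

lemma ctranspose_mat [simp]: "ctranspose (mat c) = mat (cnj c)"
  by (simp add: vec_eq_iff mat_def)

lemma hinner_ctranspose: "hinner x (M *v y) = hinner (ctranspose M *v x) y"
  for M :: "complex^'c^'r"
proof -
  have "hinner x (M *v y) = (\<Sum>i\<in>UNIV. \<Sum>j\<in>UNIV. cnj (x $ i) * (M $ i $ j * y $ j))"
    by (simp add: hinner_def matrix_vector_mult_def sum_distrib_left)
  also have "\<dots> = (\<Sum>j\<in>UNIV. \<Sum>i\<in>UNIV. cnj (x $ i) * (M $ i $ j * y $ j))"
    by (rule sum.swap)
  also have "\<dots> = hinner (ctranspose M *v x) y"
    by (simp add: hinner_def matrix_vector_mult_def sum_distrib_left sum_distrib_right mult_ac)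
  finally show ?thesis .
qed

lemma inner_ctranspose: "x \<bullet> (M *v y) = (ctranspose M *v x) \<bullet> y" for M :: "complex^'c^'r"
  by (simp add: inner_eq_Re_hinner hinner_ctranspose)

lemma matrix_eqI: "(\<And>x. M *v x = N *v x) \<Longrightarrow> M = N" for M N :: "complex^'c^'r"
  by (simp add: matrix_eq)

section \<open>Positive semidefinite forms and the variational principle\<close>

abbreviation hermitian :: "complex^'m^'m \<Rightarrow> bool" where
  "hermitian M \<equiv> ctranspose M = M"

lemma subspace_of_vec_subspace: "vec.subspace V \<Longrightarrow> subspace V" for V :: "(complex^'m) set"
  by (simp add: vec.subspace_def real_vector.subspace_def scaleR_cvec)

text \<open>A form that is nonnegative on \<open>V\<close> has a minimum where it vanishes, so its
  derivative along every \<open>w\<close> in \<open>V\<close> is zero there. \<open>K\<close> may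
  map \<open>V\<close> out of itself, hence \<open>K *v v\<close> is tested against \<open>V\<close>
  only.\<close>

lemma psd_kernel:
  fixes K :: "complex^'m^'m"
  assumes "hermitian K" "subspace V" and psd: "\<And>w. w \<in> V \<Longrightarrow> 0 \<le> w \<bullet> (K *v w)"
    and "v \<in> V" "v \<bullet> (K *v v) = 0" "w \<in> V"
  shows "w \<bullet> (K *v v) = 0"
proof -
  define a c where "a = w \<bullet> (K *v v)" and "c = w \<bullet> (K *v w)"
  have sym: "v \<bullet> (K *v w) = a"
    using assms(1) inner_ctranspose[of v K w] inner_commute[of w] by (simp add: a_def)
  have c: "c \<ge> 0"
    using psd assms(6) by (simp add: c_def)
  \<comment> \<open>Close to the minimizer \<open>- a / c\<close> of
    \<open>2 t a + t\<^sup>2 c\<close>; the \<open>+ 1\<close> covers \<open>c = 0\<close>.\<close>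
  define t where "t = - a / (c + 1)"
  have "v + t *\<^sub>R w \<in> V"
    using assms by (simp add: subspace_add subspace_scale)
  from psd[OF this] have "0 \<le> (v + t *\<^sub>R w) \<bullet> (K *v v + t *\<^sub>R (K *v w))"
    by (simp only: matrix_vector_right_distrib matrix_vector_mult_scaleR)
  also have "\<dots> = v \<bullet> (K *v v) + 2 * t * a + t\<^sup>2 * c"
    unfolding c_def by (simp add: inner_add_left inner_add_right sym power2_eq_square)
      (simp add: a_def algebra_simps)
  also have "\<dots> = 2 * t * a + t\<^sup>2 * c"
    using assms(5) by simp
  also have "\<dots> = - (a\<^sup>2 * (c + 2)) / (c + 1)\<^sup>2"
    using c by (simp add: t_def divide_simps power2_eq_square) algebra
  finally have "a\<^sup>2 * (c + 2) \<le> 0"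
    using c by (simp add: field_simps zero_le_divide_iff)
  then have "a = 0"
    using c by (simp add: mult_le_0_iff)
  then show ?thesis
    by (simp add: a_def)
qed

lemma psd_kernel_UNIV:
  fixes K :: "complex^'m^'m"
  assumes "hermitian K" and psd: "\<And>w. 0 \<le> w \<bullet> (K *v w)" and "v \<bullet> (K *v v) = 0"
  shows "K *v v = 0"
  using psd_kernel[of K UNIV v "K *v v"] assms by simp

text \<open>Rayleigh principle: at a maximizer \<open>v\<close> of the form on the unit sphere of
  \<open>V\<close>, with maximum \<open>x\<close>, the form of \<open>K = x - H\<close> is
  nonnegative on \<open>V\<close> and vanishes at \<open>v\<close>. By invariance
  \<open>K *v v\<close> lies in \<open>V\<close>, so it is orthogonal to itself.\<close>

lemma hermitian_eigenvector:
  fixes H :: "complex^'m^'m"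
  assumes H: "hermitian H" and V: "vec.subspace V" and inv: "\<And>v. v \<in> V \<Longrightarrow> H *v v \<in> V"
    and ne: "u \<in> V" "u \<noteq> 0"
  obtains v x where "v \<in> V" "norm v = 1" "H *v v = complex_of_real x *s v"
proof -
  let ?S = "sphere 0 1 \<inter> V"
  have sV: "subspace V"
    by (rule subspace_of_vec_subspace[OF V])
  have "compact ?S"
    using compact_Int_closed[OF compact_sphere closed_subspace[OF sV]] .
  moreover have "(1 / norm u) *\<^sub>R u \<in> ?S"
    using ne sV by (auto simp: subspace_scale)
  then have "?S \<noteq> {}"
    by blast
  moreover have "continuous_on ?S (\<lambda>v. v \<bullet> (H *v v))"
    by (intro continuous_on_inner continuous_on_id linear_continuous_on
        matrix_vector_mul_bounded_linear)
  ultimately obtain v where v: "v \<in> ?S" and max: "\<And>w. w \<in> ?S \<Longrightarrow> w \<bullet> (H *v w) \<le> v \<bullet> (H *v v)"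
    by (meson continuous_attains_sup)
  define x where "x = v \<bullet> (H *v v)"
  define K where "K = mat (complex_of_real x) - H"
  have Kv: "K *v w = x *\<^sub>R w - H *v w" for w
    by (simp add: K_def matrix_vector_mult_diff_rdistrib scaleR_cvec vec_eq_iff)
       (simp add: matrix_vector_mult_def mat_def if_distrib[of "\<lambda>z. z * _"] cong: if_cong)
  have hK: "hermitian K"
    by (simp add: K_def ctranspose_diff H)
  have psd: "0 \<le> w \<bullet> (K *v w)" if "w \<in> V" for w
  proof (cases "w = 0")
    case False
    let ?w = "(1 / norm w) *\<^sub>R w"
    have "?w \<in> ?S"
      using that False sV by (auto simp: subspace_scale)
    from max[OF this] have "(1 / norm w)\<^sup>2 * (w \<bullet> (H *v w)) \<le> x"
      by (simp add: matrix_vector_mult_scaleR x_def power2_eq_square)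
    then have "w \<bullet> (H *v w) \<le> x * (norm w)\<^sup>2"
      using False by (simp add: field_simps)
    then show ?thesis
      by (simp add: Kv inner_diff_right power2_norm_eq_inner)
  qed simp
  have vK: "v \<bullet> (K *v v) = 0"
    using v by (simp only: Kv inner_diff_right) (simp add: x_def norm_eq_1)
  have KV: "K *v v \<in> V"
    using v sV inv by (simp add: Kv subspace_diff subspace_scale)
  have "(K *v v) \<bullet> (K *v v) = 0"
    using psd_kernel[OF hK sV psd _ vK KV] v by simp
  then have "H *v v = complex_of_real x *s v"
    by (simp add: Kv scaleR_cvec)
  with v that[of v x] show ?thesis
    by simp
qed

lemma mat_mult_vec [simp]: "mat c *v x = c *s x" for x :: "complex^'m"
  by (simp add: matrix_vector_mult_def mat_def vec_eq_iff if_distrib[of "\<lambda>z. z * _"] cong: if_cong)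

section \<open>Contractions and their eigenvalues on the unit circle\<close>

definition contraction :: "complex^'c^'r \<Rightarrow> bool" where
  "contraction C \<longleftrightarrow> (\<forall>v. norm (C *v v) \<le> norm v)"

lemma contraction_ctranspose:
  assumes "contraction C"
  shows "contraction (ctranspose C)"
  unfolding contraction_def
proof
  fix v
  let ?w = "ctranspose C *v v"
  have "(norm ?w)\<^sup>2 = v \<bullet> (C *v ?w)"
    by (simp only: inner_ctranspose[of v C] power2_norm_eq_inner)
  also have "\<dots> \<le> norm v * norm (C *v ?w)"
    by (rule norm_cauchy_schwarz)
  also have "\<dots> \<le> norm v * norm ?w"
    using assms by (simp add: contraction_def mult_left_mono)
  finally show "norm ?w \<le> norm v"
    by (cases "norm ?w = 0") (simp_all add: power2_eq_square)
qed

text \<open>\<open>I - C\<^sup>\<dagger> C\<close> is positive semidefinite and its form vanishes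
  where \<open>C\<close> preserves the norm.\<close>

lemma contraction_isometric_vector:
  assumes "contraction C" "norm (C *v v) = norm v"
  shows "ctranspose C *v (C *v v) = v"
proof -
  let ?K = "mat 1 - ctranspose C ** C"
  have form: "w \<bullet> (?K *v w) = (norm w)\<^sup>2 - (norm (C *v w))\<^sup>2" for w
    using inner_ctranspose[of w "ctranspose C" "C *v w"]
    by (simp add: matrix_vector_mult_diff_rdistrib matrix_vector_mul_assoc[symmetric]
        inner_diff_right power2_norm_eq_inner)
  have "?K *v v = 0"
  proof (rule psd_kernel_UNIV)
    show "hermitian ?K"
      by (simp add: ctranspose_diff ctranspose_mult)
    show "0 \<le> w \<bullet> (?K *v w)" for w
      using assms(1) by (simp add: form contraction_def power_mono)
    show "v \<bullet> (?K *v v) = 0"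
      using assms(2) by (simp add: form)
  qed
  then show ?thesis
    by (simp add: matrix_vector_mult_diff_rdistrib matrix_vector_mul_assoc)
qed

text \<open>On the unit circle a contraction behaves like a normal matrix. This is why the
  complement of the preserved modes will be invariant.\<close>

lemma contraction_unit_eigenvector:
  assumes "contraction C" "C *v v = z *s v" "cmod z = 1"
  shows "ctranspose C *v v = cnj z *s v"
proof -
  have "norm (C *v v) = norm v"
    using assms by (simp add: norm_smult_cvec)
  from contraction_isometric_vector[OF assms(1) this]
  have "z *s (ctranspose C *v v) = v"
    by (simp add: assms(2) matrix_vector_mult_smult)
  then have "cnj z *s v = (cnj z * z) *s (ctranspose C *v v)"
    by (metis vector_smult_assoc)
  also have "cnj z * z = 1"
    using assms(3) by (simp add: complex_norm_square[symmetric] mult.commute)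
  finally show ?thesis
    by simp
qed

text \<open>On an invariant subspace where \<open>C\<close> is isometric it is unitary, and the commuting Hermitian
  matrices \<open>C + C\<^sup>\<dagger>\<close> and \<open>\<i> (C - C\<^sup>\<dagger>)\<close> have a common eigenvector.\<close>

lemma isometric_subspace_eigenvector:
  fixes C :: "complex^'m^'m"
  assumes C: "contraction C" and W: "vec.subspace W"
    and inv: "\<And>w. w \<in> W \<Longrightarrow> C *v w \<in> W" and iso: "\<And>w. w \<in> W \<Longrightarrow> norm (C *v w) = norm w"
    and ne: "u \<in> W" "u \<noteq> 0"
  obtains v z where "v \<noteq> 0" "cmod z = 1" "C *v v = z *s v"
proof -
  let ?T = "ctranspose C"
  have TC: "?T *v (C *v w) = w" if "w \<in> W" for w
    using contraction_isometric_vector[OF C iso[OF that]] .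
  have sW: "subspace W"
    by (rule subspace_of_vec_subspace[OF W])
  have lin: "linear ((*v) C)"
    by (rule matrix_vector_mul_linear)
  have "inj_on ((*v) C) W"
    by (rule inj_on_inverseI[of _ "(*v) ?T"]) (rule TC)
  then have "dim ((*v) C ` W) = dim W"
    using dim_image_eq[OF lin, of W] sW by (simp add: span_eq_iff[THEN iffD2])
  \<comment> \<open>Injectivity in finite dimension gives surjectivity, so
    \<open>C\<^sup>\<dagger>\<close> maps \<open>W\<close> into itself and inverts \<open>C\<close>
    there.\<close>
  then have onto: "(*v) C ` W = W"
    using subspace_dim_equal[OF linear_subspace_image[OF lin sW] sW] inv by auto
  have CT: "C *v (?T *v w) = w \<and> ?T *v w \<in> W" if "w \<in> W" for w
    using that TC onto by (metis imageE)
  define H where "H = C + ?T"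
  have Hv: "H *v w = C *v w + ?T *v w" for w
    by (simp add: H_def matrix_vector_mult_add_rdistrib)
  have "hermitian H"
    by (simp add: H_def ctranspose_add add.commute)
  then obtain w1 x where w1: "w1 \<in> W" "norm w1 = 1" "H *v w1 = complex_of_real x *s w1"
    using hermitian_eigenvector[OF _ W _ ne, of H] inv CT W by (auto simp: Hv vec.subspace_add)
  define E where "E = {w \<in> W. H *v w = complex_of_real x *s w}"
  have E: "vec.subspace E"
    using W by (auto simp: E_def vec.subspace_def matrix_vector_right_distrib
        matrix_vector_mult_smult vector_add_ldistrib mult.commute)
  define K where "K = mat \<i> ** (C - ?T)"
  have Kv: "K *v w = \<i> *s (C *v w - ?T *v w)" for w
    by (simp add: K_def matrix_vector_mul_assoc[symmetric] matrix_vector_mult_diff_rdistrib)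
  have "hermitian K"
  proof (rule matrix_eqI)
    fix w
    show "ctranspose K *v w = K *v w"
      by (simp add: Kv K_def ctranspose_mult ctranspose_diff matrix_vector_mult_diff_rdistrib
          matrix_vector_mul_assoc[symmetric] matrix_vector_mult_smult)
  qed
  \<comment> \<open>\<open>C\<close> and \<open>C\<^sup>\<dagger>\<close> are mutually inverse on
    \<open>W\<close>, so both commute with \<open>H\<close> there and preserve its eigenspace
    \<open>E\<close>.\<close>
  moreover have "C *v w \<in> E \<and> ?T *v w \<in> E" if "w \<in> E" for w
  proof -
    have w: "w \<in> W" "C *v w + ?T *v w = complex_of_real x *s w"
      using that by (auto simp: E_def Hv)
    from w(2) have "C *v (C *v w) + C *v (?T *v w) = complex_of_real x *s (C *v w)"
      "?T *v (C *v w) + ?T *v (?T *v w) = complex_of_real x *s (?T *v w)"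
      by (simp_all only: matrix_vector_right_distrib[symmetric] matrix_vector_mult_smult[symmetric])
    then show ?thesis
      using w TC CT inv
      by (simp add: E_def Hv matrix_vector_right_distrib matrix_vector_mult_smult)
  qed
  then have "K *v w \<in> E" if "w \<in> E" for w
    using that E by (simp add: Kv vec.subspace_diff vec.subspace_scale)
  moreover have "w1 \<in> E" "w1 \<noteq> 0"
    using w1 by (auto simp: E_def)
  ultimately obtain v y where v: "v \<in> E" "norm v = 1" "K *v v = complex_of_real y *s v"
    using hermitian_eigenvector[OF _ E] by metis
  \<comment> \<open>From \<open>H = C + C\<^sup>\<dagger>\<close> and
    \<open>K = \<i> (C - C\<^sup>\<dagger>)\<close>: \<open>2 C = H - \<i> K\<close>.\<close>
  define z where "z = (complex_of_real x - \<i> * complex_of_real y) / 2"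
  have sum: "C *v v + ?T *v v = complex_of_real x *s v"
    using v by (simp add: E_def Hv)
  have "(- \<i>) *s (K *v v) = C *v v - ?T *v v"
    by (simp add: Kv)
  then have diff: "C *v v - ?T *v v = (- \<i> * complex_of_real y) *s v"
    by (simp add: v)
  have "C *v v = (1 / 2) *s ((C *v v + ?T *v v) + (C *v v - ?T *v v))"
    by (simp add: vec_eq_iff)
  also have "\<dots> = z *s v"
    unfolding sum diff by (simp add: vec_eq_iff z_def field_simps)
  finally have Cv: "C *v v = z *s v" .
  have "norm (C *v v) = norm v"
    using v by (simp add: E_def iso)
  then have "cmod z = 1"
    using v by (simp add: Cv norm_smult_cvec)
  moreover have "v \<noteq> 0"
    using v by auto
  ultimately show ?thesis
    using that Cv by blast
qed

section \<open>Stein equations\<close>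

text \<open>For a contraction in finite dimension this amounts to spectral radius below one; the
  eigenvector form is what the Lyapunov argument contradicts.\<close>

definition stable :: "complex^'m^'m \<Rightarrow> bool" where
  "stable C \<longleftrightarrow> contraction C \<and> (\<forall>v z. v \<noteq> 0 \<longrightarrow> cmod z = 1 \<longrightarrow> C *v v \<noteq> z *s v)"

text \<open>If the minimum \<open>x\<close> of \<open>v \<bullet> (Y *v v)\<close> on the unit sphere were negative, the minimizers would
  span a \<open>C\<close>-invariant subspace on which \<open>C\<close> is isometric.\<close>

lemma stable_lyapunov_nonneg:
  fixes C Y :: "complex^'m^'m"
  assumes C: "stable C" and Y: "hermitian Y"
    and mono: "\<And>v. (C *v v) \<bullet> (Y *v (C *v v)) \<le> v \<bullet> (Y *v v)"
  shows "0 \<le> v \<bullet> (Y *v v)"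
proof -
  let ?S = "sphere 0 1 :: (complex^'m) set"
  have "axis undefined 1 \<in> ?S"
    by simp
  then have "?S \<noteq> {}"
    by blast
  moreover have "continuous_on ?S (\<lambda>v. v \<bullet> (Y *v v))"
    by (intro continuous_on_inner continuous_on_id linear_continuous_on
        matrix_vector_mul_bounded_linear)
  ultimately obtain u where u: "u \<in> ?S" and min: "\<And>w. w \<in> ?S \<Longrightarrow> u \<bullet> (Y *v u) \<le> w \<bullet> (Y *v w)"
    using continuous_attains_inf[OF compact_sphere, of 0 1 "\<lambda>v. v \<bullet> (Y *v v)"] by blast
  define x where "x = u \<bullet> (Y *v u)"
  have ge: "x * (norm w)\<^sup>2 \<le> w \<bullet> (Y *v w)" for w
  proof (cases "w = 0")
    case False
    have "(1 / norm w) *\<^sub>R w \<in> ?S"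
      using False by simp
    from min[OF this] have "x \<le> (1 / norm w)\<^sup>2 * (w \<bullet> (Y *v w))"
      by (simp add: matrix_vector_mult_scaleR x_def power2_eq_square)
    then show ?thesis
      using False by (simp add: field_simps)
  qed simp
  have "0 \<le> x"
  proof (rule ccontr)
    assume "\<not> 0 \<le> x"
    define K where "K = Y - mat (complex_of_real x)"
    have Kv: "K *v w = Y *v w - x *\<^sub>R w" for w
      by (simp add: K_def matrix_vector_mult_diff_rdistrib scaleR_cvec)
    have form: "w \<bullet> (K *v w) = w \<bullet> (Y *v w) - x * (norm w)\<^sup>2" for w
      by (simp add: Kv inner_diff_right power2_norm_eq_inner)
    have hK: "hermitian K"
      by (simp add: K_def ctranspose_diff Y)
    have psd: "0 \<le> w \<bullet> (K *v w)" for w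
      using ge[of w] by (simp add: form)
    define W where "W = {w. K *v w = 0}"
    have W: "vec.subspace W"
      by (auto simp: W_def vec.subspace_def matrix_vector_right_distrib matrix_vector_mult_smult)
    have main: "C *v w \<in> W \<and> norm (C *v w) = norm w" if "w \<in> W" for w
    proof -
      have "x * (norm (C *v w))\<^sup>2 \<le> (C *v w) \<bullet> (Y *v (C *v w))"
        by (rule ge)
      moreover have "\<dots> \<le> w \<bullet> (Y *v w)"
        by (rule mono)
      moreover have "\<dots> = x * (norm w)\<^sup>2"
        using that form[of w] by (simp add: W_def)
      \<comment> \<open>As \<open>x < 0\<close>, the contraction bound reverses. The chain closes
        up, so all its inequalities are equalities.\<close>
      moreover have "\<dots> \<le> x * (norm (C *v w))\<^sup>2"
        using C \<open>\<not> 0 \<le> x\<close> by (simp add: stable_def contraction_def power_mono)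
      ultimately have eq: "(C *v w) \<bullet> (Y *v (C *v w)) = x * (norm (C *v w))\<^sup>2"
        "x * (norm (C *v w))\<^sup>2 = x * (norm w)\<^sup>2"
        by linarith+
      from eq(1) have "(C *v w) \<bullet> (K *v (C *v w)) = 0"
        by (simp add: form)
      then have "K *v (C *v w) = 0"
        by (rule psd_kernel_UNIV[OF hK psd])
      moreover have "norm (C *v w) = norm w"
        using eq(2) \<open>\<not> 0 \<le> x\<close> by simp
      ultimately show ?thesis
        by (simp add: W_def)
    qed
    have "u \<bullet> (K *v u) = 0"
      using u by (simp add: form x_def)
    then have "u \<in> W"
      using psd_kernel_UNIV[OF hK psd] by (simp add: W_def)
    moreover have "u \<noteq> 0"
      using u by auto
    ultimately obtain v z where "v \<noteq> 0" "cmod z = 1" "C *v v = z *s v"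
      using isometric_subspace_eigenvector[OF _ W, of C u] main C unfolding stable_def by metis
    then show False
      using C by (simp add: stable_def)
  qed
  then show ?thesis
    using ge[of v] by (smt (verit) mult_nonneg_nonneg zero_le_power2)
qed

lemma inner_congruence:
  "v \<bullet> ((D ** X ** ctranspose D) *v v) = (ctranspose D *v v) \<bullet> (X *v (ctranspose D *v v))"
  for D X :: "complex^'m^'m"
  using inner_ctranspose[of v D "X *v (ctranspose D *v v)"]
  by (simp add: matrix_vector_mul_assoc[symmetric])

lemma hermitian_form_zero:
  fixes X :: "complex^'m^'m"
  assumes "hermitian X" "\<And>v. v \<bullet> (X *v v) = 0"
  shows "X = 0"
proof (rule matrix_eqI)
  show "X *v v = 0 *v v" for v
    using psd_kernel_UNIV[of X v] assms by simp
qed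

lemma cmat_minus_mult: "(- X) ** Y = - (X ** Y)" "X ** (- Y) = - (X ** Y)"
  for X :: "complex^'b^'a" and Y :: "complex^'c^'b"
  by (simp_all add: vec_eq_iff matrix_matrix_mult_def sum_negf)

lemma cmat_diff_mult: "(X - Z) ** Y = X ** Y - Z ** Y" "W ** (X - Z) = W ** X - W ** Z"
  for X Z :: "complex^'b^'a" and Y :: "complex^'c^'b" and W :: "complex^'a^'d"
  by (simp_all add: vec_eq_iff matrix_matrix_mult_def sum_subtractf algebra_simps)

lemma cmat_add_mult: "(X + Z) ** Y = X ** Y + Z ** Y" "W ** (X + Z) = W ** X + W ** Z"
  for X Z :: "complex^'b^'a" and Y :: "complex^'c^'b" and W :: "complex^'a^'d"
  by (simp_all add: vec_eq_iff matrix_matrix_mult_def sum.distrib algebra_simps)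

text \<open>The equation makes the form of \<open>X\<close> invariant under
  \<open>D\<^sup>\<dagger>\<close>, so the Lyapunov argument applies to both \<open>X\<close> and
  \<open>- X\<close>.\<close>

lemma stein_hermitian_zero:
  fixes D X :: "complex^'m^'m"
  assumes D: "stable (ctranspose D)" and X: "hermitian X" and eq: "X = D ** X ** ctranspose D"
  shows "X = 0"
proof (rule hermitian_form_zero[OF X])
  fix v
  have form: "w \<bullet> (X *v w) = (ctranspose D *v w) \<bullet> (X *v (ctranspose D *v w))" for w
    using inner_congruence[of w D X] eq by simp
  have minus: "w \<bullet> ((- X) *v w) = - (w \<bullet> (X *v w))" for w
    using matrix_vector_mult_diff_rdistrib[of 0 X w] by simp
  have "0 \<le> v \<bullet> (X *v v)"
    by (rule stable_lyapunov_nonneg[OF D X]) (simp add: form[symmetric])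
  moreover have "0 \<le> v \<bullet> ((- X) *v v)"
    by (rule stable_lyapunov_nonneg[OF D]) (simp_all only: minus ctranspose_uminus X form[symmetric] order_refl)
  ultimately show "v \<bullet> (X *v v) = 0"
    by (simp add: minus)
qed

abbreviation cscale :: "complex \<Rightarrow> complex^'c^'r \<Rightarrow> complex^'c^'r"  (infixr "*c" 75) where
  "c *c M \<equiv> map_matrix ((*) c) M"

lemma cscale_nth [simp]: "(c *c M) $ i $ j = c * M $ i $ j"
  by (simp add: map_matrix_def)

lemma cscale_mult_vec [simp]: "(c *c M) *v v = c *s (M *v v)"
  by (simp add: matrix_vector_mult_def vec_eq_iff sum_distrib_left mult.assoc)

lemma ctranspose_cscale: "ctranspose (c *c M) = cnj c *c ctranspose M"
  by (simp add: vec_eq_iff)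

lemma cscale_mult: "(c *c M) ** N = c *c (M ** N)" "M ** (c *c N) = c *c (M ** N)"
  by (simp_all add: vec_eq_iff matrix_matrix_mult_def sum_distrib_left mult_ac)

text \<open>The Stein map commutes with the adjoint, so \<open>X + X\<^sup>\<dagger>\<close> and
  \<open>\<i> (X - X\<^sup>\<dagger>)\<close> are Hermitian solutions.\<close>

lemma stein_zero:
  fixes D X :: "complex^'m^'m"
  assumes D: "stable (ctranspose D)" and eq: "X = D ** X ** ctranspose D"
  shows "X = 0"
proof -
  have eqT: "ctranspose X = D ** ctranspose X ** ctranspose D"
    using arg_cong[OF eq, of ctranspose] by (simp add: ctranspose_mult matrix_mul_assoc)
  have 1: "X + ctranspose X = 0"
  proof (rule stein_hermitian_zero[OF D])
    show "hermitian (X + ctranspose X)"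
      by (simp add: ctranspose_add add.commute)
    show "X + ctranspose X = D ** (X + ctranspose X) ** ctranspose D"
      by (simp only: cmat_add_mult eq[symmetric] eqT[symmetric])
  qed
  have 2: "\<i> *c (X - ctranspose X) = 0"
  proof (rule stein_hermitian_zero[OF D])
    show "hermitian (\<i> *c (X - ctranspose X))"
      by (simp add: vec_eq_iff algebra_simps)
    have "\<i> *c (X - ctranspose X) = \<i> *c (D ** X ** ctranspose D - D ** ctranspose X ** ctranspose D)"
      by (simp only: eq[symmetric] eqT[symmetric])
    also have "\<dots> = D ** (\<i> *c (X - ctranspose X)) ** ctranspose D"
      by (simp add: cmat_diff_mult cscale_mult)
    finally show "\<i> *c (X - ctranspose X) = D ** (\<i> *c (X - ctranspose X)) ** ctranspose D" .
  qed
  have "X - ctranspose X = - \<i> *c (\<i> *c (X - ctranspose X))"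
    by (simp add: vec_eq_iff)
  also have "\<dots> = 0"
    unfolding 2 by (simp add: vec_eq_iff)
  finally have "X = ctranspose X"
    by (rule eq_iff_diff_eq_0[THEN iffD2])
  with 1 have "X + X = 0"
    by simp
  then show "X = 0"
    by (simp add: vec_eq_iff)
qed

section \<open>The Stein map as a matrix on vectorized matrices\<close>

definition mat_of_vec :: "complex^('m \<times> 'm) \<Rightarrow> complex^'m^'m" where
  "mat_of_vec x = (\<chi> i j. x $ (i, j))"

definition vec_of_mat :: "complex^'m^'m \<Rightarrow> complex^('m \<times> 'm)" where
  "vec_of_mat X = (\<chi> p. X $ fst p $ snd p)"

lemma vec_of_mat_of_vec [simp]: "vec_of_mat (mat_of_vec x) = x"
  and mat_of_vec_of_mat [simp]: "mat_of_vec (vec_of_mat X) = X"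
  and vec_of_mat_nth [simp]: "vec_of_mat X $ p = X $ fst p $ snd p"
  and mat_of_vec_nth [simp]: "mat_of_vec x $ i $ j = x $ (i, j)"
  by (simp_all add: vec_of_mat_def mat_of_vec_def vec_eq_iff)

text \<open>The matrix of \<open>X \<mapsto> (1 + e) X - C X C\<^sup>\<dagger>\<close> on vectorized matrices.\<close>

definition stein_matrix :: "complex^'m^'m \<Rightarrow> real \<Rightarrow> complex^('m \<times> 'm)^('m \<times> 'm)" where
  "stein_matrix C e = (\<chi> p q. (if p = q then 1 + complex_of_real e else 0)
     - C $ fst p $ fst q * cnj (C $ snd p $ snd q))"

lemma stein_matrix_mult:
  "stein_matrix C e *v vec_of_mat X = vec_of_mat ((1 + e) *\<^sub>R X - C ** X ** ctranspose C)"
proof -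
  have "(stein_matrix C e *v vec_of_mat X) $ p = (1 + complex_of_real e) * X $ fst p $ snd p
      - (\<Sum>q\<in>UNIV. C $ fst p $ fst q * X $ fst q $ snd q * cnj (C $ snd p $ snd q))" for p
  proof -
    have "(stein_matrix C e *v vec_of_mat X) $ p
        = (\<Sum>q\<in>UNIV. (if p = q then (1 + complex_of_real e) * X $ fst q $ snd q else 0)
            - C $ fst p $ fst q * X $ fst q $ snd q * cnj (C $ snd p $ snd q))"
      by (auto simp: stein_matrix_def matrix_vector_mult_def algebra_simps intro!: sum.cong)
    then show ?thesis
      by (simp add: sum_subtractf)
  qed
  moreover have "(\<Sum>q\<in>UNIV. C $ i $ fst q * X $ fst q $ snd q * cnj (C $ j $ snd q))
      = (C ** X ** ctranspose C) $ i $ j" for i j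
  proof -
    have "(\<Sum>q\<in>UNIV. C $ i $ fst q * X $ fst q $ snd q * cnj (C $ j $ snd q))
        = (\<Sum>a\<in>UNIV. \<Sum>b\<in>UNIV. C $ i $ a * X $ a $ b * cnj (C $ j $ b))"
      by (simp add: sum.cartesian_product UNIV_Times_UNIV[symmetric] case_prod_unfold del: UNIV_Times_UNIV)
    also have "\<dots> = (\<Sum>b\<in>UNIV. \<Sum>a\<in>UNIV. C $ i $ a * X $ a $ b * cnj (C $ j $ b))"
      by (rule sum.swap)
    finally show ?thesis
      by (simp add: matrix_matrix_mult_def sum_distrib_right)
  qed
  ultimately show ?thesis
    by (simp add: vec_eq_iff scaleR_conv_of_real[where 'a = complex])
qed

text \<open>A kernel element satisfies \<open>C X C\<^sup>\<dagger> = (1 + e) X\<close>. Splitting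
  \<open>1 / (1 + e)\<close> evenly between the two factors gives the Stein equation of the scaled
  matrix.\<close>

lemma stein_matrix_invertible:
  fixes C :: "complex^'m^'m"
  assumes e: "e \<ge> 0" and C: "stable ((1 / sqrt (1 + e)) *\<^sub>R ctranspose C)"
  shows "det (stein_matrix C e) \<noteq> 0"
proof -
  have "x = 0" if "stein_matrix C e *v x = 0" for x
  proof -
    define t X where "t = 1 / sqrt (1 + e)" and "X = mat_of_vec x"
    have "vec_of_mat ((1 + e) *\<^sub>R X - C ** X ** ctranspose C) = 0"
      using that stein_matrix_mult[of C e X] by (simp add: X_def)
    then have "(1 + e) *\<^sub>R X - C ** X ** ctranspose C = 0"
      by (metis mat_of_vec_of_mat mat_of_vec_nth vec_eq_iff zero_index)
    then have 1: "C ** X ** ctranspose C = (1 + e) *\<^sub>R X"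
      by simp
    have "(t *\<^sub>R C) ** X ** ctranspose (t *\<^sub>R C) = t\<^sup>2 *\<^sub>R (C ** X ** ctranspose C)"
      by (simp add: vec_eq_iff matrix_matrix_mult_def sum_distrib_left sum_distrib_right
          scaleR_conv_of_real[where 'a = complex] power2_eq_square mult_ac)
    also have "\<dots> = X"
      using e by (simp add: 1 t_def power_divide)
    finally have "X = (t *\<^sub>R C) ** X ** ctranspose (t *\<^sub>R C)"
      by simp
    moreover have "ctranspose (t *\<^sub>R C) = t *\<^sub>R ctranspose C"
      by (simp add: vec_eq_iff scaleR_conv_of_real[where 'a = complex])
    ultimately have "X = 0"
      using stein_zero[of "t *\<^sub>R C" X] C by (simp add: t_def)
    then show ?thesis
      by (metis X_def vec_of_mat_of_vec vec_of_mat_nth vec_eq_iff zero_index)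
  qed
  then show ?thesis
    by (metis invertible_det_nz invertible_left_inverse matrix_left_invertible_ker)
qed

section \<open>The channel at a fixed momentum\<close>

lemma scaleR_cmat_mult_vec: "(s *\<^sub>R M) *v v = s *\<^sub>R (M *v v)" for M :: "complex^'c^'r"
  by (simp add: matrix_vector_mult_def vec_eq_iff scaleR_sum_right)

section \<open>Orthogonal projectors onto complex subspaces\<close>

definition is_orth_projector :: "(complex^'m) set \<Rightarrow> complex^'m^'m \<Rightarrow> bool" where
  "is_orth_projector V P \<longleftrightarrow> P ** P = P \<and> ctranspose P = P \<and> range ((*v) P) = V"

lemma is_orth_projector_fixes: "is_orth_projector V P \<Longrightarrow> v \<in> V \<longleftrightarrow> P *v v = v"
  unfolding is_orth_projector_def by (metis matrix_vector_mul_assoc rangeE rangeI)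

lemma is_orth_projector_unique:
  assumes "is_orth_projector V P" "is_orth_projector V Q"
  shows "P = Q"
proof -
  have absorb: "P ** Q = Q" if "is_orth_projector V P" "is_orth_projector V Q" for P Q
  proof (rule matrix_eqI)
    fix x
    have "Q *v x \<in> V"
      using that(2) by (auto simp: is_orth_projector_def)
    then show "(P ** Q) *v x = Q *v x"
      using is_orth_projector_fixes[OF that(1)] by (simp add: matrix_vector_mul_assoc[symmetric])
  qed
  have "P = ctranspose (Q ** P)"
    using absorb[OF assms(2,1)] assms by (simp add: is_orth_projector_def)
  also have "\<dots> = P ** Q"
    using assms by (simp add: ctranspose_mult is_orth_projector_def)
  finally show ?thesis
    using absorb[OF assms] by simp
qed

lemma is_orth_projector_exists:
  fixes V :: "(complex^'m) set"
  assumes V: "vec.subspace V"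
  shows "\<exists>P. is_orth_projector V P"
proof -
  have sV: "subspace V"
    by (rule subspace_of_vec_subspace[OF V])
  have "\<exists>y. y \<in> V \<and> (\<forall>w\<in>V. hinner w (x - y) = 0)" for x
  proof -
    obtain y z where yz: "y \<in> V" "\<And>w. w \<in> V \<Longrightarrow> orthogonal z w" "x = y + z"
      using orthogonal_subspace_decomp_exists[of V x] sV by (metis span_eq_iff)
    have "hinner w z = 0" if "w \<in> V" for w
    proof -
      \<comment> \<open>Real orthogonality to both \<open>w\<close> and \<open>\<i> w\<close> is
        Hermitian orthogonality to \<open>w\<close>.\<close>
      have "z \<bullet> w = 0" "z \<bullet> (\<i> *s w) = 0"
        using yz(2) that V by (simp_all add: orthogonal_def[symmetric] vec.subspace_scale)
      then have "hinner z w = 0"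
        by (simp add: complex_eq_iff inner_eq_Re_hinner)
      then show ?thesis
        using cnj_hinner[of z w] by simp
    qed
    then show ?thesis
      using yz by auto
  qed
  then obtain f where f: "\<And>x. f x \<in> V" "\<And>x w. w \<in> V \<Longrightarrow> hinner w (x - f x) = 0"
    by metis
  \<comment> \<open>Orthogonality of the residual determines the point of \<open>V\<close>;
    linearity and idempotence of \<open>f\<close> follow from this uniqueness.\<close>
  have unique: "f x = y" if "y \<in> V" "\<And>w. w \<in> V \<Longrightarrow> hinner w (x - y) = 0" for x y
  proof -
    have "f x - y \<in> V"
      using f that V by (simp add: vec.subspace_diff)
    with f(2)[of "f x - y" x] that(2)[of "f x - y"] have "hinner (f x - y) ((x - y) - (x - f x)) = 0"
      by (simp add: hinner_diff_right)
    then show ?thesis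
      by simp
  qed
  have "f (x + y) = f x + f y" for x y
  proof (rule unique)
    show "hinner w (x + y - (f x + f y)) = 0" if "w \<in> V" for w
      using f(2)[OF that, of x] f(2)[OF that, of y] by (simp add: hinner_diff_right hinner_add_right)
  qed (use f V in \<open>simp add: vec.subspace_add\<close>)
  moreover have "f (c *s x) = c *s f x" for c x
  proof (rule unique)
    show "hinner w (c *s x - c *s f x) = 0" if "w \<in> V" for w
      using f(2)[OF that, of x] by (simp add: hinner_diff_right)
  qed (use f V in \<open>simp add: vec.subspace_scale\<close>)
  ultimately have lin: "Vector_Spaces.linear (*s) (*s) f"
    by (simp add: Vector_Spaces.linear_iff vec.vector_space_axioms)
  have P: "matrix f *v x = f x" for x
    by (rule matrix_works[OF lin])
  have ff: "f y = y" if "y \<in> V" for y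
    by (rule unique) (simp_all add: that)
  have "matrix f ** matrix f = matrix f"
    by (rule matrix_eqI) (simp add: matrix_vector_mul_assoc[symmetric] P ff f)
  moreover have "ctranspose (matrix f) = matrix f"
  proof (rule matrix_eqI)
    fix x
    let ?d = "ctranspose (matrix f) *v x - f x"
    have "hinner y (ctranspose (matrix f) *v x) = hinner y (f x)" for y
    proof -
      have "hinner y (ctranspose (matrix f) *v x) = hinner (f y) x"
        by (simp add: hinner_ctranspose P)
      also have "\<dots> = hinner (f y) (f x)"
        using f(2)[OF f(1)[of y], of x] by (simp add: hinner_diff_right)
      also have "\<dots> = hinner y (f x)"
        using arg_cong[OF f(2)[OF f(1)[of x], of y], of cnj]
        by (simp add: cnj_hinner) (simp add: hinner_def sum_subtractf left_diff_distrib)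
      finally show ?thesis .
    qed
    then have "hinner ?d ?d = 0"
      by (simp add: hinner_diff_right)
    then show "ctranspose (matrix f) *v x = matrix f *v x"
      by (simp add: P)
  qed
  moreover have "range ((*v) (matrix f)) = V"
  proof
    show "range ((*v) (matrix f)) \<subseteq> V"
      using f(1) by (auto simp: P)
    show "V \<subseteq> range ((*v) (matrix f))"
      using ff by (metis P rangeI subsetI)
  qed
  ultimately show ?thesis
    unfolding is_orth_projector_def by blast
qed

lemma orth_projector_correct:
  assumes "vec.subspace V"
  shows "is_orth_projector V (orth_projector V)"
proof -
  obtain P where "is_orth_projector V P"
    using is_orth_projector_exists[OF assms] by blast
  then have "is_orth_projector V (THE P. is_orth_projector V P)"
    by (rule theI) (rule is_orth_projector_unique[OF _ \<open>is_orth_projector V P\<close>])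
  then show ?thesis
    unfolding orth_projector_def is_orth_projector_def .
qed

lemma tendsto_det:
  fixes M :: "'a \<Rightarrow> 'b::real_normed_field^'n^'n"
  assumes "\<And>i j. ((\<lambda>x. M x $ i $ j) \<longlongrightarrow> L $ i $ j) F"
  shows "((\<lambda>x. det (M x)) \<longlongrightarrow> det L) F"
  unfolding det_def by (intro tendsto_intros assms)

definition cramer_component :: "'a::field^'n^'n \<Rightarrow> 'a^'n \<Rightarrow> 'n \<Rightarrow> 'a" where
  "cramer_component M b l = det (\<chi> i j. if j = l then b $ i else M $ i $ j) / det M"

lemma cramer_component: "det M \<noteq> 0 \<Longrightarrow> M *v x = b \<longleftrightarrow> x = (\<chi> l. cramer_component M b l)"
  unfolding cramer_component_def by (rule cramer)

text \<open>Complete positivity of the channel \<open>\<Gamma> \<mapsto> A + B \<Gamma> B\<^sup>\<dagger>\<close>, as a condition that is stable under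
  composition of channels: \<open>I - B B\<^sup>\<dagger> \<plusminus> \<i> A \<ge> 0\<close>.\<close>

locale momentum_channel =
  fixes A B :: "complex^'m^'m"
  assumes antihermitian: "ctranspose A = - A"
    and positive: "\<bar>v \<bullet> ((\<i> *c A) *v v)\<bar> + (norm (ctranspose B *v v))\<^sup>2 \<le> (norm v)\<^sup>2"
begin

lemma contraction_ctranspose_B: "contraction (ctranspose B)"
proof -
  have "norm (ctranspose B *v v) \<le> norm v" for v
  proof (rule power2_le_imp_le[OF _ norm_ge_zero])
    show "(norm (ctranspose B *v v))\<^sup>2 \<le> (norm v)\<^sup>2"
      using positive[of v] abs_ge_zero[of "v \<bullet> ((\<i> *c A) *v v)"] by linarith
  qed
  then show ?thesis
    by (simp add: contraction_def)
qed

lemma contraction_B: "contraction B"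
  using contraction_ctranspose[OF contraction_ctranspose_B] by simp

text \<open>The defect of \<open>B\<^sup>\<dagger>\<close> from being an isometry. It dominates
  \<open>\<plusminus> \<i> A\<close>, vanishes on preserved modes, and is the source of the Stein
  equation solved by \<open>P\<close>.\<close>

definition E :: "complex^'m^'m" where "E = mat 1 - B ** ctranspose B"

lemma hermitian_E: "hermitian E"
  by (simp add: E_def ctranspose_diff ctranspose_mult)

lemma form_E: "v \<bullet> (E *v v) = (norm v)\<^sup>2 - (norm (ctranspose B *v v))\<^sup>2"
  using inner_ctranspose[of v B "ctranspose B *v v"]
  by (simp add: E_def matrix_vector_mult_diff_rdistrib inner_diff_right
      matrix_vector_mul_assoc[symmetric] power2_norm_eq_inner)

lemma hermitian_iA: "hermitian (\<i> *c A)"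
  by (simp add: ctranspose_cscale antihermitian) (simp add: vec_eq_iff)

lemma form_E_A: "\<bar>v \<bullet> ((\<i> *c A) *v v)\<bar> \<le> v \<bullet> (E *v v)"
  using positive[of v] form_E[of v] by linarith

text \<open>\<open>B\<^sup>\<dagger>\<close> is isometric at \<open>v\<close>, so the defect
  \<open>E\<close> vanishes there; the positive semidefinite \<open>E + \<i> A\<close> then has zero
  form at \<open>v\<close>, which forces \<open>A *v v = 0\<close>.\<close>

lemma unit_eigenvector:
  assumes "B *v v = z *s v" "cmod z = 1"
  shows "ctranspose B *v v = cnj z *s v" "E *v v = 0" "A *v v = 0"
proof -
  show 1: "ctranspose B *v v = cnj z *s v"
    by (rule contraction_unit_eigenvector[OF contraction_B assms])
  have "norm (ctranspose B *v v) = norm v"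
    using assms(2) by (simp add: 1 norm_smult_cvec)
  from contraction_isometric_vector[OF contraction_ctranspose_B this]
  show E: "E *v v = 0"
    by (simp add: E_def matrix_vector_mult_diff_rdistrib matrix_vector_mul_assoc)
  have "(E + \<i> *c A) *v v = 0"
  proof (rule psd_kernel_UNIV)
    show "hermitian (E + \<i> *c A)"
      by (simp only: ctranspose_add hermitian_E hermitian_iA)
    show "0 \<le> w \<bullet> ((E + \<i> *c A) *v w)" for w
      using form_E_A[of w] by (simp add: matrix_vector_mult_add_rdistrib inner_add_right)
    show "v \<bullet> ((E + \<i> *c A) *v v) = 0"
      using form_E_A[of v] E by (simp add: matrix_vector_mult_add_rdistrib inner_add_right)
  qed
  then show "A *v v = 0"
    by (simp add: matrix_vector_mult_add_rdistrib E)
qed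

section \<open>Preserved and dissipative subspaces\<close>

abbreviation "Vu \<equiv> preserved_space B"
abbreviation "Vd \<equiv> dissipative_space B"
abbreviation "P \<equiv> orth_projector Vd"

lemma preserved_induct [consumes 1, case_names subspace eigen]:
  assumes "v \<in> Vu" "vec.subspace {v. Q v}"
    and "\<And>v z. B *v v = z *s v \<Longrightarrow> cmod z = 1 \<Longrightarrow> v \<in> Vu \<Longrightarrow> Q v"
  shows "Q v"
proof -
  show "Q v"
    using assms(1)[unfolded preserved_space_def] assms(2)
  proof (rule vec.span_induct)
    fix w
    assume w: "w \<in> {v. v \<noteq> 0 \<and> (\<exists>z. cmod z = 1 \<and> B *v v = z *s v)}"
    then have "w \<in> Vu"
      unfolding preserved_space_def by (rule vec.span_base)
    with w show "Q w"
      using assms(3) by blast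
  qed
qed

lemma preserved_subspace: "vec.subspace Vu"
  by (simp add: preserved_space_def)

lemma kernel_subspace: "vec.subspace {v. M *v v = 0}" for M :: "complex^'m^'m"
  by (auto simp: vec.subspace_def matrix_vector_right_distrib matrix_vector_mult_smult)

lemma preserved_kernel: "v \<in> Vu \<Longrightarrow> E *v v = 0" "v \<in> Vu \<Longrightarrow> A *v v = 0"
proof -
  show "E *v v = 0" if "v \<in> Vu"
    using that by (induction rule: preserved_induct) (rule kernel_subspace, erule unit_eigenvector(2))
  show "A *v v = 0" if "v \<in> Vu"
    using that by (induction rule: preserved_induct) (rule kernel_subspace, erule unit_eigenvector(3))
qed

lemma preserved_invariant: "v \<in> Vu \<Longrightarrow> B *v v \<in> Vu" "v \<in> Vu \<Longrightarrow> ctranspose B *v v \<in> Vu"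
proof -
  have sub: "vec.subspace {v. M *v v \<in> Vu}" for M :: "complex^'m^'m"
    using preserved_subspace
    by (auto simp: vec.subspace_def matrix_vector_right_distrib matrix_vector_mult_smult)
  show "B *v v \<in> Vu" if "v \<in> Vu"
    using that
  proof (induction rule: preserved_induct)
    case (eigen v z)
    then show ?case
      using vec.subspace_scale[OF preserved_subspace] by simp
  qed (rule sub)
  show "ctranspose B *v v \<in> Vu" if "v \<in> Vu"
    using that
  proof (induction rule: preserved_induct)
    case (eigen v z)
    then show ?case
      using vec.subspace_scale[OF preserved_subspace] unit_eigenvector(1)[of v z] by simp
  qed (rule sub)
qed

lemma dissipative_subspace: "vec.subspace Vd"
  by (auto simp: dissipative_space_def vec.subspace_def hinner_add_right)

lemma projector: "is_orth_projector Vd P"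
  by (rule orth_projector_correct[OF dissipative_subspace])

lemma P_idem [simp]: "P ** P = P" and P_hermitian [simp]: "ctranspose P = P"
  using projector by (auto simp: is_orth_projector_def)

lemma in_Vd_iff: "v \<in> Vd \<longleftrightarrow> P *v v = v"
  by (rule is_orth_projector_fixes[OF projector])

lemma P_mult_in [simp]: "P *v v \<in> Vd"
  by (simp add: in_Vd_iff matrix_vector_mul_assoc)

lemma P_absorb_left: "(\<And>x. M *v x \<in> Vd) \<Longrightarrow> P ** M = M"
  by (rule matrix_eqI) (simp add: in_Vd_iff matrix_vector_mul_assoc[symmetric])

text \<open>For \<open>v\<close> in \<open>Vu\<close>,
  \<open>hinner v (M *v x) = \<plusminus> hinner (M *v v) x = 0\<close>, so the range of
  \<open>M\<close> lies in \<open>Vd\<close>; the adjoint gives the other side.\<close>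

lemma hermitian_absorb:
  assumes "\<And>v. v \<in> Vu \<Longrightarrow> M *v v = 0" "ctranspose M = M \<or> ctranspose M = - M"
  shows "P ** M = M" "M ** P = M"
proof -
  have "M *v x \<in> Vd" for x
    using assms hinner_ctranspose[of _ M x] matrix_vector_mult_diff_rdistrib[of 0 M]
    by (auto simp: dissipative_space_def)
  then show 1: "P ** M = M"
    by (rule P_absorb_left)
  have "ctranspose (P ** M) = ctranspose M"
    by (simp only: 1)
  then show "M ** P = M"
    using assms(2) by (auto simp: ctranspose_mult cmat_minus_mult)
qed

lemma A_P: "P ** A = A" "A ** P = A"
  using hermitian_absorb[of A] antihermitian preserved_kernel(2) by blast+

lemma E_P: "P ** E = E" "E ** P = E"
  using hermitian_absorb[of E] hermitian_E preserved_kernel(1) by blast+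

text \<open>\<open>Vu\<close> is invariant under both \<open>B\<close> and
  \<open>B\<^sup>\<dagger>\<close>, so \<open>Vd\<close> is too. Hence \<open>P B P\<close> equals
  both \<open>B P\<close> and \<open>P B\<close>.\<close>

lemma B_P: "P ** B = B ** P"
proof -
  have inv: "M *v w \<in> Vd"
    if "w \<in> Vd" "\<And>v. v \<in> Vu \<Longrightarrow> ctranspose M *v v \<in> Vu" for M w
    using that by (simp add: dissipative_space_def hinner_ctranspose)
  have 1: "P ** (B ** P) = B ** P"
    by (rule P_absorb_left) (simp add: matrix_vector_mul_assoc[symmetric] inv preserved_invariant)
  have 2: "P ** (ctranspose B ** P) = ctranspose B ** P"
    by (rule P_absorb_left) (simp add: matrix_vector_mul_assoc[symmetric] inv preserved_invariant)
  have "ctranspose (P ** (ctranspose B ** P)) = ctranspose (ctranspose B ** P)"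
    by (simp only: 2)
  then have "P ** B ** P = P ** B"
    by (simp add: ctranspose_mult)
  with 1 show ?thesis
    by (simp add: matrix_mul_assoc)
qed

definition D :: "complex^'m^'m" where "D = P ** B ** P"

lemma D_P: "P ** D = D" "D ** P = D"
  by (simp_all add: D_def matrix_mul_assoc) (simp add: matrix_mul_assoc[symmetric])

lemma D_eq: "D = P ** B" "D = B ** P"
  by (simp_all add: D_def B_P matrix_mul_assoc[symmetric])

lemma ctranspose_D_P: "P ** ctranspose D = ctranspose D" "ctranspose D ** P = ctranspose D"
  using arg_cong[OF D_P(2), of ctranspose] arg_cong[OF D_P(1), of ctranspose]
  by (simp_all add: ctranspose_mult)

text \<open>\<open>B\<close> may have eigenvalues on the unit circle, hence the strict bound on
  \<open>s\<close>. It matches \<open>e > 0\<close> in the regularized equation, where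
  \<open>s = 1 / sqrt (1 + e)\<close>.\<close>

lemma stable_scaled_B: "0 \<le> s \<Longrightarrow> s < 1 \<Longrightarrow> stable (s *\<^sub>R ctranspose B)"
proof -
  assume s: "0 \<le> s" "s < 1"
  have sv: "(s *\<^sub>R ctranspose B) *v v = s *\<^sub>R (ctranspose B *v v)" for v
    by (rule scaleR_cmat_mult_vec)
  have le: "norm ((s *\<^sub>R ctranspose B) *v v) \<le> s * norm v" for v
    using contraction_ctranspose_B s by (simp add: sv contraction_def mult_left_mono)
  have "contraction (s *\<^sub>R ctranspose B)"
    unfolding contraction_def
  proof
    show "norm ((s *\<^sub>R ctranspose B) *v v) \<le> norm v" for v
      using le[of v] s mult_left_le_one_le[of "norm v" s] by simp
  qed
  moreover have "False" if "v \<noteq> 0" "cmod z = 1" "(s *\<^sub>R ctranspose B) *v v = z *s v" for v z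
    using le[of v] that s by (simp add: norm_smult_cvec)
  ultimately show ?thesis
    by (auto simp: stable_def)
qed

lemma norm_P_le: "norm (P *v v) \<le> norm v"
proof -
  have "(norm (P *v v))\<^sup>2 = v \<bullet> (P *v v)"
    using inner_ctranspose[of v P "P *v v"] by (simp add: matrix_vector_mul_assoc power2_norm_eq_inner)
  also have "\<dots> \<le> norm v * norm (P *v v)"
    by (rule norm_cauchy_schwarz)
  finally show ?thesis
    by (cases "norm (P *v v) = 0") (simp_all add: power2_eq_square)
qed

lemma contraction_D: "contraction D"
  using norm_P_le contraction_B unfolding contraction_def D_eq(1)
  by (metis matrix_vector_mul_assoc order_trans)

text \<open>An eigenvector with nonzero eigenvalue lies in the range of \<open>P\<close>. If the
  eigenvalue is on the unit circle, it is an eigenvector of \<open>B\<close> and lies in both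
  \<open>Vu\<close> and \<open>Vd\<close>, so it is zero.\<close>

lemma stable_D: "stable (ctranspose D)"
  unfolding stable_def
proof (intro conjI allI impI notI)
  show "contraction (ctranspose D)"
    by (rule contraction_ctranspose[OF contraction_D])
  fix v z
  assume v: "v \<noteq> 0" and z: "cmod z = 1" and "ctranspose D *v v = z *s v"
  from contraction_unit_eigenvector[OF contraction_ctranspose[OF contraction_D] this(3,2)]
  have Dv: "D *v v = cnj z *s v"
    by simp
  have "P *v (D *v v) = D *v v"
    by (simp add: matrix_vector_mul_assoc D_P)
  then have "cnj z *s (P *v v) = cnj z *s v"
    by (simp add: Dv matrix_vector_mult_smult)
  moreover have "z \<noteq> 0"
    using z by auto
  ultimately have Pv: "P *v v = v"
    by (simp add: vector_mul_lcancel)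
  then have "B *v v = cnj z *s v"
    using Dv by (simp add: D_eq(2) matrix_vector_mul_assoc[symmetric])
  then have "v \<in> Vu"
    using v z unfolding preserved_space_def by (intro vec.span_base) force
  moreover have "v \<in> Vd"
    using Pv by (simp add: in_Vd_iff)
  ultimately have "hinner v v = 0"
    by (simp add: dissipative_space_def)
  then show False
    using v by simp
qed

lemma stable_scaled_D: "0 \<le> s \<Longrightarrow> s \<le> 1 \<Longrightarrow> stable (s *\<^sub>R ctranspose D)"
proof -
  assume s: "0 \<le> s" "s \<le> 1"
  have sv: "(s *\<^sub>R ctranspose D) *v v = s *\<^sub>R (ctranspose D *v v)" for v
    by (rule scaleR_cmat_mult_vec)
  have le: "norm ((s *\<^sub>R ctranspose D) *v v) \<le> s * norm v" for v
    using stable_D s by (simp add: sv stable_def contraction_def mult_left_mono)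
  have "contraction (s *\<^sub>R ctranspose D)"
    unfolding contraction_def
  proof
    show "norm ((s *\<^sub>R ctranspose D) *v v) \<le> norm v" for v
      using le[of v] s mult_left_le_one_le[of "norm v" s] by simp
  qed
  moreover have "False" if "v \<noteq> 0" "cmod z = 1" "(s *\<^sub>R ctranspose D) *v v = z *s v" for v z
  proof -
    have "norm v \<le> s * norm v"
      using le[of v] that by (simp add: norm_smult_cvec)
    then have "s = 1"
      using s \<open>v \<noteq> 0\<close> by simp
    then show False
      using that stable_D by (simp add: stable_def)
  qed
  ultimately show ?thesis
    by (auto simp: stable_def)
qed

text \<open>The solution of \<open>Y = b + D Y D\<^sup>\<dagger>\<close> is the limit of the resolvent of \<open>X \<mapsto> X - B X B\<^sup>\<dagger>\<close> applied
  to \<open>b\<close>; the latter involves the entries of \<open>B\<close> only, not the projector.\<close>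

lemma regularized_solution:
  assumes b: "P ** b = b" "b ** P = b"
  obtains Y where "Y = b + D ** Y ** ctranspose D"
    "\<And>l. ((\<lambda>e. cramer_component (stein_matrix B e) (vec_of_mat b) l) \<longlongrightarrow> vec_of_mat Y $ l) (at_right 0)"
proof -
  define x where "x e = (\<chi> l. cramer_component (stein_matrix D e) (vec_of_mat b) l)" for e
  have detD: "det (stein_matrix D e) \<noteq> 0" if "e \<ge> 0" for e
    using that by (intro stein_matrix_invertible stable_scaled_D) auto
  have detB: "det (stein_matrix B e) \<noteq> 0" if "e > 0" for e
    using that by (intro stein_matrix_invertible stable_scaled_B) auto
  have eq: "(1 + e) *\<^sub>R mat_of_vec (x e) = b + D ** mat_of_vec (x e) ** ctranspose D" if "e \<ge> 0" for e
  proof -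
    have "stein_matrix D e *v x e = vec_of_mat b"
      using cramer_component[OF detD[OF that]] by (simp add: x_def)
    then have "vec_of_mat ((1 + e) *\<^sub>R mat_of_vec (x e) - D ** mat_of_vec (x e) ** ctranspose D) = vec_of_mat b"
      by (simp add: stein_matrix_mult[symmetric])
    then have "(1 + e) *\<^sub>R mat_of_vec (x e) - D ** mat_of_vec (x e) ** ctranspose D = b"
      by (metis mat_of_vec_of_mat)
    then show ?thesis
      by (simp add: algebra_simps)
  qed
  \<comment> \<open>The solution for \<open>D\<close> satisfies \<open>P X P = X\<close>, and on
    such matrices \<open>B X B\<^sup>\<dagger> = D X D\<^sup>\<dagger>\<close>. So it also solves
    the system for \<open>B\<close>, which has a unique solution for \<open>e > 0\<close>.\<close>
  have xB: "x e $ l = cramer_component (stein_matrix B e) (vec_of_mat b) l" if "e > 0" for e l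
  proof -
    let ?X = "mat_of_vec (x e)"
    have "(1 + e) *\<^sub>R (P ** ?X ** P) = P ** ((1 + e) *\<^sub>R ?X) ** P"
      by (simp add: vec_eq_iff matrix_matrix_mult_def sum_distrib_left sum_distrib_right
          scaleR_conv_of_real[where 'a = complex] mult_ac)
    also have "\<dots> = P ** b ** P + (P ** D) ** ?X ** (ctranspose D ** P)"
      using eq[of e] that by (simp add: cmat_add_mult matrix_mul_assoc)
    also have "\<dots> = (1 + e) *\<^sub>R ?X"
      using eq[of e] that by (simp add: b D_P ctranspose_D_P)
    finally have X: "P ** ?X ** P = ?X"
      using that by simp
    have "B ** ?X ** ctranspose B = B ** (P ** ?X ** P) ** ctranspose B"
      by (simp only: X)
    also have "\<dots> = (B ** P) ** ?X ** (ctranspose (B ** P))"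
      by (simp add: ctranspose_mult matrix_mul_assoc)
    also have "\<dots> = D ** ?X ** ctranspose D"
      by (simp add: D_eq(2))
    finally have "(1 + e) *\<^sub>R ?X - B ** ?X ** ctranspose B = b"
      using eq[of e] that by simp
    then have "stein_matrix B e *v vec_of_mat ?X = vec_of_mat b"
      by (simp only: stein_matrix_mult)
    then show ?thesis
      using cramer_component[OF detB[OF that]] by simp
  qed
  \<comment> \<open>The determinant for \<open>D\<close> is nonzero at \<open>e = 0\<close> too, so
    the solution is continuous there.\<close>
  have lim: "((\<lambda>e. x e $ l) \<longlongrightarrow> x 0 $ l) (at_right 0)" for l
  proof -
    have entry: "((\<lambda>e. stein_matrix D e $ p $ q) \<longlongrightarrow> stein_matrix D 0 $ p $ q) (at_right 0)" for p q
      unfolding stein_matrix_def by (auto intro!: tendsto_eq_intros)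
    show ?thesis
      unfolding x_def cramer_component_def using detD[of 0]
      by (simp, intro tendsto_divide tendsto_det entry) (auto intro: entry)
  qed
  show ?thesis
  proof (rule that)
    show "mat_of_vec (x 0) = b + D ** mat_of_vec (x 0) ** ctranspose D"
      using eq[of 0] by simp
    show "((\<lambda>e. cramer_component (stein_matrix B e) (vec_of_mat b) l)
        \<longlongrightarrow> vec_of_mat (mat_of_vec (x 0)) $ l) (at_right 0)" for l
      unfolding vec_of_mat_of_vec using lim[of l] by (rule Lim_transform_eventually)
        (auto simp: eventually_at_right_field xB intro!: exI[of _ 1])
  qed
qed

lemma stein_unique:
  assumes "X = b + D ** X ** ctranspose D" "Z = b + D ** Z ** ctranspose D"
  shows "X = Z"
proof -
  have "X - Z = D ** (X - Z) ** ctranspose D"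
    using assms by (simp add: cmat_diff_mult) (metis add_diff_cancel_left)
  from stein_zero[OF stable_D this] show ?thesis
    by simp
qed

section \<open>The steady state and its bounds\<close>

abbreviation "G \<equiv> steady_state A B"

text \<open>The equation on \<open>Vd\<close> and the extension by zero merge into one unrestricted
  Stein equation: \<open>A\<close> and \<open>D\<close> absorb \<open>P\<close> on both sides, so
  each of its solutions satisfies \<open>X = P X P\<close>.\<close>

lemma steady_state_iff:
  "X = P ** X ** P \<and> (\<forall>v\<in>Vd. X *v v = (P ** A + P ** B ** X ** ctranspose B ** P) *v v)
   \<longleftrightarrow> X = A + D ** X ** ctranspose D" (is "?L \<longleftrightarrow> ?R")
proof -
  have DXD: "P ** B ** (P ** X ** P) ** ctranspose B ** P = D ** X ** ctranspose D" for X
    by (simp add: D_def ctranspose_mult matrix_mul_assoc)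
  show ?thesis
  proof
    assume ?L
    then have X: "P ** X ** P = X"
      by metis
    then have XP: "X ** P = X"
      by (metis P_idem matrix_mul_assoc)
    show ?R
    proof (rule matrix_eqI)
      fix v
      have "X *v v = X *v (P *v v)"
        by (simp add: matrix_vector_mul_assoc XP)
      also have "\<dots> = (P ** A + P ** B ** X ** ctranspose B ** P) *v (P *v v)"
        using \<open>?L\<close> P_mult_in by blast
      also have "\<dots> = (P ** A ** P + P ** B ** X ** ctranspose B ** (P ** P)) *v v"
        by (simp only: matrix_vector_mul_assoc cmat_add_mult matrix_mul_assoc)
      also have "\<dots> = (A + P ** B ** (P ** X ** P) ** ctranspose B ** P) *v v"
        by (simp only: A_P P_idem X)
      finally show "X *v v = (A + D ** X ** ctranspose D) *v v"
        by (simp only: DXD)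
    qed
  next
    assume R: ?R
    then have "P ** X ** P = P ** A ** P + (P ** D) ** X ** (ctranspose D ** P)"
      by (metis cmat_add_mult matrix_mul_assoc)
    also have "\<dots> = X"
      by (simp only: A_P D_P ctranspose_D_P R[symmetric])
    finally have X: "P ** X ** P = X" .
    have "X = P ** A + P ** B ** X ** ctranspose B ** P"
      using R DXD[of X] by (simp only: X A_P)
    with X show ?L
      by metis
  qed
qed

lemma steady_state: "G = A + D ** G ** ctranspose D"
proof -
  obtain Y where Y: "Y = A + D ** Y ** ctranspose D"
    using regularized_solution[OF A_P] by metis
  have "G = (THE X. X = A + D ** X ** ctranspose D)"
    unfolding steady_state_def Let_def steady_state_iff ..
  also have "\<dots> = Y"
    using Y stein_unique by (intro the_equality) auto
  finally show ?thesis
    by (simp only: Y[symmetric])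
qed

lemma G_P: "P ** G = G" "G ** P = G"
proof -
  have "P ** G ** P = G"
    using steady_state_iff[of G, THEN iffD2, OF steady_state] by metis
  then show "P ** G = G" "G ** P = G"
    by (metis P_idem matrix_mul_assoc)+
qed

text \<open>\<open>- G\<^sup>\<dagger>\<close> solves the same Stein equation.\<close>

lemma G_antihermitian: "ctranspose G = - G"
proof -
  have "ctranspose (A + D ** G ** ctranspose D) = - A + D ** ctranspose G ** ctranspose D"
    by (simp add: ctranspose_add ctranspose_mult antihermitian matrix_mul_assoc)
  then have "ctranspose G = - A + D ** ctranspose G ** ctranspose D"
    by (simp only: steady_state[symmetric])
  from arg_cong[OF this, of uminus]
  have "- ctranspose G = A + D ** (- ctranspose G) ** ctranspose D"
    unfolding cmat_minus_mult minus_add_distrib minus_minus .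
  then have "- ctranspose G = G"
    using steady_state by (rule stein_unique)
  then show ?thesis
    by (metis minus_minus)
qed

lemma hermitian_iG: "hermitian (\<i> *c G)"
  by (simp add: ctranspose_cscale G_antihermitian) (simp add: vec_eq_iff)

text \<open>\<open>D D\<^sup>\<dagger> = P (I - E) P = P - E\<close>. Thus \<open>P\<close> arises
  from \<open>E\<close> as \<open>G\<close> does from \<open>A\<close>.\<close>

lemma P_stein: "P = E + D ** P ** ctranspose D"
proof -
  have "D ** P ** ctranspose D = D ** ctranspose D"
    by (simp add: D_P)
  also have "\<dots> = P ** (B ** ctranspose B) ** P"
    by (simp add: D_eq(1) ctranspose_mult matrix_mul_assoc)
  also have "B ** ctranspose B = mat 1 - E"
    by (simp add: E_def)
  also have "P ** (mat 1 - E) ** P = P - E"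
    by (simp add: cmat_diff_mult E_P)
  finally show ?thesis
    by simp
qed

text \<open>\<open>P \<plusminus> \<i> G\<close> solves the Stein equation with the nonnegative
  source \<open>E \<plusminus> \<i> A\<close>, so its form does not increase under
  \<open>D\<^sup>\<dagger>\<close>, as the Lyapunov argument requires.\<close>

lemma form_G: "\<bar>v \<bullet> ((\<i> *c G) *v v)\<bar> \<le> v \<bullet> (P *v v)"
proof -
  have "0 \<le> v \<bullet> ((P + c *c G) *v v)" if c: "c = \<i> \<or> c = - \<i>" for c
  proof (rule stable_lyapunov_nonneg[OF stable_D])
    have "hermitian (c *c G)"
      using c hermitian_iG by (auto simp: ctranspose_cscale G_antihermitian vec_eq_iff)
    then show "hermitian (P + c *c G)"
      by (simp only: ctranspose_add P_hermitian)
    fix v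
    have "P + c *c G = (E + D ** P ** ctranspose D) + c *c (A + D ** G ** ctranspose D)"
      by (simp only: P_stein[symmetric] steady_state[symmetric])
    also have "\<dots> = (E + c *c A) + D ** (P + c *c G) ** ctranspose D"
      by (simp add: cmat_add_mult cscale_mult) (simp add: vec_eq_iff algebra_simps)
    finally have "v \<bullet> ((P + c *c G) *v v)
        = v \<bullet> ((E + c *c A) *v v) + v \<bullet> ((D ** (P + c *c G) ** ctranspose D) *v v)"
      by (metis inner_add_right matrix_vector_mult_add_rdistrib)
    moreover have "0 \<le> v \<bullet> ((E + c *c A) *v v)"
      using form_E_A[of v] c by (auto simp: matrix_vector_mult_add_rdistrib inner_add_right)
    ultimately show "(ctranspose D *v v) \<bullet> ((P + c *c G) *v (ctranspose D *v v))
        \<le> v \<bullet> ((P + c *c G) *v v)"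
      by (simp only: inner_congruence)
  qed
  from this[of \<i>] this[of "- \<i>"] show ?thesis
    by (auto simp: matrix_vector_mult_add_rdistrib inner_add_right inner_diff_right)
qed

text \<open>The spectrum of \<open>H\<close> is the one of \<open>\<i> G\<close> on the dissipative space, in \<open>[-1, 1]\<close>, together with
  the eigenvalue \<open>2\<close> on the preserved space.\<close>

definition H :: "complex^'m^'m" where
  "H = \<i> *c G + 2 *c (mat 1 - P)"

lemma hermitian_H: "hermitian H"
proof -
  have "hermitian (2 *c (mat 1 - P))"
    by (simp add: ctranspose_cscale ctranspose_diff)
  then show ?thesis
    by (simp only: H_def ctranspose_add hermitian_iG)
qed

text \<open>A linear combination of the equations of \<open>G\<close> and \<open>P\<close>.
  Subtracting \<open>2 I\<close> from \<open>H\<close> frees the source from the projector.\<close>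

lemma H_limit:
  "((\<lambda>e. cramer_component (stein_matrix B e) (vec_of_mat (\<i> *c A - 2 *c E)) (i, j))
      \<longlongrightarrow> H $ i $ j - 2 * mat 1 $ i $ j) (at_right 0)"
proof -
  let ?b = "\<i> *c A - 2 *c E"
  have b: "P ** ?b = ?b" "?b ** P = ?b"
    by (simp_all add: cmat_diff_mult cscale_mult A_P E_P)
  obtain Y where Y: "Y = ?b + D ** Y ** ctranspose D" and lim:
    "\<And>l. ((\<lambda>e. cramer_component (stein_matrix B e) (vec_of_mat ?b) l) \<longlongrightarrow> vec_of_mat Y $ l) (at_right 0)"
    using regularized_solution[OF b] by metis
  have "\<i> *c G - 2 *c P = \<i> *c (A + D ** G ** ctranspose D) - 2 *c (E + D ** P ** ctranspose D)"
    by (simp only: P_stein[symmetric] steady_state[symmetric])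
  also have "\<dots> = ?b + D ** (\<i> *c G - 2 *c P) ** ctranspose D"
    by (simp add: cmat_diff_mult cscale_mult) (simp add: vec_eq_iff algebra_simps)
  finally have "Y = \<i> *c G - 2 *c P"
    using Y stein_unique by blast
  from lim[of "(i, j)", unfolded this] show ?thesis
    by (simp add: H_def algebra_simps)
qed

lemma H_on_Vd: "P *v v = v \<Longrightarrow> H *v v = (\<i> *c G) *v v"
  by (simp add: H_def matrix_vector_mult_add_rdistrib matrix_vector_mult_diff_rdistrib)

text \<open>Applying \<open>H - P H = 2 (I - P)\<close> to \<open>v\<close> gives
  \<open>(z - 2) (v - P v) = 0\<close>.\<close>

lemma H_eigenvector_cases:
  assumes "H *v v = z *s v"
  shows "z = 2 \<or> P *v v = v"
proof -
  have "H - P ** H = 2 *c (mat 1 - P)"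
    by (simp add: H_def cmat_add_mult cmat_diff_mult cscale_mult G_P) (simp add: vec_eq_iff)
  then have "H *v v - P *v (H *v v) = 2 *s (v - P *v v)"
    by (metis cscale_mult_vec mat_mult_vec matrix_vector_mul_assoc matrix_vector_mult_diff_rdistrib
        vector_smult_lid)
  then have "(z - 2) *s (v - P *v v) = 0"
    by (simp add: assms matrix_vector_mult_smult) (simp add: vec_eq_iff algebra_simps)
  then have "z - 2 = 0 \<or> v - P *v v = 0"
    by (simp only: vector_mul_eq_0)
  then show ?thesis
    by auto
qed

lemma H_eigenvalue_bound:
  assumes "H *v v = complex_of_real x *s v" "v \<noteq> 0"
  shows "x = 2 \<or> x \<in> {-1..1}"
proof (cases "x = 2")
  case False
  then have "complex_of_real x \<noteq> 2"
    by (metis of_real_eq_iff of_real_numeral)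
  then have Pv: "P *v v = v"
    using H_eigenvector_cases[OF assms(1)] by blast
  then have "(\<i> *c G) *v v = x *\<^sub>R v"
    using H_on_Vd assms(1) by (metis scaleR_cvec)
  then have "\<bar>x * (v \<bullet> v)\<bar> \<le> v \<bullet> v"
    using form_G[of v] by (simp only: Pv inner_scaleR_right)
  then have "\<bar>x\<bar> \<le> 1"
    using assms(2) by (simp add: abs_mult)
  then show ?thesis
    by auto
qed simp

lemma eigenspace_eq:
  assumes "z \<noteq> 2"
  shows "{v \<in> Vd. (\<i> *c G) *v v = z *s v} = {v. H *v v = z *s v}"
proof (intro equalityI subsetI)
  fix v
  assume "v \<in> {v. H *v v = z *s v}"
  then show "v \<in> {v \<in> Vd. (\<i> *c G) *v v = z *s v}"
    using H_eigenvector_cases[of v z] assms H_on_Vd[of v] in_Vd_iff[of v] by auto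
next
  fix v
  assume "v \<in> {v \<in> Vd. (\<i> *c G) *v v = z *s v}"
  then show "v \<in> {v. H *v v = z *s v}"
    using H_on_Vd[of v] in_Vd_iff[of v] by auto
qed

lemma eigenspace_2: "{v \<in> Vd. (\<i> *c G) *v v = 2 *s v} = {0}"
proof -
  have "v = 0" if "v \<in> Vd" "(\<i> *c G) *v v = 2 *s v" for v
  proof -
    have "(\<i> *c G) *v v = 2 *\<^sub>R v"
      using that(2) by (simp add: scaleR_cvec)
    then have "\<bar>2 * (v \<bullet> v)\<bar> \<le> v \<bullet> v"
      using form_G[of v] that(1) by (simp only: in_Vd_iff inner_scaleR_right)
    then have "v \<bullet> v = 0"
      using inner_ge_zero[of v] by linarith
    then show ?thesis
      by simp
  qed
  then show ?thesis
    using dissipative_subspace by (auto simp: vec.subspace_0)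
qed

end

section \<open>Continuity of the spectrum of a Hermitian matrix\<close>

definition orthonormal_set :: "(complex^'m) set \<Rightarrow> bool" where
  "orthonormal_set S \<longleftrightarrow> (\<forall>v\<in>S. \<forall>w\<in>S. hinner v w = (if v = w then 1 else 0))"

lemma orthonormal_set_coefficient:
  assumes "orthonormal_set S" "finite S" "w \<in> S"
  shows "hinner w (\<Sum>v\<in>S. c v *s v) = c w"
proof -
  have "hinner w (\<Sum>v\<in>S. c v *s v) = (\<Sum>v\<in>S. c v * hinner w v)"
    by (simp add: hinner_sum_right)
  also have "\<dots> = (\<Sum>v\<in>S. if w = v then c v else 0)"
    using assms by (intro sum.cong) (auto simp: orthonormal_set_def)
  finally show ?thesis
    using assms by simp
qed

lemma orthonormal_set_independent:
  assumes "orthonormal_set S" "finite S"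
  shows "vec.independent S"
proof
  assume "vec.dependent S"
  then obtain u v where "(\<Sum>w\<in>S. u w *s w) = 0" "v \<in> S" "u v \<noteq> 0"
    using assms(2) by (auto simp: vec.dependent_finite)
  then show False
    using orthonormal_set_coefficient[OF assms, of v u] by simp
qed

lemma orthonormal_set_card:
  assumes "orthonormal_set (S :: (complex^'m) set)" "finite S"
  shows "card S \<le> CARD('m)"
  using vec.independent_card_le_dim[of S UNIV] orthonormal_set_independent[OF assms]
  by (simp add: vec_dim_card card_cart_basis)

text \<open>The rows of \<open>W\<close> are the eigenvectors. Indexing by \<open>'m\<close>, with
  repetitions in \<open>d\<close>, places all frames in one finite-dimensional normed space, where
  bounded sequences have convergent subsequences.\<close>

definition eigenframe :: "complex^'m^'m \<Rightarrow> real^'m \<Rightarrow> complex^'m^'m \<Rightarrow> bool" where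
  "eigenframe H d W \<longleftrightarrow> (\<forall>i j. hinner (W $ i) (W $ j) = (if i = j then 1 else 0)) \<and>
     (\<forall>i. H *v (W $ i) = complex_of_real (d $ i) *s (W $ i))"

text \<open>A maximal orthonormal set of eigenvectors is a basis, since its orthogonal complement is
  invariant.\<close>

lemma hermitian_eigenframe:
  fixes H :: "complex^'m^'m"
  assumes H: "hermitian H"
  obtains d W where "eigenframe H d W"
proof -
  define Q where "Q S \<longleftrightarrow> orthonormal_set S \<and> finite S \<and> (\<forall>v\<in>S. \<exists>x. H *v v = complex_of_real x *s v)"
    for S :: "(complex^'m) set"
  have "Q {}"
    by (simp add: Q_def orthonormal_set_def)
  moreover have "\<forall>S. Q S \<longrightarrow> card S < Suc CARD('m)"
    using orthonormal_set_card by (auto simp: Q_def less_Suc_eq_le)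
  ultimately obtain S where S: "Q S" and max: "\<And>T. Q T \<Longrightarrow> card T \<le> card S"
    using ex_has_greatest_nat[of Q "{}" card "Suc CARD('m)"] by blast
  define V where "V = {w. \<forall>v\<in>S. hinner v w = 0}"
  have zero: "u = 0" if uV: "u \<in> V" for u
  proof (rule ccontr)
    assume "u \<noteq> 0"
    have "vec.subspace V"
      by (auto simp: V_def vec.subspace_def hinner_add_right)
    moreover have "H *v w \<in> V" if "w \<in> V" for w
    proof -
      have "hinner v (H *v w) = 0" if "v \<in> S" for v
      proof -
        obtain x where "H *v v = complex_of_real x *s v"
          using S \<open>v \<in> S\<close> unfolding Q_def by blast
        then show ?thesis
          using \<open>w \<in> V\<close> \<open>v \<in> S\<close> hinner_ctranspose[of v H w] by (simp add: H V_def)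
      qed
      then show ?thesis
        by (simp add: V_def)
    qed
    ultimately obtain v x where v: "v \<in> V" "norm v = 1" "H *v v = complex_of_real x *s v"
      using hermitian_eigenvector[OF H _ _ uV \<open>u \<noteq> 0\<close>] by metis
    have vS: "hinner w v = 0 \<and> hinner v w = 0" if "w \<in> S" for w
      using v(1) that cnj_hinner[of w v] by (auto simp: V_def)
    then have vnS: "v \<notin> S"
      using v(2) by (metis hinner_self_eq_0 norm_zero zero_neq_one)
    have "Q (insert v S)"
      using S v vS vnS unfolding Q_def orthonormal_set_def by (auto simp: hinner_self)
    from max[OF this] show False
      using vnS S by (simp add: Q_def)
  qed
  have residual: "x - (\<Sum>v\<in>S. hinner v x *s v) \<in> V" for x
  proof -
    have "hinner w (\<Sum>v\<in>S. hinner v x *s v) = hinner w x" if "w \<in> S" for w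
      using S that by (simp add: Q_def orthonormal_set_coefficient)
    then show ?thesis
      by (simp add: V_def hinner_diff_right)
  qed
  have "x \<in> vec.span S" for x
  proof -
    have "x = (\<Sum>v\<in>S. hinner v x *s v)"
      using zero[OF residual[of x]] by simp
    also have "\<dots> \<in> vec.span S"
      by (intro vec.span_sum vec.span_scale vec.span_base)
    finally show ?thesis .
  qed
  then have "UNIV \<subseteq> vec.span S"
    by blast
  then have "CARD('m) \<le> card S"
    using vec.dim_le_card[of UNIV S] S by (simp add: Q_def vec_dim_card card_cart_basis)
  then have "card S = CARD('m)"
    using orthonormal_set_card S by (metis Q_def le_antisym)
  then obtain f where f: "bij_betw f (UNIV :: 'm set) S"
    using S by (metis Q_def finite_class.finite_UNIV finite_same_card_bij)
  have fS: "f i \<in> S" "f i = f j \<longleftrightarrow> i = j" for i j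
    using f by (auto simp: bij_betw_def inj_on_def)
  obtain g where g: "\<And>v. v \<in> S \<Longrightarrow> H *v v = complex_of_real (g v) *s v"
    using S unfolding Q_def by metis
  have "eigenframe H (\<chi> i. g (f i)) (\<chi> i. f i)"
    using S fS g by (simp add: eigenframe_def Q_def orthonormal_set_def)
  then show ?thesis
    by (rule that)
qed

lemma eigenframe_norm: "eigenframe H d W \<Longrightarrow> norm (W $ i) = 1"
  using hinner_self[of "W $ i"] unfolding eigenframe_def
  by (metis norm_ge_zero of_real_eq_1_iff power2_eq_1_iff abs_of_nonneg abs_1 power2_abs zero_neq_neg_one
      norm_not_less_zero neg_less_0_iff_less zero_less_one)

lemma eigenframe_inj: "eigenframe H d W \<Longrightarrow> inj (($) W)"
  unfolding eigenframe_def by (metis injI zero_neq_one)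

lemma eigenframe_orthonormal:
  assumes "eigenframe H d W"
  shows "orthonormal_set (range (($) W))"
  using inj_eq[OF eigenframe_inj[OF assms]] assms by (auto simp: orthonormal_set_def eigenframe_def)

lemma eigenframe_span:
  assumes "eigenframe (H :: complex^'m^'m) d W"
  shows "vec.span (range (($) W)) = UNIV"
proof -
  have "card (range (($) W)) = CARD('m)"
    by (simp add: card_image[OF eigenframe_inj[OF assms]])
  then show ?thesis
    using vec.card_ge_dim_independent[of "range (($) W)" UNIV]
      orthonormal_set_independent[OF eigenframe_orthonormal[OF assms]] by (auto simp: vec_dim_card card_cart_basis)
qed

text \<open>Evaluating \<open>hinner (W $ j) (H *v v)\<close> from either side shows that an
  eigenvector \<open>v\<close> has no component along \<open>W $ j\<close> unless
  \<open>d $ j = z\<close>.\<close>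

lemma eigenframe_eigenspace_dim:
  assumes fr: "eigenframe (H :: complex^'m^'m) d W" and H: "hermitian H"
  shows "vec.dim {v. H *v v = z *s v} = card {i. complex_of_real (d $ i) = z}"
proof -
  let ?I = "{i. complex_of_real (d $ i) = z}" and ?E = "{v. H *v v = z *s v}"
  have sub: "vec.subspace ?E"
    by (auto simp: vec.subspace_def matrix_vector_right_distrib matrix_vector_mult_smult
        vector_add_ldistrib mult.commute)
  have "?E \<subseteq> vec.span (($) W ` ?I)"
  proof
    fix v
    assume v: "v \<in> ?E"
    have "v \<in> vec.span (range (($) W))"
      using eigenframe_span[OF fr] by simp
    then obtain c where "v = (\<Sum>w\<in>range (($) W). c w *s w)"
      by (auto simp: vec.span_finite)
    moreover from this have coeff: "hinner (W $ j) v = c (W $ j)" for j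
      using orthonormal_set_coefficient[OF eigenframe_orthonormal[OF fr], of "W $ j" c] by simp
    ultimately have c: "v = (\<Sum>i\<in>UNIV. c (W $ i) *s (W $ i))"
      by (simp add: sum.reindex[OF eigenframe_inj[OF fr]])
    have zero: "c (W $ j) = 0" if "j \<notin> ?I" for j
    proof -
      have "z * hinner (W $ j) v = hinner (W $ j) (H *v v)"
        using v by simp
      also have "\<dots> = complex_of_real (d $ j) * hinner (W $ j) v"
        using fr by (simp add: hinner_ctranspose H eigenframe_def)
      finally show ?thesis
        using that by (simp add: coeff)
    qed
    have "v = (\<Sum>i\<in>?I. c (W $ i) *s (W $ i))"
      by (subst c, rule sum.mono_neutral_right) (auto simp: zero)
    then show "v \<in> vec.span (($) W ` ?I)"
      by (metis (no_types, lifting) image_eqI vec.span_base vec.span_scale vec.span_sum)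
  qed
  moreover have "($) W ` ?I \<subseteq> ?E"
    using fr by (auto simp: eigenframe_def)
  then have "vec.span (($) W ` ?I) \<subseteq> ?E"
    using sub by (rule vec.span_minimal)
  ultimately have "?E = vec.span (($) W ` ?I)"
    by blast
  moreover have "vec.independent (($) W ` ?I)"
    using orthonormal_set_independent[OF eigenframe_orthonormal[OF fr]]
    by (rule vec.independent_mono) auto
  ultimately show ?thesis
    using eigenframe_inj[OF fr] by (simp add: vec.dim_eq_card_independent card_image inj_on_subset)
qed

lemma count_image_mset_set: "finite I \<Longrightarrow> count (image_mset f (mset_set I)) z = card {i \<in> I. f i = z}"
  by (simp add: count_image_mset vimage_def Int_def conj_commute)

lemma count_sum_replicate_mset:
  "finite Z \<Longrightarrow> count (\<Sum>w\<in>Z. replicate_mset (n w) w) z = (if z \<in> Z then n z else 0)"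
  by (simp add: count_sum)

text \<open>The eigenvalue \<open>2\<close> marks the preserved modes.\<close>

definition frame_energies :: "real^'m \<Rightarrow> ereal multiset" where
  "frame_energies d = image_mset (\<lambda>i. entanglement_energy (d $ i)) (mset_set {i. d $ i \<noteq> 2})"

lemma frame_energies_alt:
  "frame_energies d = image_mset (\<lambda>z. entanglement_energy (Re z))
     (filter_mset (\<lambda>z. z \<noteq> 2) (image_mset (\<lambda>i. complex_of_real (d $ i)) (mset_set UNIV)))"
proof -
  have "complex_of_real x = 2 \<longleftrightarrow> x = 2" for x
    by (metis of_real_eq_iff of_real_numeral)
  then show ?thesis
    by (simp add: frame_energies_def filter_mset_image_mset filter_mset_mset_set multiset.map_comp comp_def)
qed

lemma eigenframe_unique:
  assumes "eigenframe H d W" "eigenframe H d' W'" "hermitian H"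
  shows "frame_energies d = frame_energies d'"
proof -
  have "image_mset (\<lambda>i. complex_of_real (d $ i)) (mset_set UNIV)
      = image_mset (\<lambda>i. complex_of_real (d' $ i)) (mset_set UNIV)"
    using eigenframe_eigenspace_dim[OF assms(1,3)] eigenframe_eigenspace_dim[OF assms(2,3)]
    by (intro multiset_eqI) (simp add: count_image_mset_set)
  then show ?thesis
    by (simp only: frame_energies_alt)
qed

context momentum_channel
begin

lemma spectrum_eq_frame_energies:
  assumes fr: "eigenframe H d W"
  shows "image_mset (\<lambda>z. entanglement_energy (Re z)) (eigenvalues_on Vd (\<i> *c G)) = frame_energies d"
proof -
  let ?S = "\<lambda>z. {v \<in> Vd. (\<i> *c G) *v v = z *s v}"
  let ?Z = "{z. \<exists>v\<in>Vd. v \<noteq> 0 \<and> (\<i> *c G) *v v = z *s v}"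
  have dim: "vec.dim (?S z) = (if z = 2 then 0 else card {i. complex_of_real (d $ i) = z})" for z
    using eigenframe_eigenspace_dim[OF fr hermitian_H, of z] eigenspace_eq[of z] eigenspace_2
    by (auto simp: vec.dim_eq_0)
  have Z: "z \<in> ?Z \<longleftrightarrow> vec.dim (?S z) \<noteq> 0" for z
    by (auto simp: vec.dim_eq_0)
  \<comment> \<open>Finiteness matters: a sum over an infinite \<open>?Z\<close> would be the empty
    multiset by convention.\<close>
  have "?Z \<subseteq> range (\<lambda>i. complex_of_real (d $ i))"
  proof
    fix z
    assume "z \<in> ?Z"
    then have "(if z = 2 then 0 else card {i. complex_of_real (d $ i) = z}) \<noteq> 0"
      unfolding Z dim .
    then have "\<exists>i. complex_of_real (d $ i) = z"
      by (auto simp: card_gt_0_iff split: if_splits)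
    then show "z \<in> range (\<lambda>i. complex_of_real (d $ i))"
      by auto
  qed
  then have "finite ?Z"
    by (rule finite_subset) simp
  then have "count (eigenvalues_on Vd (\<i> *c G)) z = (if z \<in> ?Z then vec.dim (?S z) else 0)" for z
    unfolding eigenvalues_on_def by (rule count_sum_replicate_mset)
  then have "count (eigenvalues_on Vd (\<i> *c G)) z = vec.dim (?S z)" for z
    using Z[of z] by (simp only:) auto
  then have "eigenvalues_on Vd (\<i> *c G)
      = filter_mset (\<lambda>z. z \<noteq> 2) (image_mset (\<lambda>i. complex_of_real (d $ i)) (mset_set UNIV))"
    by (intro multiset_eqI) (simp only: dim count_filter_mset count_image_mset_set finite, simp)
  then show ?thesis
    by (simp only: frame_energies_alt)
qed

lemma frame_range:
  assumes "eigenframe H d W"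
  shows "d $ i = 2 \<or> d $ i \<in> {-1..1}"
proof (rule H_eigenvalue_bound)
  show "H *v (W $ i) = complex_of_real (d $ i) *s (W $ i)"
    using assms by (simp add: eigenframe_def)
  show "W $ i \<noteq> 0"
    using eigenframe_norm[OF assms, of i] by auto
qed

end

section \<open>Continuity of the entanglement energy up to the ends of
  \<open>[-1, 1]\<close>\<close>

lemma entanglement_energy_uminus: "x \<in> {-1..1} \<Longrightarrow> entanglement_energy (- x) = - entanglement_energy x"
proof -
  assume x: "x \<in> {-1..1}"
  consider "x = 1" | "x = -1" | "-1 < x" "x < 1"
    using x by force
  then show ?thesis
  proof cases
    case 3
    then have "ln ((1 + x) / (1 - x)) = - ln ((1 - x) / (1 + x))"
      by (simp add: ln_div)
    with 3 show ?thesis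
      by (simp add: entanglement_energy_def)
  qed (simp_all add: entanglement_energy_def)
qed

lemma tendsto_entanglement_energy_minus_1:
  assumes f: "\<And>n. f n \<in> {-1..1}" and lim: "f \<longlonglongrightarrow> -1"
  shows "(\<lambda>n. entanglement_energy (f n)) \<longlonglongrightarrow> entanglement_energy (-1)"
proof -
  have "\<forall>\<^sub>F n in sequentially. ereal r < entanglement_energy (f n)" for r
  proof -
    \<comment> \<open>The point with energy \<open>r\<close>:
      \<open>(1 - ?t) / (1 + ?t) = exp r\<close>.\<close>
    let ?t = "(1 - exp r) / (1 + exp r)"
    have pos: "0 < 1 + exp r"
      by (simp add: add_pos_pos)
    have t: "-1 < ?t" "?t < 1"
      using pos by (simp_all add: field_simps)
    from order_tendstoD(2)[OF lim t(1)] show ?thesis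
    proof eventually_elim
      case (elim n)
      show ?case
      proof (cases "f n = -1")
        case False
        then have "-1 < f n" "f n < 1"
          using f[of n] elim t by auto
        moreover from this have "exp r < (1 - f n) / (1 + f n)"
          using elim pos by (simp add: field_simps)
        then have "r < ln ((1 - f n) / (1 + f n))"
          by (metis exp_gt_zero ln_exp ln_less_cancel_iff order_less_trans)
        ultimately show ?thesis
          by (simp add: entanglement_energy_def)
      qed (simp add: entanglement_energy_def)
    qed
  qed
  then show ?thesis
    by (simp add: entanglement_energy_def tendsto_PInfty)
qed

lemma tendsto_entanglement_energy:
  assumes f: "\<And>n. f n \<in> {-1..1}" and lim: "f \<longlonglongrightarrow> x"
  shows "(\<lambda>n. entanglement_energy (f n)) \<longlonglongrightarrow> entanglement_energy x"
proof -
  have x: "x \<in> {-1..1}"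
    using closed_sequentially[OF closed_atLeastAtMost f lim] by simp
  consider "x = -1" | "x = 1" | "-1 < x" "x < 1"
    using x by force
  then show ?thesis
  proof cases
    case 1
    then show ?thesis
      using tendsto_entanglement_energy_minus_1[of f] f lim by simp
  next
    case 2
    \<comment> \<open>Reflection reduces the end \<open>1\<close> to the end
      \<open>-1\<close>.\<close>
    have "(\<lambda>n. entanglement_energy (- f n)) \<longlonglongrightarrow> entanglement_energy (-1)"
      using f tendsto_minus[OF lim] 2
      by (intro tendsto_entanglement_energy_minus_1) (force, simp)
    then have "(\<lambda>n. - entanglement_energy (f n)) \<longlonglongrightarrow> - entanglement_energy 1"
      using f entanglement_energy_uminus[of 1] by (simp add: entanglement_energy_uminus)
    then show ?thesis
      unfolding 2 by (simp add: ereal_Lim_uminus[of _ "entanglement_energy 1"])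
  next
    case 3
    have ev: "\<forall>\<^sub>F n in sequentially. ereal (ln ((1 - f n) / (1 + f n))) = entanglement_energy (f n)"
      using order_tendstoD(1)[OF lim 3(1)] order_tendstoD(2)[OF lim 3(2)]
      by eventually_elim (simp add: entanglement_energy_def)
    have "(\<lambda>n. ereal (ln ((1 - f n) / (1 + f n)))) \<longlonglongrightarrow> ereal (ln ((1 - x) / (1 + x)))"
      using 3 by (intro tendsto_intros lim) auto
    from Lim_transform_eventually[OF this ev] show ?thesis
      using 3 by (simp add: entanglement_energy_def[of x])
  qed
qed

text \<open>By compactness of the set of orthonormal eigenframes.\<close>

lemma frame_energies_continuous:
  fixes H0 :: "complex^'m^'m"
  assumes H0: "(Hs \<longlongrightarrow> H0) F"
    and fr: "\<And>k. eigenframe (Hs k) (d k) (W k)"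
    and range: "\<And>k i. d k $ i = 2 \<or> d k $ i \<in> {-1..1}"
    and h0: "hermitian H0" and fr0: "eigenframe H0 d0 W0"
  shows "mset_tendsto (\<lambda>k. frame_energies (d k)) (frame_energies d0) F"
  unfolding mset_tendsto_def
proof (intro allI impI)
  fix N
  assume N: "\<forall>x\<in>#frame_energies d0. open (N x) \<and> x \<in> N x"
  let ?R = "\<lambda>k. rel_mset (\<lambda>x y. y \<in> N x) (frame_energies d0) (frame_energies (d k))"
  \<comment> \<open>A failure yields frames of matrices tending to \<open>H0\<close>, from which a
    convergent subsequence is extracted.\<close>
  have "\<exists>\<delta>>0. \<forall>k. dist (Hs k) H0 < \<delta> \<longrightarrow> ?R k"
  proof (rule ccontr)
    assume *: "\<not> ?thesis"
    have "\<exists>k. dist (Hs k) H0 < 1 / Suc n \<and> \<not> ?R k" for n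
      using * by (metis of_nat_0_less_iff zero_less_Suc zero_less_divide_1_iff)
    then obtain k where k: "\<And>n. dist (Hs (k n)) H0 < 1 / Suc n" "\<And>n. \<not> ?R (k n)"
      by metis
    have Hk: "(\<lambda>n. Hs (k n)) \<longlonglongrightarrow> H0"
    proof (rule metric_LIMSEQ_I)
      fix r :: real
      assume "0 < r"
      then obtain m where "1 / Suc m < r"
        using nat_approx_posE by blast
      then show "\<exists>no. \<forall>n\<ge>no. dist (Hs (k n)) H0 < r"
      proof (intro exI[of _ m] allI impI)
        fix n
        assume "m \<le> n"
        then have "1 / real (Suc n) \<le> 1 / real (Suc m)"
          by (intro divide_left_mono) auto
        with k(1)[of n] \<open>1 / Suc m < r\<close> show "dist (Hs (k n)) H0 < r"
          by linarith
      qed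
    qed
    have "norm (d k) \<le> 2 * real CARD('m)" for k
    proof -
      have "norm (d k) \<le> (\<Sum>i\<in>UNIV. \<bar>d k $ i\<bar>)"
        using norm_le_l1_cart by blast
      also have "\<dots> \<le> (\<Sum>i\<in>(UNIV::'m set). 2)"
        using range[of k] by (intro sum_mono) (smt (verit) atLeastAtMost_iff)
      finally show ?thesis
        by simp
    qed
    moreover have "norm (W k) \<le> real CARD('m)" for k
    proof -
      have "norm (W k) \<le> (\<Sum>i\<in>UNIV. norm (W k $ i))"
        unfolding norm_vec_def by (rule L2_set_le_sum) simp
      then show ?thesis
        by (simp add: eigenframe_norm[OF fr])
    qed
    ultimately have "bounded (range (\<lambda>n. (d (k n), W (k n))))"
      by (intro bounded_subset[OF bounded_Times[OF bounded_cball[of 0 "2 * real CARD('m)"] bounded_cball[of 0 "real CARD('m)"]]]) auto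
    then obtain l r where r: "strict_mono r" and lim: "((\<lambda>n. (d (k n), W (k n))) \<circ> r) \<longlonglongrightarrow> l"
      using bounded_imp_convergent_subsequence by blast
    define e V where "e = fst l" and "V = snd l"
    have de: "(\<lambda>n. d (k (r n))) \<longlonglongrightarrow> e" and WV: "(\<lambda>n. W (k (r n))) \<longlonglongrightarrow> V"
      using tendsto_fst[OF lim] tendsto_snd[OF lim] by (simp_all add: comp_def e_def V_def)
    have di: "(\<lambda>n. d (k (r n)) $ i) \<longlonglongrightarrow> e $ i" for i
      by (rule tendsto_vec_nth[OF de])
    have Wi: "(\<lambda>n. W (k (r n)) $ i $ j) \<longlonglongrightarrow> V $ i $ j" for i j
      by (intro tendsto_vec_nth WV)
    have Hi: "(\<lambda>n. Hs (k (r n)) $ i $ j) \<longlonglongrightarrow> H0 $ i $ j" for i j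
      using LIMSEQ_subseq_LIMSEQ[OF Hk r] by (intro tendsto_vec_nth) (simp add: comp_def)
    have frV: "eigenframe H0 e V"
      unfolding eigenframe_def
    proof (intro conjI allI)
      fix i j
      have "(\<lambda>n. hinner (W (k (r n)) $ i) (W (k (r n)) $ j)) \<longlonglongrightarrow> hinner (V $ i) (V $ j)"
        unfolding hinner_def by (intro tendsto_intros Wi)
      then show "hinner (V $ i) (V $ j) = (if i = j then 1 else 0)"
        using fr by (simp add: eigenframe_def LIMSEQ_const_iff)
    next
      fix i
      have "(H0 *v (V $ i)) $ j = complex_of_real (e $ i) * V $ i $ j" for j
      proof (rule LIMSEQ_unique)
        show "(\<lambda>n. (Hs (k (r n)) *v (W (k (r n)) $ i)) $ j) \<longlonglongrightarrow> (H0 *v (V $ i)) $ j"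
          unfolding matrix_vector_mult_def by (simp, intro tendsto_intros Wi Hi)
        have "(\<lambda>n. complex_of_real (d (k (r n)) $ i) * W (k (r n)) $ i $ j)
            \<longlonglongrightarrow> complex_of_real (e $ i) * V $ i $ j"
          by (intro tendsto_intros Wi di)
        then show "(\<lambda>n. (Hs (k (r n)) *v (W (k (r n)) $ i)) $ j)
            \<longlonglongrightarrow> complex_of_real (e $ i) * V $ i $ j"
          using fr by (simp add: eigenframe_def)
      qed
      then show "H0 *v (V $ i) = complex_of_real (e $ i) *s (V $ i)"
        by (simp add: vec_eq_iff)
    qed
    \<comment> \<open>The limit frame may differ from \<open>W0\<close>, but the energies depend on
      \<open>H0\<close> only.\<close>
    have e0: "frame_energies d0 = frame_energies e"
      by (rule eigenframe_unique[OF fr0 frV h0])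
    \<comment> \<open>The gap at work: an eigenvalue beyond \<open>1\<close> equals
      \<open>2\<close>, so preserved and dissipative indices do not mix near the limit.\<close>
    have sep: "\<forall>\<^sub>F n in sequentially. d (k (r n)) $ i = 2 \<longleftrightarrow> e $ i = 2" for i
    proof (cases "e $ i = 2")
      case True
      then have "\<forall>\<^sub>F n in sequentially. 1 < d (k (r n)) $ i"
        using order_tendstoD(1)[OF di, of 1 i] by simp
      then show ?thesis
        by eventually_elim (use range True in force)
    next
      case False
      then have "\<forall>\<^sub>F n in sequentially. d (k (r n)) $ i \<noteq> 2"
        by (rule tendsto_imp_eventually_ne[OF di])
      then show ?thesis
        by eventually_elim (use False in simp)
    qed
    have near: "\<forall>\<^sub>F n in sequentially. e $ i \<noteq> 2 \<longrightarrow>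
        entanglement_energy (d (k (r n)) $ i) \<in> N (entanglement_energy (e $ i))" for i
    proof (cases "e $ i = 2")
      case False
      \<comment> \<open>The value \<open>2\<close>, taken for finitely many \<open>n\<close> only,
        is replaced by \<open>0\<close> to stay in \<open>[-1, 1]\<close> for all
        \<open>n\<close>.\<close>
      define f where "f n = (if d (k (r n)) $ i = 2 then 0 else d (k (r n)) $ i)" for n
      have ev: "\<forall>\<^sub>F n in sequentially. d (k (r n)) $ i = f n"
        using sep[of i] by eventually_elim (simp add: f_def False)
      have "f \<longlonglongrightarrow> e $ i"
        using Lim_transform_eventually[OF di ev] .
      moreover have "f n \<in> {-1..1}" for n
        using range[of "k (r n)" i] by (auto simp: f_def)
      ultimately have "(\<lambda>n. entanglement_energy (f n)) \<longlonglongrightarrow> entanglement_energy (e $ i)"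
        by (intro tendsto_entanglement_energy)
      moreover have "entanglement_energy (e $ i) \<in># frame_energies d0"
        using False unfolding e0 by (auto simp: frame_energies_def)
      then have "open (N (entanglement_energy (e $ i)))"
        "entanglement_energy (e $ i) \<in> N (entanglement_energy (e $ i))"
        using N by auto
      ultimately have "\<forall>\<^sub>F n in sequentially. entanglement_energy (f n) \<in> N (entanglement_energy (e $ i))"
        by (rule topological_tendstoD)
      with ev show ?thesis
        by eventually_elim simp
    qed simp
    have "\<forall>\<^sub>F n in sequentially. \<forall>i. (d (k (r n)) $ i = 2 \<longleftrightarrow> e $ i = 2) \<and>
        (e $ i \<noteq> 2 \<longrightarrow> entanglement_energy (d (k (r n)) $ i) \<in> N (entanglement_energy (e $ i)))"
      by (intro eventually_all_finite eventually_conj sep near)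
    then obtain n where n: "\<And>i. d (k (r n)) $ i = 2 \<longleftrightarrow> e $ i = 2"
      "\<And>i. e $ i \<noteq> 2 \<Longrightarrow> entanglement_energy (d (k (r n)) $ i) \<in> N (entanglement_energy (e $ i))"
      using eventually_happens'[OF sequentially_bot] by blast
    have "rel_mset (\<lambda>x y. y \<in> N x) (frame_energies e) (frame_energies (d (k (r n))))"
      unfolding frame_energies_def n(1)
      by (intro multiset.rel_map(1)[THEN iffD2] multiset.rel_map(2)[THEN iffD2]
          multiset.rel_refl_strong) (simp add: n(2))
    then show False
      using k(2)[of "r n"] by (simp add: e0)
  qed
  then obtain \<delta> where "\<delta> > 0" "\<And>k. dist (Hs k) H0 < \<delta> \<Longrightarrow> ?R k"
    by blast
  then show "\<forall>\<^sub>F k in F. ?R k"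
    using tendstoD[OF H0, of \<delta>] by (auto elim: eventually_mono)
qed

section \<open>Rational dependence on the momentum\<close>

lemma cis_eq_imp_eq:
  assumes "cis k = cis l" "\<bar>k - l\<bar> < 2 * pi"
  shows "k = l"
proof -
  have "cis (k - l) = 1"
    using assms(1) by (simp add: cis_divide[symmetric])
  then have "cos (k - l) = 1"
    by (metis cis.sel(1) one_complex.sel(1))
  then obtain n :: int where n: "k - l = n * 2 * pi"
    by (auto simp: cos_one_2pi_int)
  then have "\<bar>k - l\<bar> = \<bar>real_of_int n\<bar> * (2 * pi)"
    by (simp add: abs_mult)
  then have "\<bar>real_of_int n\<bar> * (2 * pi) < 1 * (2 * pi)"
    using assms(2) by simp
  then have "\<bar>real_of_int n\<bar> < 1"
    by (rule mult_right_less_imp_less) simp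
  then have "n = 0"
    by linarith
  then show ?thesis
    using n by simp
qed

lemma cis_eventually_neq: "\<forall>\<^sub>F k in at k0. cis k \<noteq> z"
proof (cases "cis k0 = z")
  case True
  have "cis k \<noteq> cis k0" if "dist k k0 < 1" "k \<noteq> k0" for k
    using cis_eq_imp_eq[of k k0] that pi_gt3 by (auto simp: dist_real_def)
  then show ?thesis
    unfolding True[symmetric] eventually_at by (intro exI[of _ 1]) auto
next
  case False
  have "(cis \<longlongrightarrow> cis k0) (at k0)"
    by (intro tendsto_intros)
  then show ?thesis
    using False by (rule tendsto_imp_eventually_ne)
qed

lemma tendsto_poly_cis: "((\<lambda>k. poly p (cis k)) \<longlongrightarrow> poly p (cis k0)) (at k0)"
  by (intro tendsto_intros)

lemma poly_cis_eventually_neq: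
  assumes "p \<noteq> 0"
  shows "\<forall>\<^sub>F k in at k0. poly p (cis k) \<noteq> 0"
proof -
  have "\<forall>\<^sub>F k in at k0. \<forall>z\<in>{z. poly p z = 0}. cis k \<noteq> z"
    using cis_eventually_neq by (intro eventually_ball_finite poly_roots_finite assms) auto
  then show ?thesis
    by eventually_elim auto
qed

text \<open>Induction on the degree of \<open>q\<close>: at a zero of \<open>q\<close> boundedness
  forces \<open>p\<close> to vanish as well, and the common factor \<open>cis k - cis k0\<close>
  cancels on a punctured neighbourhood.\<close>

lemma bounded_rational_limit:
  fixes g :: "real \<Rightarrow> complex"
  assumes "q \<noteq> 0" "\<forall>\<^sub>F k in at k0. poly q (cis k) * g k = poly p (cis k)" "\<And>k. cmod (g k) \<le> C"
  shows "\<exists>l. (g \<longlongrightarrow> l) (at k0)"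
  using assms(1,2)
proof (induction "degree q" arbitrary: p q rule: less_induct)
  case less
  let ?z = "cis k0"
  show ?case
  proof (cases "poly q ?z = 0")
    case False
    have "((\<lambda>k. poly p (cis k) / poly q (cis k)) \<longlongrightarrow> poly p ?z / poly q ?z) (at k0)"
      using False by (intro tendsto_divide tendsto_poly_cis)
    moreover have "\<forall>\<^sub>F k in at k0. poly p (cis k) / poly q (cis k) = g k"
      using less.prems(2) poly_cis_eventually_neq[OF less.prems(1)]
      by eventually_elim (simp add: field_simps)
    ultimately show ?thesis
      by (blast intro: Lim_transform_eventually)
  next
    case True
    have "((\<lambda>k. poly q (cis k) * g k) \<longlongrightarrow> 0) (at k0)"
    proof (rule tendsto_0_le)
      show "((\<lambda>k. poly q (cis k)) \<longlongrightarrow> 0) (at k0)"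
        using tendsto_poly_cis[of q k0] by (simp only: True)
      show "\<forall>\<^sub>F k in at k0. norm (poly q (cis k) * g k) \<le> norm (poly q (cis k)) * C"
        using assms(3) by (simp add: norm_mult mult_left_mono)
    qed
    from tendsto_unique[OF _ tendsto_poly_cis Lim_transform_eventually[OF this less.prems(2)]]
    have "poly p ?z = 0"
      by simp
    with True obtain p' q' where p: "p = [:-?z, 1:] * p'" and q: "q = [:-?z, 1:] * q'"
      unfolding poly_eq_0_iff_dvd by (elim dvdE) blast
    have "q' \<noteq> 0"
      using less.prems(1) q by auto
    moreover have "degree q = Suc (degree q')"
      unfolding q using \<open>q' \<noteq> 0\<close> by (subst degree_mult_eq) auto
    moreover have "\<forall>\<^sub>F k in at k0. poly q' (cis k) * g k = poly p' (cis k)"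
      using less.prems(2) cis_eventually_neq[of ?z k0]
    proof eventually_elim
      case (elim k)
      then have "(cis k - ?z) * (poly q' (cis k) * g k) = (cis k - ?z) * poly p' (cis k)"
        by (simp add: p q algebra_simps)
      with elim(2) show ?case
        by simp
    qed
    ultimately show ?thesis
      using less.hyps[of q' p'] by simp
  qed
qed

text \<open>Polynomials in \<open>\<epsilon>\<close> whose coefficients are trigonometric polynomials in \<open>k\<close>, up to a power
  of \<open>e\<^sup>i\<^sup>k\<close>: in the bivariate polynomial \<open>Q\<close> the outer variable is \<open>\<epsilon>\<close>, the inner one \<open>e\<^sup>i\<^sup>k\<close>.\<close>

definition bitrig :: "(complex \<Rightarrow> real \<Rightarrow> complex) \<Rightarrow> bool" where
  "bitrig \<phi> \<longleftrightarrow> (\<exists>n Q. \<forall>e k. cis k ^ n * \<phi> e k = poly (poly Q [:e:]) (cis k))"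

lemma bitrigI: "(\<And>e k. cis k ^ n * \<phi> e k = poly (poly Q [:e:]) (cis k)) \<Longrightarrow> bitrig \<phi>"
  unfolding bitrig_def by blast

lemma bitrig_const: "bitrig (\<lambda>e k. c)"
  by (rule bitrigI[of 0 _ "[:[:c:]:]"]) simp

lemma bitrig_eps: "bitrig (\<lambda>e k. e)"
  by (rule bitrigI[of 0 _ "[:0, 1:]"]) simp

lemma bitrig_cis: "bitrig (\<lambda>e k. cis k)"
  by (rule bitrigI[of 0 _ "[:[:0, 1:]:]"]) simp

lemma bitrig_cis_minus: "bitrig (\<lambda>e k. cis (- k))"
  by (rule bitrigI[of 1 _ 1]) (simp add: cis_mult)

lemma bitrig_add:
  assumes "bitrig \<phi>" "bitrig \<psi>"
  shows "bitrig (\<lambda>e k. \<phi> e k + \<psi> e k)"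
proof -
  obtain n Q m R where Q: "\<And>e k. cis k ^ n * \<phi> e k = poly (poly Q [:e:]) (cis k)"
    and R: "\<And>e k. cis k ^ m * \<psi> e k = poly (poly R [:e:]) (cis k)"
    using assms unfolding bitrig_def by metis
  show ?thesis
  proof (rule bitrigI)
    fix e k
    have "cis k ^ (n + m) * (\<phi> e k + \<psi> e k)
        = cis k ^ m * (cis k ^ n * \<phi> e k) + cis k ^ n * (cis k ^ m * \<psi> e k)"
      by (simp add: power_add algebra_simps)
    also have "\<dots> = poly (poly ([:monom 1 m:] * Q + [:monom 1 n:] * R) [:e:]) (cis k)"
      by (simp add: Q R poly_monom)
    finally show "cis k ^ (n + m) * (\<phi> e k + \<psi> e k)
        = poly (poly ([:monom 1 m:] * Q + [:monom 1 n:] * R) [:e:]) (cis k)" .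
  qed
qed

lemma bitrig_mult:
  assumes "bitrig \<phi>" "bitrig \<psi>"
  shows "bitrig (\<lambda>e k. \<phi> e k * \<psi> e k)"
proof -
  obtain n Q m R where Q: "\<And>e k. cis k ^ n * \<phi> e k = poly (poly Q [:e:]) (cis k)"
    and R: "\<And>e k. cis k ^ m * \<psi> e k = poly (poly R [:e:]) (cis k)"
    using assms unfolding bitrig_def by metis
  show ?thesis
  proof (rule bitrigI)
    show "cis k ^ (n + m) * (\<phi> e k * \<psi> e k) = poly (poly (Q * R) [:e:]) (cis k)" for e k
      using arg_cong2[OF Q R, of "(*)" k e k e] by (simp add: power_add mult_ac)
  qed
qed

lemma bitrig_sum: "(\<And>i. i \<in> I \<Longrightarrow> bitrig (\<phi> i)) \<Longrightarrow> bitrig (\<lambda>e k. \<Sum>i\<in>I. \<phi> i e k)"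
  by (induction I rule: infinite_finite_induct) (simp_all add: bitrig_const bitrig_add)

lemma bitrig_prod: "(\<And>i. i \<in> I \<Longrightarrow> bitrig (\<phi> i)) \<Longrightarrow> bitrig (\<lambda>e k. \<Prod>i\<in>I. \<phi> i e k)"
  by (induction I rule: infinite_finite_induct) (simp_all add: bitrig_const bitrig_mult)

lemma bitrig_diff: "bitrig \<phi> \<Longrightarrow> bitrig \<psi> \<Longrightarrow> bitrig (\<lambda>e k. \<phi> e k - \<psi> e k)"
  using bitrig_add[OF _ bitrig_mult[OF bitrig_const[of "-1"]], of \<phi> \<psi>] by simp

lemma bitrig_det:
  assumes "\<And>i j. bitrig (\<lambda>e k. M e k $ i $ j)"
  shows "bitrig (\<lambda>e k. det (M e k))"
  unfolding det_def by (intro bitrig_sum bitrig_mult bitrig_const bitrig_prod assms)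

section \<open>Lowest order in \<epsilon>\<close>

lemma poly_poly_const: "poly (poly Q [:e:]) z = poly (map_poly (\<lambda>c. poly c z) Q) e"
  for Q :: "'a::comm_ring_1 poly poly"
  by (induction Q) (simp_all add: map_poly_pCons)

text \<open>For \<open>s > 0\<close> a finite limit forces \<open>h\<close> to vanish at
  \<open>0\<close>, so one power of \<open>e\<close> cancels; for \<open>s = 0\<close> this is
  continuity.\<close>

lemma poly_leading_limit:
  fixes h :: "complex poly"
  assumes "((\<lambda>e. poly h (complex_of_real e) / complex_of_real e ^ s) \<longlongrightarrow> L) (at_right 0)"
  shows "coeff h s = L"
  using assms
proof (induction s arbitrary: h)
  case 0
  have "((\<lambda>e. poly h (complex_of_real e)) \<longlongrightarrow> poly h (complex_of_real 0)) (at_right 0)"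
    by (intro tendsto_intros)
  then show ?case
    using tendsto_unique[OF _ _ 0] by (simp add: poly_0_coeff_0)
next
  case (Suc s)
  have lim0: "((\<lambda>e. poly h (complex_of_real e)) \<longlongrightarrow> poly h (complex_of_real 0)) (at_right 0)"
    by (intro tendsto_intros)
  have "((\<lambda>e. complex_of_real e ^ Suc s) \<longlongrightarrow> complex_of_real 0 ^ Suc s) (at_right 0)"
    by (intro tendsto_intros)
  from tendsto_mult[OF this Suc.prems]
  have "((\<lambda>e. complex_of_real e ^ Suc s * (poly h (complex_of_real e) / complex_of_real e ^ Suc s)) \<longlongrightarrow> 0) (at_right 0)"
    by simp
  then have "((\<lambda>e. poly h (complex_of_real e)) \<longlongrightarrow> 0) (at_right 0)"
    by (rule Lim_transform_eventually) (auto simp: eventually_at_right_field intro!: exI[of _ 1])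
  then have "poly h 0 = 0"
    using tendsto_unique[OF _ lim0] by simp
  obtain c h' where h: "h = pCons c h'"
    by (rule pCons_cases)
  with \<open>poly h 0 = 0\<close> have h': "h = pCons 0 h'"
    by simp
  have "((\<lambda>e. poly h' (complex_of_real e) / complex_of_real e ^ s) \<longlongrightarrow> L) (at_right 0)"
    using Suc.prems
    by (rule Lim_transform_eventually) (auto simp: h' eventually_at_right_field intro!: exI[of _ 1])
  from Suc.IH[OF this] show ?case
    by (simp add: h')
qed

lemma poly_lowest_coeff_tendsto:
  fixes h :: "complex poly"
  assumes "\<And>i. i < s \<Longrightarrow> coeff h i = 0"
  shows "((\<lambda>e. poly h (complex_of_real e) / complex_of_real e ^ s) \<longlongrightarrow> coeff h s) (at_right 0)"
  using assms
proof (induction s arbitrary: h)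
  case 0
  have "((\<lambda>e. poly h (complex_of_real e)) \<longlongrightarrow> poly h (complex_of_real 0)) (at_right 0)"
    by (intro tendsto_intros)
  then show ?case
    by (simp add: poly_0_coeff_0)
next
  case (Suc s)
  obtain c h' where h: "h = pCons c h'"
    by (rule pCons_cases)
  have c: "c = 0"
    using Suc.prems[of 0] by (simp add: h)
  have "coeff h' i = 0" if "i < s" for i
    using Suc.prems[of "Suc i"] that by (simp add: h)
  from Suc.IH[OF this]
  have "((\<lambda>e. poly h' (complex_of_real e) / complex_of_real e ^ s) \<longlongrightarrow> coeff h' s) (at_right 0)" .
  then have "((\<lambda>e. poly h (complex_of_real e) / complex_of_real e ^ Suc s) \<longlongrightarrow> coeff h' s) (at_right 0)"
    by (rule Lim_transform_eventually) (auto simp: h c eventually_at_right_field intro!: exI[of _ 1])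
  then show ?case
    by (simp add: h)
qed

text \<open>The common denominator \<open>c\<close> is the lowest non-vanishing coefficient of \<open>\<delta>\<close> with respect to
  \<open>\<epsilon>\<close>.\<close>

lemma bitrig_limit_rational:
  assumes \<delta>: "bitrig \<delta>" and nz: "\<And>e k. e > 0 \<Longrightarrow> \<delta> (complex_of_real e) k \<noteq> 0"
  shows "\<exists>c. c \<noteq> 0 \<and> (\<forall>\<nu> g. bitrig \<nu> \<longrightarrow>
      (\<forall>k. ((\<lambda>e. \<nu> (complex_of_real e) k / \<delta> (complex_of_real e) k) \<longlongrightarrow> g k) (at_right 0)) \<longrightarrow>
      (\<exists>n p. \<forall>k. poly c (cis k) * cis k ^ n * g k = poly p (cis k)))"
proof -
  obtain n Q where Q: "\<And>e k. cis k ^ n * \<delta> e k = poly (poly Q [:e:]) (cis k)"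
    using \<delta> unfolding bitrig_def by blast
  have "Q \<noteq> 0"
    using Q[of 0 1] nz[of 1 0] by auto
  \<comment> \<open>The order in \<epsilon> of the bivariate polynomial, hence independent of
    \<open>k\<close>. At momenta where this coefficient vanishes the identity to be shown still
    holds, with left-hand side \<open>0\<close>.\<close>
  define s where "s = (LEAST s. coeff Q s \<noteq> 0)"
  have "\<exists>s. coeff Q s \<noteq> 0"
    using \<open>Q \<noteq> 0\<close> by (simp add: poly_eq_iff)
  then have s: "coeff Q s \<noteq> 0" "\<And>i. i < s \<Longrightarrow> coeff Q i = 0"
    unfolding s_def by (rule LeastI_ex) (use not_less_Least in blast)
  define h where "h P k = map_poly (\<lambda>c. poly c (cis k)) P" for P :: "complex poly poly" and k
  have h: "poly (poly P [:e:]) (cis k) = poly (h P k) e" "coeff (h P k) i = poly (coeff P i) (cis k)" for P e k i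
    by (simp_all add: h_def poly_poly_const coeff_map_poly)
  have "\<exists>n p. \<forall>k. poly (coeff Q s) (cis k) * cis k ^ n * g k = poly p (cis k)"
    if \<nu>: "bitrig \<nu>" and g: "\<And>k. ((\<lambda>e. \<nu> (complex_of_real e) k / \<delta> (complex_of_real e) k) \<longlongrightarrow> g k) (at_right 0)" for \<nu> g
  proof -
    obtain m R where R: "\<And>e k. cis k ^ m * \<nu> e k = poly (poly R [:e:]) (cis k)"
      using \<nu> unfolding bitrig_def by blast
    have "poly (coeff Q s) (cis k) * cis k ^ m * g k = poly (monom 1 n * coeff R s) (cis k)" for k
    proof -
      have "((\<lambda>e. poly (h Q k) (complex_of_real e) / complex_of_real e ^ s) \<longlongrightarrow> poly (coeff Q s) (cis k)) (at_right 0)"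
        using poly_lowest_coeff_tendsto[of s "h Q k"] by (simp add: h s)
      from tendsto_mult[OF tendsto_mult[OF this tendsto_const] g]
      have "((\<lambda>e. poly (h Q k) (complex_of_real e) / complex_of_real e ^ s * cis k ^ m
          * (\<nu> (complex_of_real e) k / \<delta> (complex_of_real e) k)) \<longlongrightarrow> poly (coeff Q s) (cis k) * cis k ^ m * g k) (at_right 0)" .
      \<comment> \<open>For \<open>e > 0\<close> the nonzero \<open>\<delta>\<close> cancels and
        \<open>cis k ^ m * \<nu>\<close> becomes the polynomial from \<open>R\<close>, leaving a
        polynomial in \<open>e\<close> over \<open>e ^ s\<close>.\<close>
      moreover have "\<forall>\<^sub>F e in at_right 0. poly (h Q k) (complex_of_real e) / complex_of_real e ^ s * cis k ^ m
          * (\<nu> (complex_of_real e) k / \<delta> (complex_of_real e) k)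
          = poly (smult (cis k ^ n) (h R k)) (complex_of_real e) / complex_of_real e ^ s"
        by (auto simp: eventually_at_right_field h(1)[symmetric] Q[symmetric] R[symmetric] nz intro!: exI[of _ 1])
      ultimately have "coeff (smult (cis k ^ n) (h R k)) s = poly (coeff Q s) (cis k) * cis k ^ m * g k"
        by (intro poly_leading_limit) (rule Lim_transform_eventually)
      then show ?thesis
        by (simp add: h poly_monom)
    qed
    then show ?thesis
      by blast
  qed
  with s(1) show ?thesis
    by blast
qed

section \<open>The one-period channel\<close>

lemma sum_sum_type: "(\<Sum>i\<in>UNIV. f i) = (\<Sum>a\<in>UNIV. f (Inl a)) + (\<Sum>b\<in>UNIV. f (Inr b))"
  for f :: "'a::finite + 'b::finite \<Rightarrow> 'c::comm_monoid_add"
  by (simp add: UNIV_Plus_UNIV[symmetric] sum.Plus del: UNIV_Plus_UNIV)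

definition join_vec :: "real^'a \<Rightarrow> real^'b \<Rightarrow> real^('a + 'b)" where
  "join_vec x p = (\<chi> i. case i of Inl a \<Rightarrow> x $ a | Inr b \<Rightarrow> p $ b)"

lemma inner_join_vec: "join_vec x p \<bullet> join_vec y q = x \<bullet> y + p \<bullet> q"
  by (simp add: inner_vec_def join_vec_def sum_sum_type)

lemma block_matrix_mult_join_vec:
  "block_matrix A B C D *v join_vec x p = join_vec (A *v x + B *v p) (C *v x + D *v p)"
  by (simp add: vec_eq_iff matrix_vector_mult_def block_matrix_def join_vec_def sum_sum_type
      split: sum.split)

text \<open>The CPTP condition, tested on the vectors \<open>(x, - B\<^sup>T y)\<close> and \<open>(y, B\<^sup>T x)\<close>.\<close>

lemma gaussian_channel_form:
  fixes A B :: "real^'m^'m"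
  assumes "gaussian_channel A B"
  shows "2 * (x \<bullet> (A *v y)) + (norm (transpose B *v x))\<^sup>2 + (norm (transpose B *v y))\<^sup>2
    \<le> (norm x)\<^sup>2 + (norm y)\<^sup>2"
proof -
  define L where "L = block_matrix A B (- transpose B) 0"
  have "norm (L *v v) \<le> norm v" for v
  proof -
    have "0 \<le> v \<bullet> ((mat 1 - transpose L ** L) *v v)"
      using assms by (simp add: gaussian_channel_def Let_def loewner_le_def L_def)
    also have "\<dots> = v \<bullet> v - v \<bullet> (transpose L *v (L *v v))"
      by (simp add: matrix_vector_mult_diff_rdistrib inner_diff_right matrix_vector_mul_assoc)
    also have "v \<bullet> (transpose L *v (L *v v)) = (L *v v) \<bullet> (L *v v)"
      by (metis dot_lmul_matrix transpose_matrix_vector inner_commute)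
    finally show ?thesis
      by (simp add: norm_le)
  qed
  note L = this
  let ?p = "- (transpose B *v y)" and ?q = "transpose B *v x"
  let ?X = "join_vec x ?p" and ?Y = "join_vec y ?q"
  have tr: "u \<bullet> (B *v w) = (transpose B *v u) \<bullet> w" for u w
    by (metis dot_lmul_matrix transpose_matrix_vector)
  have "L *v ?Y = join_vec (A *v y + B *v ?q) (- (transpose B *v y))"
    unfolding L_def block_matrix_mult_join_vec
    using matrix_vector_mult_diff_rdistrib[of 0 "transpose B" y] by simp
  then have "?X \<bullet> (L *v ?Y) = x \<bullet> (A *v y) + (norm ?q)\<^sup>2 + (norm (transpose B *v y))\<^sup>2"
    by (simp add: inner_join_vec inner_add_right tr power2_norm_eq_inner)
  moreover have "?X \<bullet> (L *v ?Y) \<le> norm ?X * norm ?Y"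
    using norm_cauchy_schwarz[of ?X "L *v ?Y"] mult_left_mono[OF L[of ?Y] norm_ge_zero[of ?X]] by linarith
  \<comment> \<open>Doubling the form gives the \<open>B\<close> terms twice, the squared norms
    contain them once, so one copy survives.\<close>
  moreover have "2 * (norm ?X * norm ?Y) \<le> (norm ?X)\<^sup>2 + (norm ?Y)\<^sup>2"
    using sum_squares_bound[of "norm ?X" "norm ?Y"] by (simp add: mult.assoc)
  moreover have "(norm ?X)\<^sup>2 = (norm x)\<^sup>2 + (norm (transpose B *v y))\<^sup>2"
    "(norm ?Y)\<^sup>2 = (norm y)\<^sup>2 + (norm ?q)\<^sup>2"
    by (simp_all add: power2_norm_eq_inner inner_join_vec)
  ultimately show ?thesis
    by linarith
qed

lemma cmatrix_nth [simp]: "cmatrix M $ i $ j = complex_of_real (M $ i $ j)"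
  by (simp add: cmatrix_def map_matrix_def)

lemma ctranspose_cmatrix: "ctranspose (cmatrix M) = cmatrix (transpose M)"
  by (simp add: vec_eq_iff transpose_def)

text \<open>For \<open>v = x + \<i> y\<close> the form of \<open>\<i> A\<close> is
  \<open>- 2 (x \<bullet> A y)\<close>, as \<open>A\<close> is skew. The absolute value comes from
  replacing \<open>x\<close> by \<open>- x\<close>.\<close>

lemma momentum_channel_cmatrix:
  fixes A B :: "real^'m^'m"
  assumes ch: "gaussian_channel A B"
  shows "momentum_channel (cmatrix A) (cmatrix B)"
proof
  have A: "transpose A = - A"
    using ch by (simp add: gaussian_channel_def)
  then show "ctranspose (cmatrix A) = - cmatrix A"
    unfolding ctranspose_cmatrix by (simp add: vec_eq_iff)
  fix v :: "complex^'m"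
  define x y where "x = (\<chi> i. Re (v $ i))" and "y = (\<chi> i. Im (v $ i))"
  have re: "(\<chi> i. Re ((cmatrix M *v v) $ i)) = M *v x" and im: "(\<chi> i. Im ((cmatrix M *v v) $ i)) = M *v y"
    for M :: "real^'m^'m"
    by (simp_all add: vec_eq_iff matrix_vector_mult_def x_def y_def)
  have nrm: "(norm w)\<^sup>2 = (norm (\<chi> i. Re (w $ i)))\<^sup>2 + (norm (\<chi> i. Im (w $ i)))\<^sup>2" for w :: "complex^'m"
    unfolding power2_norm_eq_inner by (simp add: inner_vec_def inner_complex_def sum.distrib)
  have skew: "y \<bullet> (A *v x) = - (x \<bullet> (A *v y))"
  proof -
    have "y \<bullet> (A *v x) = (transpose A *v y) \<bullet> x"
      by (metis dot_lmul_matrix transpose_matrix_vector)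
    also have "\<dots> = - (x \<bullet> (A *v y))"
      using matrix_vector_mult_diff_rdistrib[of 0 A y] by (simp add: A inner_commute)
    finally show ?thesis .
  qed
  have "v \<bullet> (\<i> *s w) = y \<bullet> (\<chi> i. Re (w $ i)) - x \<bullet> (\<chi> i. Im (w $ i))" for w
    by (simp add: inner_vec_def inner_complex_def x_def y_def sum_subtractf[symmetric] algebra_simps)
  then have "v \<bullet> ((\<i> *c cmatrix A) *v v) = - 2 * (x \<bullet> (A *v y))"
    by (simp add: re im skew)
  moreover have "(norm (ctranspose (cmatrix B) *v v))\<^sup>2
      = (norm (transpose B *v x))\<^sup>2 + (norm (transpose B *v y))\<^sup>2"
    unfolding ctranspose_cmatrix by (subst nrm) (simp add: re im)
  moreover have "(norm v)\<^sup>2 = (norm x)\<^sup>2 + (norm y)\<^sup>2"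
    by (subst nrm) (simp add: x_def y_def)
  moreover have "M *v (- x) = - (M *v x)" for M :: "real^'m^'m"
    by (simp add: matrix_vector_mult_def vec_eq_iff sum_negf)
  ultimately show "\<bar>v \<bullet> ((\<i> *c cmatrix A) *v v)\<bar> + (norm (ctranspose (cmatrix B) *v v))\<^sup>2 \<le> (norm v)\<^sup>2"
    using gaussian_channel_form[OF ch, of x y] gaussian_channel_form[OF ch, of "- x" y]
    by (simp add: abs_if)
qed

lemma momentum_channel_conjugate:
  fixes A B U :: "complex^'m^'m"
  assumes ch: "momentum_channel A B" and U: "U ** ctranspose U = mat 1"
  shows "momentum_channel (U ** A ** ctranspose U) (U ** B ** ctranspose U)"
proof
  interpret momentum_channel A B by (rule ch)
  show "ctranspose (U ** A ** ctranspose U) = - (U ** A ** ctranspose U)"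
    by (simp add: ctranspose_mult antihermitian cmat_minus_mult matrix_mul_assoc)
  fix v
  let ?w = "ctranspose U *v v"
  have "ctranspose U ** U = mat 1"
    using U matrix_left_right_inverse by blast
  then have iso: "norm (U *v w) = norm w" for w
    unfolding norm_eq_sqrt_inner
    by (metis ctranspose_ctranspose inner_ctranspose matrix_vector_mul_assoc matrix_vector_mul_lid)
  have "norm ?w = norm v"
    unfolding norm_eq_sqrt_inner
    by (metis U ctranspose_ctranspose inner_ctranspose matrix_vector_mul_assoc matrix_vector_mul_lid)
  moreover have "v \<bullet> ((\<i> *c (U ** A ** ctranspose U)) *v v) = ?w \<bullet> ((\<i> *c A) *v ?w)"
    using inner_congruence[of v U "\<i> *c A"] by (simp add: cscale_mult)
  moreover have "norm (ctranspose (U ** B ** ctranspose U) *v v) = norm (ctranspose B *v ?w)"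
    by (simp add: ctranspose_mult matrix_vector_mul_assoc[symmetric] iso)
  ultimately show "\<bar>v \<bullet> ((\<i> *c (U ** A ** ctranspose U)) *v v)\<bar>
      + (norm (ctranspose (U ** B ** ctranspose U) *v v))\<^sup>2 \<le> (norm v)\<^sup>2"
    using positive[of ?w] by simp
qed

text \<open>The bound for the second channel at \<open>v\<close> leaves the squared norm of
  \<open>B2\<^sup>\<dagger> v\<close>, which is exactly what bounds the first channel at
  \<open>B2\<^sup>\<dagger> v\<close>.\<close>

lemma momentum_channel_compose:
  assumes "momentum_channel A1 B1" "momentum_channel A2 B2"
  shows "momentum_channel (A2 + B2 ** A1 ** ctranspose B2) (B2 ** B1)"
proof
  interpret c1: momentum_channel A1 B1 by (rule assms)
  interpret c2: momentum_channel A2 B2 by (rule assms)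
  show "ctranspose (A2 + B2 ** A1 ** ctranspose B2) = - (A2 + B2 ** A1 ** ctranspose B2)"
    by (simp add: ctranspose_add ctranspose_mult c1.antihermitian c2.antihermitian cmat_minus_mult
        matrix_mul_assoc)
  fix v
  let ?w = "ctranspose B2 *v v"
  have "\<i> *c (A2 + B2 ** A1 ** ctranspose B2) = \<i> *c A2 + B2 ** (\<i> *c A1) ** ctranspose B2"
    by (simp add: cscale_mult vec_eq_iff distrib_left)
  then have "v \<bullet> ((\<i> *c (A2 + B2 ** A1 ** ctranspose B2)) *v v)
      = v \<bullet> ((\<i> *c A2) *v v) + ?w \<bullet> ((\<i> *c A1) *v ?w)"
    by (metis inner_add_right inner_congruence matrix_vector_mult_add_rdistrib)
  moreover have "ctranspose (B2 ** B1) *v v = ctranspose B1 *v ?w"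
    by (simp add: ctranspose_mult matrix_vector_mul_assoc)
  ultimately show "\<bar>v \<bullet> ((\<i> *c (A2 + B2 ** A1 ** ctranspose B2)) *v v)\<bar>
      + (norm (ctranspose (B2 ** B1) *v v))\<^sup>2 \<le> (norm v)\<^sup>2"
    using c1.positive[of ?w] c2.positive[of v] by simp
qed

section \<open>Momentum dependence of the one-period data\<close>

lemma exp_minus_i_eq_cis: "exp (- (\<i> * complex_of_real k)) = cis (- k)"
  by (simp add: cis_conv_exp)

lemma U_mat_nth:
  "U_mat k $ Inl a $ Inl b = 0" "U_mat k $ Inl a $ Inr b' = (if a = b' then 1 else 0)"
  "U_mat k $ Inr a' $ Inl b = (if a' = b then cis (- k) else 0)" "U_mat k $ Inr a' $ Inr b' = 0"
  unfolding U_mat_def block_matrix_def exp_minus_i_eq_cis by (simp_all add: mat_def)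

lemma U_mat_unitary:
  "(U_mat k :: complex^('n::finite + 'n)^('n + 'n)) ** ctranspose (U_mat k) = mat 1"
proof -
  have "((U_mat k :: complex^('n + 'n)^('n + 'n)) ** ctranspose (U_mat k)) $ i $ j = mat 1 $ i $ j" for i j
    by (cases i; cases j)
      (simp_all add: matrix_matrix_mult_def sum_sum_type U_mat_nth mat_def cis_cnj cis_mult
        if_distrib[of cnj] if_distrib[of "\<lambda>z. z * _"] cong: if_cong)
  then show ?thesis
    by (simp add: vec_eq_iff)
qed

lemma U_mat_periodic: "U_mat (k + 2 * pi) = U_mat k"
proof -
  have "cis (- (k + 2 * pi)) = cis (- k)"
    unfolding cis_cnj[symmetric] by (simp add: complex_eq_iff)
  then show ?thesis
    unfolding U_mat_def exp_minus_i_eq_cis by (simp only:)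
qed

lemma momentum_channel_period:
  assumes o: "gaussian_channel Ao Bo" and e: "gaussian_channel Ae Be"
  shows "momentum_channel (A_mat Ao Ae Be k) (B_mat Bo Be k)"
proof -
  let ?U = "U_mat k"
  let ?B = "?U ** cmatrix Be ** ctranspose ?U"
  have "A_mat Ao Ae Be k = ?U ** cmatrix Ae ** ctranspose ?U + ?B ** cmatrix Ao ** ctranspose ?B"
    by (simp add: A_mat_def ctranspose_mult ctranspose_cmatrix matrix_mul_assoc)
  moreover have "B_mat Bo Be k = ?B ** cmatrix Bo"
    by (simp add: B_mat_def)
  ultimately show ?thesis
    using momentum_channel_compose[OF momentum_channel_cmatrix[OF o]
        momentum_channel_conjugate[OF momentum_channel_cmatrix[OF e] U_mat_unitary[of k]]]
    by simp
qed

text \<open>Conjugates are carried along so that the class is closed under adjoints.\<close>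

definition trig_matrix :: "(real \<Rightarrow> complex^'c^'r) \<Rightarrow> bool" where
  "trig_matrix M \<longleftrightarrow> (\<forall>i j. bitrig (\<lambda>e k. M k $ i $ j) \<and> bitrig (\<lambda>e k. cnj (M k $ i $ j)))"

lemma trig_matrix_const: "trig_matrix (\<lambda>k. M)"
  by (simp add: trig_matrix_def bitrig_const)

lemma trig_matrix_add: "trig_matrix M \<Longrightarrow> trig_matrix N \<Longrightarrow> trig_matrix (\<lambda>k. M k + N k)"
  by (simp add: trig_matrix_def bitrig_add)

lemma trig_matrix_diff: "trig_matrix M \<Longrightarrow> trig_matrix N \<Longrightarrow> trig_matrix (\<lambda>k. M k - N k)"
  by (simp add: trig_matrix_def bitrig_diff)

lemma trig_matrix_cscale: "trig_matrix M \<Longrightarrow> trig_matrix (\<lambda>k. c *c M k)"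
  by (simp add: trig_matrix_def bitrig_mult bitrig_const)

lemma trig_matrix_ctranspose: "trig_matrix M \<Longrightarrow> trig_matrix (\<lambda>k. ctranspose (M k))"
  by (simp add: trig_matrix_def)

lemma trig_matrix_mult: "trig_matrix M \<Longrightarrow> trig_matrix N \<Longrightarrow> trig_matrix (\<lambda>k. M k ** N k)"
  by (simp add: trig_matrix_def matrix_matrix_mult_def bitrig_sum bitrig_mult)

lemma bitrig_if: "bitrig \<phi> \<Longrightarrow> bitrig \<psi> \<Longrightarrow> bitrig (\<lambda>e k. if c then \<phi> e k else \<psi> e k)"
  by (cases c) simp_all

lemma trig_matrix_U: "trig_matrix (U_mat :: real \<Rightarrow> complex^('n::finite + 'n)^('n + 'n))"
  unfolding trig_matrix_def
proof (intro allI)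
  fix i j :: "'n + 'n"
  show "bitrig (\<lambda>e k. U_mat k $ i $ j) \<and> bitrig (\<lambda>e k. cnj (U_mat k $ i $ j))"
    by (cases i; cases j)
      (simp_all add: U_mat_nth if_distrib[of cnj] cis_cnj bitrig_if bitrig_const bitrig_cis bitrig_cis_minus)
qed

lemma trig_matrix_B: "trig_matrix (B_mat Bo Be)"
  unfolding B_mat_def[abs_def]
  by (intro trig_matrix_mult trig_matrix_ctranspose trig_matrix_U trig_matrix_const)

lemma trig_matrix_A: "trig_matrix (A_mat Ao Ae Be)"
  unfolding A_mat_def[abs_def]
  by (intro trig_matrix_add trig_matrix_mult trig_matrix_ctranspose trig_matrix_U trig_matrix_const)

text \<open>\<open>stein_matrix\<close> with a complex shift, as \<open>bitrig\<close> treats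
  \<epsilon> as a polynomial variable.\<close>

definition stein_family :: "(real \<Rightarrow> complex^'m^'m) \<Rightarrow> complex \<Rightarrow> real \<Rightarrow> complex^('m \<times> 'm)^('m \<times> 'm)" where
  "stein_family B e k = (\<chi> p q. (if p = q then 1 + e else 0)
     - B k $ fst p $ fst q * cnj (B k $ snd p $ snd q))"

lemma stein_family_of_real: "stein_family B (complex_of_real e) k = stein_matrix (B k) e"
  by (simp add: stein_family_def stein_matrix_def)

lemma bitrig_stein_family: "trig_matrix B \<Longrightarrow> bitrig (\<lambda>e k. stein_family B e k $ p $ q)"
proof -
  assume "trig_matrix B"
  then have "bitrig (\<lambda>e k. B k $ fst p $ fst q * cnj (B k $ snd p $ snd q))"
    by (simp add: trig_matrix_def bitrig_mult)
  moreover have "bitrig (\<lambda>e k. if p = q then 1 + e else 0)"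
    by (intro bitrig_if bitrig_const bitrig_eps bitrig_add)
  ultimately show ?thesis
    unfolding stein_family_def by (simp add: bitrig_diff)
qed

section \<open>Limits of multisets\<close>

lemma mset_tendsto_mono: "mset_tendsto S M F \<Longrightarrow> G \<le> F \<Longrightarrow> mset_tendsto S M G"
  unfolding mset_tendsto_def by (meson filter_leD)

lemma mset_tendsto_cong:
  assumes "mset_tendsto S M F" "\<forall>\<^sub>F k in F. S k = T k"
  shows "mset_tendsto T M F"
  unfolding mset_tendsto_def
proof (intro allI impI)
  fix N
  assume "\<forall>x\<in>#M. open (N x) \<and> x \<in> N x"
  then have "\<forall>\<^sub>F k in F. rel_mset (\<lambda>x y. y \<in> N x) M (S k)"
    using assms(1) by (simp add: mset_tendsto_def)
  with assms(2) show "\<forall>\<^sub>F k in F. rel_mset (\<lambda>x y. y \<in> N x) M (T k)"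
    by eventually_elim simp
qed

lemma mset_tendsto_size: "mset_tendsto S M F \<Longrightarrow> \<forall>\<^sub>F k in F. size (S k) = size M"
proof -
  assume "mset_tendsto S M F"
  then have "\<forall>\<^sub>F k in F. rel_mset (\<lambda>x y. y \<in> UNIV) M (S k)"
    unfolding mset_tendsto_def by (elim allE[of _ "\<lambda>_. UNIV"]) simp
  then show ?thesis
    by eventually_elim (simp add: rel_mset_size)
qed

lemma hausdorff_finite:
  fixes X :: "'a::t2_space set"
  assumes "finite X"
  obtains N where "\<And>x. x \<in> X \<Longrightarrow> open (N x) \<and> x \<in> N x"
    "\<And>x y. x \<in> X \<Longrightarrow> y \<in> X \<Longrightarrow> x \<noteq> y \<Longrightarrow> N x \<inter> N y = {}"
proof -
  have "\<exists>U V. open U \<and> open V \<and> x \<in> U \<and> y \<in> V \<and> U \<inter> V = {}" if "x \<noteq> y" for x y :: 'a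
    using hausdorff[OF that] .
  then obtain U V where UV: "\<And>x y :: 'a. x \<noteq> y \<Longrightarrow>
      open (U x y) \<and> open (V x y) \<and> x \<in> U x y \<and> y \<in> V x y \<and> U x y \<inter> V x y = {}"
    by metis
  define N where "N x = (\<Inter>y\<in>X - {x}. U x y \<inter> V y x)" for x
  show ?thesis
  proof (rule that)
    show "open (N x) \<and> x \<in> N x" if "x \<in> X" for x
    proof
      show "open (N x)"
        unfolding N_def using assms UV by (intro open_INT ballI open_Int) auto
      show "x \<in> N x"
        unfolding N_def
      proof
        fix y
        assume "y \<in> X - {x}"
        then show "x \<in> U x y \<inter> V y x"
          using UV[of x y] UV[of y x] by auto
      qed
    qed
    show "N x \<inter> N y = {}" if "x \<in> X" "y \<in> X" "x \<noteq> y" for x y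
      using that UV[of x y] unfolding N_def by blast
  qed
qed

text \<open>By disjointness a point of \<open>S\<close> lies in \<open>N x\<close> exactly if its
  partner in \<open>M\<close> is \<open>x\<close>. \<open>X\<close> may be larger than
  \<open>M\<close>, so that two limits can be compared through the same neighbourhoods.\<close>

lemma rel_mset_count:
  assumes rel: "rel_mset (\<lambda>x y. y \<in> N x) M S" and M: "set_mset M \<subseteq> X" and x: "x \<in> X"
    and N: "\<And>x. x \<in> X \<Longrightarrow> x \<in> N x" "\<And>x y. x \<in> X \<Longrightarrow> y \<in> X \<Longrightarrow> x \<noteq> y \<Longrightarrow> N x \<inter> N y = {}"
  shows "count M x = size (filter_mset (\<lambda>y. y \<in> N x) S)"
proof -
  obtain xs ys where xs: "mset xs = M" and ys: "mset ys = S" and rel: "list_all2 (\<lambda>x y. y \<in> N x) xs ys"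
    using rel by (auto simp: rel_mset_def)
  have "set xs \<subseteq> X"
    using M xs by auto
  with rel have "count (mset xs) x = size (filter_mset (\<lambda>y. y \<in> N x) (mset ys))"
  proof (induction rule: list_all2_induct)
    case (Cons a as b bs)
    then have "b \<in> N x \<longleftrightarrow> a = x"
      using N(2)[of a x] x by auto
    then show ?case
      using Cons by simp
  qed simp
  then show ?thesis
    by (simp add: xs ys)
qed

lemma mset_tendsto_unique:
  fixes M M' :: "'a::t2_space multiset"
  assumes S: "mset_tendsto S M F" "mset_tendsto S M' F" and F: "F \<noteq> bot"
  shows "M = M'"
proof -
  let ?X = "set_mset M \<union> set_mset M'"
  obtain N where N: "\<And>x. x \<in> ?X \<Longrightarrow> open (N x) \<and> x \<in> N x"
    "\<And>x y. x \<in> ?X \<Longrightarrow> y \<in> ?X \<Longrightarrow> x \<noteq> y \<Longrightarrow> N x \<inter> N y = {}"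
    using hausdorff_finite[of ?X] by (metis finite_Un finite_set_mset)
  have "\<forall>\<^sub>F k in F. rel_mset (\<lambda>x y. y \<in> N x) M (S k) \<and> rel_mset (\<lambda>x y. y \<in> N x) M' (S k)"
    using S N(1) by (intro eventually_conj) (simp_all add: mset_tendsto_def)
  then obtain k where k: "rel_mset (\<lambda>x y. y \<in> N x) M (S k)" "rel_mset (\<lambda>x y. y \<in> N x) M' (S k)"
    using eventually_happens'[OF F] by blast
  have "count M x = count M' x" for x
  proof (cases "x \<in> ?X")
    case True
    have "count M x = size (filter_mset (\<lambda>y. y \<in> N x) (S k))"
      using N by (intro rel_mset_count[OF k(1) _ True]) auto
    moreover have "count M' x = size (filter_mset (\<lambda>y. y \<in> N x) (S k))"
      using N by (intro rel_mset_count[OF k(2) _ True]) auto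
    ultimately show ?thesis
      by simp
  next
    case False
    then show ?thesis
      by (metis Un_iff count_eq_zero_iff)
  qed
  then show ?thesis
    by (rule multiset_eqI)
qed

lemma mset_tendsto_branches:
  fixes \<beta> :: "'i \<Rightarrow> 'k \<Rightarrow> 'a::topological_space"
  assumes "finite I" "\<And>i. i \<in> I \<Longrightarrow> (\<beta> i \<longlongrightarrow> l i) F"
  shows "mset_tendsto (\<lambda>k. image_mset (\<lambda>i. \<beta> i k) (mset_set I)) (image_mset l (mset_set I)) F"
  unfolding mset_tendsto_def
proof (intro allI impI)
  fix N
  assume N: "\<forall>x\<in>#image_mset l (mset_set I). open (N x) \<and> x \<in> N x"
  have "\<forall>\<^sub>F k in F. \<beta> i k \<in> N (l i)" if "i \<in> I" for i
    using N assms that by (intro topological_tendstoD) auto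
  then have "\<forall>\<^sub>F k in F. \<forall>i\<in>I. \<beta> i k \<in> N (l i)"
    using assms(1) by (simp add: eventually_ball_finite)
  then show "\<forall>\<^sub>F k in F. rel_mset (\<lambda>x y. y \<in> N x) (image_mset l (mset_set I))
      (image_mset (\<lambda>i. \<beta> i k) (mset_set I))"
  proof eventually_elim
    case (elim k)
    show ?case
      by (intro multiset.rel_map(1)[THEN iffD2] multiset.rel_map(2)[THEN iffD2]
          multiset.rel_refl_strong) (use assms(1) elim in simp)
  qed
qed

section \<open>Crossings of a continuous branch\<close>

text \<open>The crossing is the infimum of the set where \<open>f\<close> is at least
  \<open>c\<close>, attained because that set is closed.\<close>

lemma first_up_crossing:
  fixes f :: "real \<Rightarrow> ereal"
  assumes f: "continuous_on {s..t} f" and st: "s \<le> t" and fs: "f s < ereal c" and ft: "ereal c \<le> f t"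
  shows "up_crossings f c s t \<noteq> {}"
proof -
  define C where "C = {s..t} \<inter> f -` {ereal c..}"
  have "closed C"
    unfolding C_def using f by (rule continuous_closed_preimage) auto
  moreover have "t \<in> C"
    using st ft by (simp add: C_def)
  moreover have bdd: "bdd_below C"
    by (auto simp: C_def)
  ultimately have u: "Inf C \<in> C"
    using closed_contains_Inf by blast
  then have "s \<noteq> Inf C"
    using fs by (auto simp: C_def)
  then have su: "s < Inf C" "Inf C \<le> t"
    using u by (auto simp: C_def)
  have "f x < ereal c" if "s < x" "x < Inf C" for x
    using cInf_lower[OF _ bdd, of x] that su by (force simp: C_def)
  then have "\<forall>\<^sub>F x in at_left (Inf C). f x < ereal c"
    using su by (auto simp: eventually_at_left_field intro!: exI[of _ s])
  then show ?thesis
    using u su by (auto simp: up_crossings_def C_def)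
qed

lemma last_down_crossing:
  fixes f :: "real \<Rightarrow> ereal"
  assumes f: "continuous_on {s..t} f" and st: "s \<le> t" and fs: "ereal c \<le> f s" and ft: "f t < ereal c"
  shows "down_crossings f c s t \<noteq> {}"
proof -
  define C where "C = {s..t} \<inter> f -` {ereal c..}"
  have "closed C"
    unfolding C_def using f by (rule continuous_closed_preimage) auto
  moreover have "s \<in> C"
    using st fs by (simp add: C_def)
  moreover have bdd: "bdd_above C"
    by (auto simp: C_def)
  ultimately have u: "Sup C \<in> C"
    using closed_contains_Sup by blast
  then have "t \<noteq> Sup C"
    using ft by (auto simp: C_def)
  then have su: "s \<le> Sup C" "Sup C < t"
    using u by (auto simp: C_def)
  have "f x < ereal c" if "Sup C < x" "x < t" for x
    using cSup_upper[OF _ bdd, of x] that su by (force simp: C_def)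
  then have "\<forall>\<^sub>F x in at_right (Sup C). f x < ereal c"
    using su by (auto simp: eventually_at_right_field intro!: exI[of _ t])
  then show ?thesis
    using u su by (auto simp: down_crossings_def C_def)
qed

lemma crossings_mono:
  assumes "a \<le> s" "t \<le> b"
  shows "up_crossings f c s t \<subseteq> up_crossings f c a b" "down_crossings f c s t \<subseteq> down_crossings f c a b"
  using assms by (auto simp: up_crossings_def down_crossings_def)

lemma crossings_split:
  assumes "s \<le> t" "t \<le> u"
  shows "up_crossings f c s u = up_crossings f c s t \<union> up_crossings f c t u"
    "up_crossings f c s t \<inter> up_crossings f c t u = {}"
    "down_crossings f c s u = down_crossings f c s t \<union> down_crossings f c t u"
    "down_crossings f c s t \<inter> down_crossings f c t u = {}"
  using assms by (auto simp: up_crossings_def down_crossings_def)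

text \<open>An indicator with the half-open convention of the crossings, so that net crossings are
  its increments.\<close>

definition above :: "(real \<Rightarrow> ereal) \<Rightarrow> real \<Rightarrow> real \<Rightarrow> int" where
  "above f c t = (if ereal c \<le> f t then 1 else 0)"

text \<open>After a down crossing at \<open>x\<close> the branch is below \<open>c\<close> and stays
  there, since a return would be an up crossing. Without a crossing both ends lie on the same
  side.\<close>

lemma crossings_local_right:
  assumes f: "continuous_on {x..z} f" and xz: "x \<le> z"
    and up: "up_crossings f c x z = {}" and down: "down_crossings f c x z \<subseteq> {x}"
  shows "- int (card (down_crossings f c x z)) = above f c z - above f c x"
proof (cases "x \<in> down_crossings f c x z")
  case True
  then have x: "x < z" "ereal c \<le> f x" "\<forall>\<^sub>F s in at_right x. f s < ereal c"
    by (auto simp: down_crossings_def)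
  then obtain b where b: "x < b" "\<And>s. x < s \<Longrightarrow> s < b \<Longrightarrow> f s < ereal c"
    by (auto simp: eventually_at_right_field)
  obtain s where s: "x < s" "s < min b z"
    using dense[of x "min b z"] b x by auto
  have "f z < ereal c"
  proof (rule ccontr)
    assume "\<not> f z < ereal c"
    then have "up_crossings f c s z \<noteq> {}"
      using s b by (intro first_up_crossing continuous_on_subset[OF f]) auto
    then show False
      using crossings_mono(1)[of x s z z f c] s up by auto
  qed
  moreover have "down_crossings f c x z = {x}"
    using True down by auto
  ultimately show ?thesis
    using x by (simp add: above_def)
next
  case False
  then have "down_crossings f c x z = {}"
    using down by auto
  moreover from this have "ereal c \<le> f x \<longleftrightarrow> ereal c \<le> f z"
    using first_up_crossing[OF f xz, of c] last_down_crossing[OF f xz, of c] up by force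
  ultimately show ?thesis
    by (simp add: above_def)
qed

lemma crossings_local_left:
  assumes f: "continuous_on {y..x} f" and yx: "y \<le> x"
    and down: "down_crossings f c y x = {}" and up: "up_crossings f c y x \<subseteq> {x}"
  shows "int (card (up_crossings f c y x)) = above f c x - above f c y"
proof (cases "x \<in> up_crossings f c y x")
  case True
  then have x: "y < x" "ereal c \<le> f x" "\<forall>\<^sub>F s in at_left x. f s < ereal c"
    by (auto simp: up_crossings_def)
  then obtain b where b: "b < x" "\<And>s. b < s \<Longrightarrow> s < x \<Longrightarrow> f s < ereal c"
    by (auto simp: eventually_at_left_field)
  obtain s where s: "max b y < s" "s < x"
    using dense[of "max b y" x] b x by auto
  have "f y < ereal c"
  proof (rule ccontr)
    assume "\<not> f y < ereal c"
    then have "down_crossings f c y s \<noteq> {}"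
      using s b by (intro last_down_crossing continuous_on_subset[OF f]) auto
    then show False
      using crossings_mono(2)[of y y s x f c] s down by auto
  qed
  moreover have "up_crossings f c y x = {x}"
    using True up by auto
  ultimately show ?thesis
    using x by (simp add: above_def)
next
  case False
  then have "up_crossings f c y x = {}"
    using up by auto
  moreover from this have "ereal c \<le> f y \<longleftrightarrow> ereal c \<le> f x"
    using first_up_crossing[OF f yx, of c] last_down_crossing[OF f yx, of c] down by force
  ultimately show ?thesis
    by (simp add: above_def)
qed

text \<open>Both sides are additive under subdivision. By finiteness each point has a neighbourhood
  with no crossing except possibly at that point, so a Bolzano argument reduces the claim to the two
  local lemmas.\<close>

lemma net_crossings_branch:
  fixes f :: "real \<Rightarrow> ereal"
  assumes ab: "a \<le> b" and f: "continuous_on {a..b} f"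
    and fin: "finite (up_crossings f c a b)" "finite (down_crossings f c a b)"
  shows "int (card (up_crossings f c a b)) - int (card (down_crossings f c a b))
    = above f c b - above f c a"
proof -
  define P where "P x y \<longleftrightarrow> (a \<le> x \<and> x \<le> y \<and> y \<le> b \<longrightarrow>
      int (card (up_crossings f c x y)) - int (card (down_crossings f c x y)) = above f c y - above f c x)"
    for x y
  have fin': "finite (up_crossings f c x y)" "finite (down_crossings f c x y)" if "a \<le> x" "y \<le> b" for x y
    using crossings_mono[OF that, of f c] fin by (auto intro: finite_subset)
  have trans: "P x z" if "P x y" "P y z" "x \<le> y" "y \<le> z" for x y z
    unfolding P_def
  proof
    assume *: "a \<le> x \<and> x \<le> z \<and> z \<le> b"
    then have "card (up_crossings f c x z) = card (up_crossings f c x y) + card (up_crossings f c y z)"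
      "card (down_crossings f c x z) = card (down_crossings f c x y) + card (down_crossings f c y z)"
      using that fin' crossings_split[OF that(3,4), of f c] by (simp_all add: card_Un_disjoint)
    then show "int (card (up_crossings f c x z)) - int (card (down_crossings f c x z))
        = above f c z - above f c x"
      using that * by (simp add: P_def)
  qed
  have "P a b"
    using ab
  proof (induction rule: Bolzano)
    case (trans x y z)
    then show ?case
      using \<open>\<And>x y z. P x y \<Longrightarrow> P y z \<Longrightarrow> x \<le> y \<Longrightarrow> y \<le> z \<Longrightarrow> P x z\<close> by blast
  next
    case (local x)
    let ?X = "up_crossings f c a b \<union> down_crossings f c a b"
    obtain d where d: "d > 0" "\<And>t. t \<in> ?X \<Longrightarrow> t \<noteq> x \<Longrightarrow> d \<le> dist x t"
      using finite_set_avoid[of ?X x] fin by auto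
    have "P y z" if "y \<le> x" "x \<le> z" "z - y < d" for y z
      unfolding P_def
    proof
      assume *: "a \<le> y \<and> y \<le> z \<and> z \<le> b"
      have X: "t = x" if "t \<in> ?X" "y \<le> t" "t \<le> z" for t
        using d(2)[OF that(1)] that \<open>y \<le> x\<close> \<open>x \<le> z\<close> \<open>z - y < d\<close> by (force simp: dist_real_def)
      have sub: "up_crossings f c s t \<subseteq> ?X" "down_crossings f c s t \<subseteq> ?X" if "a \<le> s" "t \<le> b" for s t
        using crossings_mono[OF that, of f c] by auto
      have "t = x" if "t \<in> up_crossings f c x z \<union> down_crossings f c x z" for t
        using that sub[of x z] * \<open>y \<le> x\<close> \<open>x \<le> z\<close>
        by (intro X) (auto simp: up_crossings_def down_crossings_def)
      then have "up_crossings f c x z = {}" "down_crossings f c x z \<subseteq> {x}"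
        by (auto simp: up_crossings_def)
      moreover from this have "- int (card (down_crossings f c x z)) = above f c z - above f c x"
        using * that by (intro crossings_local_right continuous_on_subset[OF f]) auto
      ultimately have "P x z"
        by (simp add: P_def)
      have "t = x" if "t \<in> up_crossings f c y x \<union> down_crossings f c y x" for t
        using that sub[of y x] * \<open>y \<le> x\<close> \<open>x \<le> z\<close>
        by (intro X) (auto simp: up_crossings_def down_crossings_def)
      then have "down_crossings f c y x = {}" "up_crossings f c y x \<subseteq> {x}"
        by (auto simp: down_crossings_def)
      moreover from this have "int (card (up_crossings f c y x)) = above f c x - above f c y"
        using * that by (intro crossings_local_left continuous_on_subset[OF f]) auto
      ultimately have "P y x"
        by (simp add: P_def)
      from \<open>\<And>x y z. P x y \<Longrightarrow> P y z \<Longrightarrow> x \<le> y \<Longrightarrow> y \<le> z \<Longrightarrow> P x z\<close>[OF this \<open>P x z\<close> that(1,2)]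
      show "int (card (up_crossings f c y z)) - int (card (down_crossings f c y z))
          = above f c z - above f c y"
        using * by (simp add: P_def)
    qed
    with d(1) show ?case
      by blast
  qed
  then show ?thesis
    using ab by (simp add: P_def)
qed

section \<open>Consequences of two-sided limits of the spectrum\<close>

lemma not_chiral_of_limits:
  assumes lim: "\<And>k. mset_tendsto S (T k) (at k)" and per: "\<And>k. T (k + 2 * pi) = T k"
  shows "\<not> chiral S"
proof
  assume "chiral S"
  then obtain N p m \<beta> c where br: "eigenvalue_branches S N p m \<beta>"
    and fin: "\<And>j i. j < N \<Longrightarrow> i < m \<Longrightarrow> finite (up_crossings (\<beta> j i) c (p j) (p (Suc j))) \<and>
                    finite (down_crossings (\<beta> j i) c (p j) (p (Suc j)))"
    and nz: "net_crossings N p m \<beta> c \<noteq> 0"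
    unfolding chiral_def by blast
  have p: "p j < p (Suc j)" and cont: "\<And>i. i < m \<Longrightarrow> continuous_on {p j..p (Suc j)} (\<beta> j i)"
    and S: "\<And>k. p j < k \<Longrightarrow> k < p (Suc j) \<Longrightarrow> S k = image_mset (\<lambda>i. \<beta> j i k) (mset_set {..<m})"
    if "j < N" for j
    using br that by (auto simp: eigenvalue_branches_def)
  \<comment> \<open>Branches of adjacent segments may be permuted at a cut, so the count refers to
    the limit multiset, not to individual branches.\<close>
  define n where "n t = int (size (filter_mset (\<lambda>x. ereal c \<le> x) (T t)))" for t
  have n: "(\<Sum>i<m. above (g i) c t) = n t" if "T t = image_mset (\<lambda>i. g i t) (mset_set {..<m})" for g t
  proof -
    have "n t = int (card {i \<in> {..<m}. ereal c \<le> g i t})"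
      by (simp add: n_def that filter_mset_image_mset)
    also have "\<dots> = (\<Sum>i<m. above (g i) c t)"
      by (simp add: above_def sum.If_cases Int_def)
    finally show ?thesis ..
  qed
  have seg: "(\<Sum>i<m. int (card (up_crossings (\<beta> j i) c (p j) (p (Suc j))))
      - int (card (down_crossings (\<beta> j i) c (p j) (p (Suc j))))) = n (p (Suc j)) - n (p j)" if j: "j < N" for j
  proof -
    have "\<forall>\<^sub>F k in at_right (p j). image_mset (\<lambda>i. \<beta> j i k) (mset_set {..<m}) = S k"
      using p[OF j] S[OF j] by (auto simp: eventually_at_right_field intro!: exI[of _ "p (Suc j)"])
    moreover have "mset_tendsto (\<lambda>k. image_mset (\<lambda>i. \<beta> j i k) (mset_set {..<m}))
        (image_mset (\<lambda>i. \<beta> j i (p j)) (mset_set {..<m})) (at_right (p j))"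
      using continuous_on_Icc_at_rightD[OF cont[OF j] p[OF j]] by (intro mset_tendsto_branches) auto
    ultimately have "mset_tendsto S (image_mset (\<lambda>i. \<beta> j i (p j)) (mset_set {..<m})) (at_right (p j))"
      by (rule mset_tendsto_cong[rotated])
    \<comment> \<open>Branch end values and \<open>T\<close> are limits of the same spectrum;
      uniqueness identifies them even where \<open>S\<close> itself has an exceptional
      value.\<close>
    then have left: "T (p j) = image_mset (\<lambda>i. \<beta> j i (p j)) (mset_set {..<m})"
      by (intro mset_tendsto_unique[OF mset_tendsto_mono[OF lim at_le]]) auto
    have "\<forall>\<^sub>F k in at_left (p (Suc j)). image_mset (\<lambda>i. \<beta> j i k) (mset_set {..<m}) = S k"
      using p[OF j] S[OF j] by (auto simp: eventually_at_left_field intro!: exI[of _ "p j"])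
    moreover have "mset_tendsto (\<lambda>k. image_mset (\<lambda>i. \<beta> j i k) (mset_set {..<m}))
        (image_mset (\<lambda>i. \<beta> j i (p (Suc j))) (mset_set {..<m})) (at_left (p (Suc j)))"
      using continuous_on_Icc_at_leftD[OF cont[OF j] p[OF j]] by (intro mset_tendsto_branches) auto
    ultimately have "mset_tendsto S (image_mset (\<lambda>i. \<beta> j i (p (Suc j))) (mset_set {..<m})) (at_left (p (Suc j)))"
      by (rule mset_tendsto_cong[rotated])
    then have right: "T (p (Suc j)) = image_mset (\<lambda>i. \<beta> j i (p (Suc j))) (mset_set {..<m})"
      by (intro mset_tendsto_unique[OF mset_tendsto_mono[OF lim at_le]]) auto
    have "(\<Sum>i<m. int (card (up_crossings (\<beta> j i) c (p j) (p (Suc j))))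
        - int (card (down_crossings (\<beta> j i) c (p j) (p (Suc j)))))
        = (\<Sum>i<m. above (\<beta> j i) c (p (Suc j)) - above (\<beta> j i) c (p j))"
      using p[OF j] cont[OF j] fin[OF j] by (intro sum.cong net_crossings_branch) auto
    then show ?thesis
      using n[where g = "\<beta> j", OF left] n[where g = "\<beta> j", OF right] by (simp add: sum_subtractf)
  qed
  have "net_crossings N p m \<beta> c = (\<Sum>j<N. n (p (Suc j)) - n (p j))"
    unfolding net_crossings_def using seg by (intro sum.cong) auto
  also have "\<dots> = n (p N) - n (p 0)"
    by (rule sum_lessThan_telescope)
  also have "p N = p 0 + 2 * pi"
    using br by (simp add: eigenvalue_branches_def)
  finally show False
    using nz by (simp add: n_def per)
qed

lemma continuous_up_to_removable_of_limits:
  assumes lim: "\<And>k. mset_tendsto S (T k) (at k)" and T: "\<And>k. k \<notin> F \<Longrightarrow> T k = S k"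
    and F: "\<And>k. k + 2 * pi \<in> F \<longleftrightarrow> k \<in> F" "finite (F \<inter> {0..<2 * pi})"
    and disc: "\<And>k0. \<forall>\<^sub>F k in at k0. k \<notin> F"
  shows "continuous_up_to_removable S"
proof -
  have "\<forall>\<^sub>F k in at k0. size (T k0) = size (T k)" for k0
    using mset_tendsto_size[OF lim[of k0]] disc[of k0] by eventually_elim (simp add: T)
  \<comment> \<open>Locally constant on the connected real line, hence constant, across the momenta
    in \<open>F\<close> as well.\<close>
  then have size: "size (T k) = size (T 0)" for k
    using connected_local_const[of UNIV k 0 "\<lambda>k. size (T k)"] by simp
  have "mset_tendsto S (T k) (at_left k) \<and> mset_tendsto S (T k) (at_right k)" for k
    using mset_tendsto_mono[OF lim[of k] at_le] by auto
  moreover have "size (S k) = size (T 0)" if "k \<notin> F" for k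
    using size[of k] T[OF that] by simp
  moreover have "mset_tendsto S (S k) (at k)" if "k \<notin> F" for k
    using lim[of k] T[OF that] by simp
  ultimately show ?thesis
    unfolding continuous_up_to_removable_def using F by (intro exI[of _ F]) blast
qed

section \<open>Extension to the exceptional momenta\<close>

context momentum_channel
begin

lemma inner_P: "v \<bullet> (P *v v) = (norm (P *v v))\<^sup>2"
  using inner_ctranspose[of v P "P *v v"] by (simp add: matrix_vector_mul_assoc power2_norm_eq_inner)

text \<open>With \<open>p = v \<bullet> (P *v v)\<close>, which lies between \<open>0\<close> and
  the squared norm of \<open>v\<close>, the form is at most \<open>p\<close> plus twice the
  difference of that squared norm and \<open>p\<close>.\<close>

lemma form_H: "\<bar>v \<bullet> (H *v v)\<bar> \<le> 2 * (norm v)\<^sup>2"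
proof -
  have "v \<bullet> (P *v v) \<le> (norm v)\<^sup>2"
    unfolding inner_P using norm_P_le by (simp add: power_mono)
  moreover have "0 \<le> v \<bullet> (P *v v)"
    unfolding inner_P by simp
  moreover have "v \<bullet> (H *v v) = v \<bullet> ((\<i> *c G) *v v) + (2 * (norm v)\<^sup>2 - 2 * (v \<bullet> (P *v v)))"
  proof -
    have "H *v v = (\<i> *c G) *v v + 2 *\<^sub>R (v - P *v v)"
      by (simp add: H_def matrix_vector_mult_add_rdistrib matrix_vector_mult_diff_rdistrib scaleR_cvec)
    then show ?thesis
      by (simp only: inner_add_right inner_scaleR_right inner_diff_right power2_norm_eq_inner) simp
  qed
  ultimately show ?thesis
    using form_G[of v] by linarith
qed

text \<open>What counts is that the bound is the same for all channels, hence uniform in the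
  momentum.\<close>

lemma H_entry_bound: "cmod (H $ i $ j) \<le> 4"
proof -
  \<comment> \<open>Polarization and the parallelogram law: four times the left-hand side is at most
    \<open>2 * 4\<close>.\<close>
  have pol: "\<bar>u \<bullet> (H *v v)\<bar> \<le> 2" if "norm u = 1" "norm v = 1" for u v
  proof -
    have sym: "v \<bullet> (H *v u) = u \<bullet> (H *v v)"
      using inner_ctranspose[of v H u] by (simp add: hermitian_H inner_commute)
    have "(u + v) \<bullet> (H *v (u + v)) - (u - v) \<bullet> (H *v (u - v)) = 4 * (u \<bullet> (H *v v))"
      by (simp add: matrix_vector_right_distrib matrix_vector_mult_diff_distrib inner_add_left
          inner_add_right inner_diff_left inner_diff_right sym)
    moreover have "(norm (u + v))\<^sup>2 + (norm (u - v))\<^sup>2 = 4"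
      using that by (simp add: power2_norm_eq_inner inner_add_left inner_add_right inner_diff_left
          inner_diff_right inner_commute norm_eq_1)
    ultimately show ?thesis
      using form_H[of "u + v"] form_H[of "u - v"] by linarith
  qed
  have H1: "(H *v axis j 1) $ i = H $ i $ j"
    by (simp add: matrix_vector_mult_def axis_def if_distrib[of "\<lambda>z. _ * z"] cong: if_cong)
  have "axis i 1 \<bullet> (H *v axis j 1) = Re (H $ i $ j)"
    by (simp add: inner_axis' H1 inner_complex_def)
  moreover have "axis i \<i> \<bullet> (H *v axis j 1) = Im (H $ i $ j)"
    by (simp add: inner_axis' H1 inner_complex_def)
  ultimately have "\<bar>Re (H $ i $ j)\<bar> \<le> 2" "\<bar>Im (H $ i $ j)\<bar> \<le> 2"
    using pol[of "axis i 1" "axis j 1"] pol[of "axis i \<i>" "axis j 1"] by simp_all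
  then show ?thesis
    using cmod_le[of "H $ i $ j"] by linarith
qed

end

lemma tendsto_matrixI:
  fixes M :: "'a \<Rightarrow> complex^'c^'r"
  assumes "\<And>i j. ((\<lambda>x. M x $ i $ j) \<longlongrightarrow> L $ i $ j) F"
  shows "(M \<longlongrightarrow> L) F"
  by (intro vec_tendstoI assms)

text \<open>All entries of \<open>H\<close> share one denominator up to powers of
  \<open>cis k\<close>, so exceptional momenta can occur only at zeros of a single polynomial on the
  unit circle.\<close>

lemma momentum_H_extension:
  fixes A B :: "real \<Rightarrow> complex^'m^'m"
  assumes ch: "\<And>k. momentum_channel (A k) (B k)" and A: "trig_matrix A" and B: "trig_matrix B"
  shows "\<exists>c H0. c \<noteq> 0 \<and> (\<forall>k. ((\<lambda>k. momentum_channel.H (A k) (B k)) \<longlongrightarrow> H0 k) (at k)) \<and>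
    (\<forall>k. poly c (cis k) \<noteq> 0 \<longrightarrow> H0 k = momentum_channel.H (A k) (B k))"
proof -
  define K where "K k = momentum_channel.H (A k) (B k)" for k
  define b where "b k = \<i> *c A k - 2 *c (mat 1 - B k ** ctranspose (B k))" for k
  have b: "trig_matrix b"
    unfolding b_def[abs_def] using A B
    by (intro trig_matrix_diff trig_matrix_cscale trig_matrix_mult trig_matrix_ctranspose trig_matrix_const)
  define \<delta> where "\<delta> e k = det (stein_family B e k)" for e k
  \<comment> \<open>The Cramer numerators: \<open>\<nu> l / \<delta>\<close> is the component at
    index \<open>l\<close> of the regularized solution.\<close>
  define \<nu> where "\<nu> l e k = det (\<chi> p q. if q = l then vec_of_mat (b k) $ p else stein_family B e k $ p $ q)" for l e k
  have \<delta>: "bitrig \<delta>"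
    unfolding \<delta>_def[abs_def] by (intro bitrig_det bitrig_stein_family B)
  have \<nu>: "bitrig (\<nu> l)" for l
    unfolding \<nu>_def[abs_def]
  proof (intro bitrig_det)
    fix p q
    show "bitrig (\<lambda>e k. (\<chi> p q. if q = l then vec_of_mat (b k) $ p else stein_family B e k $ p $ q) $ p $ q)"
      using b bitrig_stein_family[OF B, of p q] by (cases "q = l") (simp_all add: trig_matrix_def)
  qed
  have nz: "\<delta> (complex_of_real e) k \<noteq> 0" if "e > 0" for e k
  proof -
    interpret momentum_channel "A k" "B k" by (rule ch)
    show ?thesis
      unfolding \<delta>_def stein_family_of_real using that
      by (intro stein_matrix_invertible stable_scaled_B) auto
  qed
  have lim: "((\<lambda>e. \<nu> (i, j) (complex_of_real e) k / \<delta> (complex_of_real e) k)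
      \<longlongrightarrow> K k $ i $ j - 2 * mat 1 $ i $ j) (at_right 0)" for i j k
  proof -
    interpret momentum_channel "A k" "B k" by (rule ch)
    show ?thesis
      using H_limit[of i j] unfolding \<delta>_def \<nu>_def stein_family_of_real K_def b_def E_def cramer_component_def .
  qed
  have "\<exists>c. c \<noteq> 0 \<and> (\<forall>\<nu> g. bitrig \<nu> \<longrightarrow>
      (\<forall>k. ((\<lambda>e. \<nu> (complex_of_real e) k / \<delta> (complex_of_real e) k) \<longlongrightarrow> g k) (at_right 0)) \<longrightarrow>
      (\<exists>n p. \<forall>k. poly c (cis k) * cis k ^ n * g k = poly p (cis k)))"
    by (rule bitrig_limit_rational[OF \<delta> nz])
  then obtain c where c: "c \<noteq> 0" and rational: "\<forall>\<nu> g. bitrig \<nu> \<longrightarrow>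
      (\<forall>k. ((\<lambda>e. \<nu> (complex_of_real e) k / \<delta> (complex_of_real e) k) \<longlongrightarrow> g k) (at_right 0)) \<longrightarrow>
      (\<exists>n p. \<forall>k. poly c (cis k) * cis k ^ n * g k = poly p (cis k))"
    by (elim exE conjE)
  have bound: "cmod (K k $ i $ j - 2 * mat 1 $ i $ j) \<le> 6" for i j k
  proof -
    interpret momentum_channel "A k" "B k" by (rule ch)
    have "cmod (2 * mat 1 $ i $ j) \<le> 2"
      by (simp add: mat_def)
    then show ?thesis
      using H_entry_bound[of i j] norm_triangle_ineq4[of "K k $ i $ j" "2 * mat 1 $ i $ j"]
      by (simp add: K_def)
  qed
  have "\<exists>l. ((\<lambda>k. K k $ i $ j) \<longlongrightarrow> l) (at k0) \<and> (poly c (cis k0) \<noteq> 0 \<longrightarrow> l = K k0 $ i $ j)" for i j k0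
  proof -
    define g where "g k = K k $ i $ j - 2 * mat 1 $ i $ j" for k
    obtain n p where np: "\<And>k. poly c (cis k) * cis k ^ n * g k = poly p (cis k)"
      using rational[rule_format, OF \<nu> lim] unfolding g_def by blast
    let ?q = "c * monom 1 n"
    have q: "?q \<noteq> 0"
      using c by simp
    have rat: "poly ?q (cis k) * g k = poly p (cis k)" for k
      using np[of k] by (simp add: poly_monom)
    have "\<forall>\<^sub>F k in at k0. poly ?q (cis k) * g k = poly p (cis k)"
      using rat by simp
    moreover have "cmod (g k) \<le> 6" for k
      unfolding g_def by (rule bound)
    ultimately obtain l where l: "(g \<longlongrightarrow> l) (at k0)"
      using bounded_rational_limit[OF q] by blast
    \<comment> \<open>The identity holds at \<open>k0\<close> itself and, by continuity, also for
      the limit; the nonzero factor cancels.\<close>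
    have "l = g k0" if "poly c (cis k0) \<noteq> 0"
    proof -
      have "((\<lambda>k. poly ?q (cis k) * g k) \<longlongrightarrow> poly ?q (cis k0) * l) (at k0)"
        by (intro tendsto_mult tendsto_poly_cis l)
      moreover have "((\<lambda>k. poly ?q (cis k) * g k) \<longlongrightarrow> poly p (cis k0)) (at k0)"
        unfolding rat by (rule tendsto_poly_cis)
      ultimately have "poly ?q (cis k0) * l = poly ?q (cis k0) * g k0"
        unfolding rat by (intro tendsto_unique) auto
      then show ?thesis
        using that by (simp add: poly_monom)
    qed
    moreover have "((\<lambda>k. K k $ i $ j) \<longlongrightarrow> l + 2 * mat 1 $ i $ j) (at k0)"
      using tendsto_add[OF l tendsto_const[of "2 * mat 1 $ i $ j"]] by (simp add: g_def)
    ultimately show ?thesis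
      by (intro exI[of _ "l + 2 * mat 1 $ i $ j"]) (simp add: g_def)
  qed
  then obtain h where h: "\<And>i j k0. ((\<lambda>k. K k $ i $ j) \<longlongrightarrow> h i j k0) (at k0)"
    "\<And>i j k0. poly c (cis k0) \<noteq> 0 \<Longrightarrow> h i j k0 = K k0 $ i $ j"
    by metis
  have "(K \<longlongrightarrow> (\<chi> i j. h i j k)) (at k)" for k
    using h(1) by (intro tendsto_matrixI) simp
  moreover have "(\<chi> i j. h i j k) = K k" if "poly c (cis k) \<noteq> 0" for k
    using h(2)[OF that] by (simp add: vec_eq_iff)
  ultimately show ?thesis
    using c unfolding K_def by (intro exI[of _ c] exI[of _ "\<lambda>k. \<chi> i j. h i j k"]) blast
qed

lemma hermitian_limit:
  fixes L :: "complex^'m^'m"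
  assumes "(M \<longlongrightarrow> L) F" "\<And>k. hermitian (M k)" "F \<noteq> bot"
  shows "hermitian L"
proof -
  have "cnj (L $ j $ i) = L $ i $ j" for i j
  proof (rule tendsto_unique[OF assms(3)])
    have entry: "((\<lambda>k. M k $ i $ j) \<longlongrightarrow> L $ i $ j) F" for i j
      by (intro tendsto_vec_nth assms(1))
    show "((\<lambda>k. M k $ i $ j) \<longlongrightarrow> L $ i $ j) F"
      by (rule entry)
    have "M k $ i $ j = cnj (M k $ j $ i)" for k
      using assms(2)[of k] by (metis ctranspose_nth)
    then show "((\<lambda>k. M k $ i $ j) \<longlongrightarrow> cnj (L $ j $ i)) F"
      using tendsto_cnj[OF entry[of j i]] by simp
  qed
  then show ?thesis
    by (simp add: vec_eq_iff)
qed

theorem theorem3p2: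
  fixes Ao Bo Ae Be :: "real^('n::finite + 'n)^('n + 'n)"
  assumes "gaussian_channel Ao Bo"
    and "gaussian_channel Ae Be"
  shows "continuous_up_to_removable (bulk_entanglement_spectrum Ao Bo Ae Be) \<and>
    \<not> chiral (bulk_entanglement_spectrum Ao Bo Ae Be)"
proof -
  define A B where "A = A_mat Ao Ae Be" and "B = B_mat Bo Be"
  define S where "S = bulk_entanglement_spectrum Ao Bo Ae Be"
  define H where "H k = momentum_channel.H (A k) (B k)" for k
  have ch: "momentum_channel (A k) (B k)" for k
    unfolding A_def B_def by (rule momentum_channel_period[OF assms])
  have hH: "hermitian (H k)" for k
    unfolding H_def by (rule momentum_channel.hermitian_H[OF ch])
  have H_periodic: "H (k + 2 * pi) = H k" for k
    by (simp add: H_def A_def B_def A_mat_def B_mat_def U_mat_periodic)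
  have "\<exists>d W. eigenframe (H k) d W" for k
    using hermitian_eigenframe[OF hH] by metis
  then obtain d W where fr: "\<And>k. eigenframe (H k) (d k) (W k)"
    by metis
  have S: "S k = frame_energies (d k)" for k
    using momentum_channel.spectrum_eq_frame_energies[OF ch, of k] fr[of k]
    by (simp add: S_def bulk_entanglement_spectrum_def Let_def A_def B_def H_def)
  have "\<exists>c H0. c \<noteq> 0 \<and> (\<forall>k. (H \<longlongrightarrow> H0 k) (at k)) \<and> (\<forall>k. poly c (cis k) \<noteq> 0 \<longrightarrow> H0 k = H k)"
    unfolding H_def[abs_def] A_def B_def
    by (rule momentum_H_extension[OF momentum_channel_period[OF assms] trig_matrix_A trig_matrix_B])
  then obtain c H0 where c: "c \<noteq> 0" and lim: "\<And>k. (H \<longlongrightarrow> H0 k) (at k)"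
    and H0: "\<And>k. poly c (cis k) \<noteq> 0 \<Longrightarrow> H0 k = H k"
    by auto
  have h0: "hermitian (H0 k)" for k
    by (rule hermitian_limit[OF lim hH]) simp
  have "\<exists>d W. eigenframe (H0 k) d W" for k
    using hermitian_eigenframe[OF h0] by metis
  then obtain d0 W0 where fr0: "\<And>k. eigenframe (H0 k) (d0 k) (W0 k)"
    by metis
  define T where "T k = frame_energies (d0 k)" for k
  \<comment> \<open>The limit multiset is read off from \<open>H0\<close>, so it exists also where
    the dimension of the dissipative space jumps.\<close>
  have ST: "mset_tendsto S (T k) (at k)" for k
    unfolding S[abs_def] T_def
  proof (rule frame_energies_continuous[OF lim fr _ h0 fr0])
    show "d k $ i = 2 \<or> d k $ i \<in> {-1..1}" for k i
      using momentum_channel.frame_range[OF ch] fr unfolding H_def by blast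
  qed
  have H0_periodic: "H0 (k + 2 * pi) = H0 k" for k
  proof (rule tendsto_unique[OF _ _ lim[of k]])
    show "(H \<longlongrightarrow> H0 (k + 2 * pi)) (at k)"
      using LIM_offset[OF lim[of "k + 2 * pi"], of "2 * pi"] by (simp add: H_periodic)
  qed simp
  have "T (k + 2 * pi) = T k" for k
    unfolding T_def using eigenframe_unique[OF fr0[of "k + 2 * pi", unfolded H0_periodic] fr0 h0] .
  then have "\<not> chiral S"
    by (rule not_chiral_of_limits[OF ST])
  moreover have "continuous_up_to_removable S"
  proof (rule continuous_up_to_removable_of_limits[OF ST])
    let ?F = "{k. poly c (cis k) = 0}"
    show "T k = S k" if "k \<notin> ?F" for k
    proof -
      have "H0 k = H k"
        using H0 that by simp
      from eigenframe_unique[OF fr0[of k, unfolded this] fr hH] show ?thesis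
        by (simp only: S T_def)
    qed
    have "cis (k + 2 * pi) = cis k" for k
      by (simp add: complex_eq_iff)
    then show "k + 2 * pi \<in> ?F \<longleftrightarrow> k \<in> ?F" for k
      by simp
    \<comment> \<open>Each of the finitely many zeros of \<open>c\<close> is met by at most one
      momentum per period.\<close>
    have "inj_on cis {0..<2 * pi}"
      by (intro inj_onI cis_eq_imp_eq) auto
    then show "finite (?F \<inter> {0..<2 * pi})"
      using finite_vimage_IntI[OF poly_roots_finite[OF c], of cis "{0..<2 * pi}"] by (simp add: vimage_def)
    show "\<forall>\<^sub>F k in at k0. k \<notin> ?F" for k0
      using poly_cis_eventually_neq[OF c] by simp
  qed
  ultimately show ?thesis
    by (simp add: S_def)
qed

end
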